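(* Let $\theta<\kappa$ be infinite regular cardinals and suppose that $\mathrm{onto}(\mathrm{NS}_\kappa,\theta)$ fails. Then: (1) $\kappa$ is greatly Mahlo; (2) $\diamondsuit^*(\mathrm{Reg}(\kappa))$ fails; (3) $\mathrm{Refl}(\kappa,\kappa,\mathrm{Reg}(\kappa))$ holds; (4) $\square(\kappa,{<}\mu)$ fails for every $\mu<\kappa$; (5) $\kappa\nrightarrow[\kappa]^2_\theta$ fails; in particular, there are no $\kappa$-Souslin trees.
   Context: Colourings $c:[\kappa]^2\to\theta$ are defined on pairs $(\alpha,\beta)$, $\alpha<\beta<\kappa$; $A\circledast B:=\{(\alpha,\beta)\in A\times B\mid\alpha<\beta\}$. $\mathrm{onto}(\mathrm{NS}_\kappa,\theta)$ asserts the existence of $c:[\kappa]^2\to\theta$ such that for every stationary $B\subseteq\kappa$ there is $\eta<\kappa$ with $c[\{\eta\}\circledast B]=\theta$. $\kappa\nrightarrow[\kappa]^2_\theta$ asserts the existence of $c:[\kappa]^2\to\theta$ with $c``[B]^2=\theta$ for every $B\in[\kappa]^\kappa$. $\mathrm{Reg}(\kappa)$ is the set of infinite regular cardinals below $\kappa$. $\mathrm{Tr}(S):=\{\alpha<\kappa\mid\mathrm{cf}(\alpha)>\omega,\ S\cap\alpha\text{ stationary in }\alpha\}$; iterated traces: $\mathrm{Tr}^0(S)=S$, $\mathrm{Tr}^{\alpha+1}(S)=\mathrm{Tr}(\mathrm{Tr}^\alpha(S))$, $\mathrm{Tr}^\alpha(S)=\bigcap_{\alpha'<\alpha}\mathrm{Tr}^{\alpha'}(S)$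 for limit $\alpha<\kappa$, and for limit $\kappa\le\alpha<\kappa^+$ with a bijection $\pi:\kappa\leftrightarrow\alpha$, $\mathrm{Tr}^\alpha(S)=\{\beta<\kappa\mid\beta\in\bigcap_{\alpha'<\beta}\mathrm{Tr}^{\pi(\alpha')}(S)\}$. $\kappa$ is greatly Mahlo iff $\mathrm{Tr}^\alpha(\mathrm{Reg}(\kappa))$ is stationary for all $\alpha<\kappa^+$. $\diamondsuit^*(S)$: there is $\langle\mathcal A_\beta\mid\beta\in S\rangle$, $\mathcal A_\beta\subseteq\mathcal P(\beta)$, $|\mathcal A_\beta|\le|\beta|$, such that for every $A\subseteq\kappa$ there is a club $C$ with $A\cap\beta\in\mathcal A_\beta$ for all $\beta\in C\cap S$. $\mathrm{Refl}(\kappa,\kappa,\mathrm{Reg}(\kappa))$: for every sequence $\langle S_i\mid i<\kappa\rangle$ of stationary subsets of $\kappa$ there is $\delta\in\mathrm{Reg}(\kappa)$ with $\delta\in\bigcap_{i<\delta}\mathrm{Tr}(S_i)$. $\square(\kappa,{<}\mu)$: there is $\langle\mathcal C_\alpha\mid\alpha<\kappa\rangle$ with $1\le|\mathcal C_\alpha|<\mu$, each $C\in\mathcal C_\alpha$ a club in $\alpha$, such that $C\cap\beta\in\mathcal C_\beta$ whenever $C\in\mathcal C_\alpha$ and $\beta$ is an accumulation point of $C$ below $\alpha$, and there is no club $D\subseteq\kappa$ with $D\cap\alpha\in\mathcal C_\alpha$ for every accumulation point $\alpha$ of $D$. *)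

theory Defs
  imports Main "HOL-Library.FuncSet"
begin

unbundle cardinal_syntax

text \<open>
  The cardinal \<open>\<kappa>\<close> is a type \<open>'k\<close> of class \<open>wellorder\<close> whose order is that of an initial ordinal;
  its elements are the ordinals below \<open>\<kappa>\<close>.  An ordinal \<open>\<alpha> < \<kappa>\<close>, as a set of ordinals, is
  \<open>{..<\<alpha>}\<close>, and \<open>\<kappa>\<close> itself is \<open>UNIV\<close>.  Notions that make sense both for \<open>\<kappa>\<close> and for the
  ordinals below it take such an initial segment \<open>D\<close> as argument.
\<close>

definition ord_rel :: "'a::order set \<Rightarrow> 'a rel" where
  "ord_rel D = {(x, y). x \<in> D \<and> y \<in> D \<and> x \<le> y}"

definition cardinal :: "'k::wellorder set \<Rightarrow> bool" where
  "cardinal D \<longleftrightarrow> Card_order (ord_rel D)"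

definition infinite_regular :: "'k::wellorder set \<Rightarrow> bool" where
  "infinite_regular D \<longleftrightarrow> infinite D \<and> cardinal D \<and> regularCard (ord_rel D)"

definition Reg :: "'k::wellorder set" where
  "Reg = {\<alpha>. infinite_regular {..<\<alpha>}}"

text \<open>The ordinal \<open>\<omega>\<close>; it exists below \<open>\<kappa>\<close> as soon as \<open>\<kappa>\<close> is uncountable.\<close>

definition omega :: "'k::wellorder" where
  "omega = (LEAST \<alpha>. infinite {..<\<alpha>})"

definition unbounded_in :: "'k::wellorder set \<Rightarrow> 'k set \<Rightarrow> bool" where
  "unbounded_in D X \<longleftrightarrow> X \<subseteq> D \<and> (\<forall>\<alpha>\<in>D. \<exists>\<beta>\<in>X. \<alpha> \<le> \<beta>)"

definition cf :: "'k::wellorder \<Rightarrow> 'k" where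
  "cf \<alpha> = (LEAST \<gamma>. \<exists>X. unbounded_in {..<\<alpha>} X \<and> (ord_rel X, ord_rel {..<\<gamma>}) \<in> ordIso)"

definition acc_points :: "'k::wellorder set \<Rightarrow> 'k set" where
  "acc_points C = {\<beta>. {..<\<beta>} \<noteq> {} \<and> (\<forall>\<gamma><\<beta>. \<exists>\<delta>\<in>C. \<gamma> < \<delta> \<and> \<delta> < \<beta>)}"

text \<open>Since unboundedness is meant with respect to \<open>\<le>\<close>, the clubs in a successor ordinal
  \<open>\<gamma> + 1\<close> are the closed sets with maximum \<open>\<gamma>\<close>, and the empty set is a club in \<open>0\<close>.\<close>

definition club_in :: "'k::wellorder set \<Rightarrow> 'k set \<Rightarrow> bool" where
  "club_in D C \<longleftrightarrow> unbounded_in D C \<and> acc_points C \<inter> D \<subseteq> C"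

definition stationary_in :: "'k::wellorder set \<Rightarrow> 'k set \<Rightarrow> bool" where
  "stationary_in D S \<longleftrightarrow> S \<subseteq> D \<and> (\<forall>C. club_in D C \<longrightarrow> S \<inter> C \<noteq> {})"

definition Tr :: "'k::wellorder set \<Rightarrow> 'k set" where
  "Tr S = {\<alpha>. omega < cf \<alpha> \<and> stationary_in {..<\<alpha>} (S \<inter> {..<\<alpha>})}"

definition circledast :: "'k::wellorder set \<Rightarrow> 'k set \<Rightarrow> ('k \<times> 'k) set"  (infixl "\<circledast>" 75) where
  "A \<circledast> B = {(\<alpha>, \<beta>) \<in> A \<times> B. \<alpha> < \<beta>}"

definition onto_NS :: "'k::wellorder \<Rightarrow> bool" where
  "onto_NS \<theta> \<longleftrightarrow>
     (\<exists>c \<in> (UNIV :: 'k set) \<circledast> UNIV \<rightarrow> {..<\<theta>}.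
        \<forall>B. stationary_in UNIV B \<longrightarrow> (\<exists>\<eta>. c ` ({\<eta>} \<circledast> B) = {..<\<theta>}))"

text \<open>The relation \<open>\<kappa> \<nrightarrow> [\<kappa>]\<^sup>2\<^sub>\<theta>\<close>.\<close>

definition negative_square_bracket :: "'k::wellorder \<Rightarrow> bool" where
  "negative_square_bracket \<theta> \<longleftrightarrow>
     (\<exists>c \<in> (UNIV :: 'k set) \<circledast> UNIV \<rightarrow> {..<\<theta>}.
        \<forall>B. |B| =o |UNIV :: 'k set| \<longrightarrow> c ` (B \<circledast> B) = {..<\<theta>})"

definition diamond_star :: "'k::wellorder set \<Rightarrow> bool" where
  "diamond_star S \<longleftrightarrow>
     (\<exists>\<A> :: 'k \<Rightarrow> 'k set set. (\<forall>\<beta>\<in>S. \<A> \<beta> \<subseteq> Pow {..<\<beta>} \<and> |\<A> \<beta>| \<le>o |{..<\<beta>}| ) \<and>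
          (\<forall>A. \<exists>C. club_in UNIV C \<and> (\<forall>\<beta> \<in> C \<inter> S. A \<inter> {..<\<beta>} \<in> \<A> \<beta>)))"

text \<open>\<open>Refl(\<kappa>, \<kappa>, T)\<close>, for \<open>T \<subseteq> \<kappa>\<close>.\<close>

definition stationary_Refl :: "'k::wellorder set \<Rightarrow> bool" where
  "stationary_Refl T \<longleftrightarrow>
     (\<forall>S :: 'k \<Rightarrow> 'k set. (\<forall>i. stationary_in UNIV (S i)) \<longrightarrow>
        (\<exists>\<delta>\<in>T. \<delta> \<in> (\<Inter>i\<in>{..<\<delta>}. Tr (S i))))"

text \<open>The principle \<open>\<square>(\<kappa>, <\<mu>)\<close>, for a cardinal \<open>\<mu> < \<kappa>\<close>.\<close>

definition square :: "'k::wellorder \<Rightarrow> bool" where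
  "square \<mu> \<longleftrightarrow>
     (\<exists>\<C> :: 'k \<Rightarrow> 'k set set. (\<forall>\<alpha>. \<C> \<alpha> \<noteq> {} \<and> |\<C> \<alpha>| <o |{..<\<mu>}| \<and> (\<forall>C \<in> \<C> \<alpha>. club_in {..<\<alpha>} C)) \<and>
          (\<forall>\<alpha>. \<forall>C \<in> \<C> \<alpha>. \<forall>\<beta> \<in> acc_points C \<inter> {..<\<alpha>}. C \<inter> {..<\<beta>} \<in> \<C> \<beta>) \<and>
          \<not> (\<exists>D. club_in UNIV D \<and> (\<forall>\<alpha> \<in> acc_points D. D \<inter> {..<\<alpha>} \<in> \<C> \<alpha>)))"


subsection \<open>Iterated traces\<close>

text \<open>The ordinals below \<open>\<kappa>\<^sup>+\<close>.\<close>

typedef 'k succ_card = "Field (cardSuc |UNIV :: 'k set| )"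
proof -
  have "|UNIV :: 'k set| <o cardSuc |UNIV :: 'k set|"
    by (rule cardSuc_greater) (rule card_of_Card_order)
  then have "cardSuc |UNIV :: 'k set| \<noteq> {}"
    by (metis Field_card_of Field_empty UNIV_not_empty card_of_empty3 card_of_mono2
        ordLess_imp_ordLeq)
  then show ?thesis
    by (auto simp: Field_def)
qed

instantiation succ_card :: (type) wellorder
begin

definition less_eq_succ_card :: "'a succ_card \<Rightarrow> 'a succ_card \<Rightarrow> bool" where
  "less_eq_succ_card x y \<longleftrightarrow>
     (Rep_succ_card x, Rep_succ_card y) \<in> cardSuc |UNIV :: 'a set|"

definition less_succ_card :: "'a succ_card \<Rightarrow> 'a succ_card \<Rightarrow> bool" where
  "less_succ_card x y \<longleftrightarrow> x \<le> y \<and> x \<noteq> y"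

instance
proof -
  let ?r = "cardSuc |UNIV :: 'a set|"
  have wo: "Well_order ?r"
    by (meson cardSuc_Card_order card_of_Card_order card_order_on_well_order_on)
  then have refl: "\<And>a. a \<in> Field ?r \<Longrightarrow> (a, a) \<in> ?r" and tr: "trans ?r" and an: "antisym ?r"
    and tot: "\<And>a b. a \<in> Field ?r \<Longrightarrow> b \<in> Field ?r \<Longrightarrow> (a, b) \<in> ?r \<or> (b, a) \<in> ?r"
    and wf: "wf (?r - Id)"
    by (auto simp: well_order_on_def linear_order_on_def partial_order_on_def preorder_on_def
        refl_on_def total_on_def) metis
  show "OFCLASS('a succ_card, wellorder_class)"
  proof (intro_classes)
    fix x y z :: "'a succ_card"
    show "x < y \<longleftrightarrow> x \<le> y \<and> \<not> y \<le> x"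
      unfolding less_succ_card_def less_eq_succ_card_def
      using an refl Rep_succ_card Rep_succ_card_inject unfolding antisym_def by metis
    show "x \<le> x"
      by (simp add: less_eq_succ_card_def refl Rep_succ_card)
    show "x \<le> y \<Longrightarrow> y \<le> z \<Longrightarrow> x \<le> z"
      unfolding less_eq_succ_card_def using tr by (meson transD)
    show "x \<le> y \<Longrightarrow> y \<le> x \<Longrightarrow> x = y"
      unfolding less_eq_succ_card_def using an Rep_succ_card_inject by (metis antisymD)
    show "x \<le> y \<or> y \<le> x"
      unfolding less_eq_succ_card_def using tot Rep_succ_card by blast
  next
    fix P :: "'a succ_card \<Rightarrow> bool" and a :: "'a succ_card"
    assume step: "\<And>x. (\<And>y. y < x \<Longrightarrow> P y) \<Longrightarrow> P x"
    have "wf (inv_image (?r - Id) Rep_succ_card)"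
      using wf by simp
    then show "P a"
    proof (induction a rule: wf_induct_rule)
      case (less x)
      show ?case
        by (rule step, rule less)
          (auto simp: less_succ_card_def less_eq_succ_card_def Rep_succ_card_inject)
    qed
  qed
qed

end

definition succ_of :: "'a::wellorder \<Rightarrow> 'a \<Rightarrow> bool" where
  "succ_of \<beta> \<alpha> \<longleftrightarrow> \<beta> < \<alpha> \<and> (\<forall>\<gamma>. \<beta> < \<gamma> \<longrightarrow> \<alpha> \<le> \<gamma>)"

lemma succ_of_unique: "succ_of \<beta> \<alpha> \<Longrightarrow> succ_of \<gamma> \<alpha> \<Longrightarrow> \<beta> = \<gamma>"
  unfolding succ_of_def by (metis leD linorder_neqE)

lemma The_succ_of: "succ_of \<beta> \<alpha> \<Longrightarrow> (THE \<gamma>. succ_of \<gamma> \<alpha>) = \<beta>"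
  using succ_of_unique by blast

text \<open>
  \<open>Tr_iter \<pi> S \<alpha>\<close> is \<open>Tr\<^sup>\<alpha>(S)\<close> for \<open>\<alpha> < \<kappa>\<^sup>+\<close>, where \<open>\<pi> \<alpha>\<close> is the bijection \<open>\<kappa> \<leftrightarrow> \<alpha>\<close> used
  at a limit ordinal \<open>\<alpha> \<ge> \<kappa>\<close>, that is, at a limit \<open>\<alpha>\<close> with \<open>|\<alpha>| \<ge> \<kappa>\<close>.  The condition
  \<open>\<pi> \<alpha> \<alpha>' < \<alpha>\<close> in the last case is only there to make the recursion terminate; it always holds
  if \<open>\<pi>\<close> satisfies \<open>bijections\<close> below (see \<open>Tr_iter_large_limit\<close>).
\<close>

function Tr_iter ::
    "('k::wellorder succ_card \<Rightarrow> 'k \<Rightarrow> 'k succ_card) \<Rightarrow> 'k set \<Rightarrow> 'k succ_card \<Rightarrow> 'k set" where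
  "Tr_iter \<pi> S \<alpha> =
     (if {..<\<alpha>} = {} then S
      else if \<exists>\<beta>. succ_of \<beta> \<alpha> then Tr (Tr_iter \<pi> S (THE \<beta>. succ_of \<beta> \<alpha>))
      else if |{..<\<alpha>}| <o |UNIV :: 'k set| then (\<Inter>\<alpha>'\<in>{..<\<alpha>}. Tr_iter \<pi> S \<alpha>')
      else {\<beta>. \<beta> \<in> (\<Inter>\<alpha>'\<in>{\<alpha>'. \<alpha>' < \<beta> \<and> \<pi> \<alpha> \<alpha>' < \<alpha>}. Tr_iter \<pi> S (\<pi> \<alpha> \<alpha>'))})"
  by pat_completeness auto
termination
proof (relation "inv_image {(x, y). x < y} (\<lambda>(\<pi>, S, \<alpha>). \<alpha>)", goal_cases)
  case 1
  then show ?case by (simp add: wf)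
next
  case (2 \<pi> S \<alpha>)
  then show ?case by (auto simp: The_succ_of succ_of_def[symmetric]) (metis succ_of_def)
qed auto

declare Tr_iter.simps [simp del]

definition bijections :: "('k::wellorder succ_card \<Rightarrow> 'k \<Rightarrow> 'k succ_card) \<Rightarrow> bool" where
  "bijections \<pi> \<longleftrightarrow>
     (\<forall>\<alpha>. {..<\<alpha>} \<noteq> {} \<and> (\<nexists>\<beta>. succ_of \<beta> \<alpha>) \<and> |UNIV :: 'k set| \<le>o |{..<\<alpha>}| \<longrightarrow>
          bij_betw (\<pi> \<alpha>) UNIV {..<\<alpha>})"

lemma Tr_iter_zero: "{..<\<alpha>} = {} \<Longrightarrow> Tr_iter \<pi> S \<alpha> = S"
  by (simp add: Tr_iter.simps)

lemma Tr_iter_succ: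
  assumes "succ_of \<beta> \<alpha>"
  shows "Tr_iter \<pi> S \<alpha> = Tr (Tr_iter \<pi> S \<beta>)"
proof -
  have "{..<\<alpha>} \<noteq> {}"
    using assms by (auto simp: succ_of_def)
  then show ?thesis
    using assms by (subst Tr_iter.simps) (auto simp: The_succ_of)
qed

lemma Tr_iter_small_limit:
  fixes \<alpha> :: "'k::wellorder succ_card"
  assumes "{..<\<alpha>} \<noteq> {}" "\<nexists>\<beta>. succ_of \<beta> \<alpha>" "|{..<\<alpha>}| <o |UNIV :: 'k set|"
  shows "Tr_iter \<pi> S \<alpha> = (\<Inter>\<alpha>'\<in>{..<\<alpha>}. Tr_iter \<pi> S \<alpha>')"
  using assms by (subst Tr_iter.simps) simp

lemma Tr_iter_large_limit:
  fixes \<alpha> :: "'k::wellorder succ_card"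
  assumes "{..<\<alpha>} \<noteq> {}" "\<nexists>\<beta>. succ_of \<beta> \<alpha>" "|UNIV :: 'k set| \<le>o |{..<\<alpha>}|" "bijections \<pi>"
  shows "Tr_iter \<pi> S \<alpha> = {\<beta>. \<beta> \<in> (\<Inter>\<alpha>'\<in>{..<\<beta>}. Tr_iter \<pi> S (\<pi> \<alpha> \<alpha>'))}"
proof -
  have "\<not> |{..<\<alpha>}| <o |UNIV :: 'k set|"
    using assms(3) not_ordLess_ordLeq by blast
  moreover have "\<pi> \<alpha> x < \<alpha>" for x
  proof -
    have "bij_betw (\<pi> \<alpha>) UNIV {..<\<alpha>}"
      using assms unfolding bijections_def by blast
    then show ?thesis
      by (auto simp: bij_betw_def)
  qed
  ultimately show ?thesis
    using assms(1,2) by (subst Tr_iter.simps) auto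
qed

text \<open>Different choices of \<open>\<pi>\<close> give the same iterated traces up to a nonstationary set, so the
  choice is immaterial; the quantification over all of them is not vacuous by \<open>ex_bijections\<close>.\<close>

definition greatly_Mahlo :: "'k::wellorder itself \<Rightarrow> bool" where
  "greatly_Mahlo _ \<longleftrightarrow>
     (\<forall>\<pi>. bijections \<pi> \<longrightarrow>
        (\<forall>\<alpha> :: 'k succ_card. stationary_in UNIV (Tr_iter \<pi> Reg \<alpha>)))"

lemma card_below_succ_card:
  assumes "infinite (UNIV :: 'k set)"
  shows "|{..<\<alpha> :: 'k succ_card}| \<le>o |UNIV :: 'k set|"
proof -
  let ?r = "cardSuc |UNIV :: 'k set|"
  have co: "Card_order ?r"
    by (rule cardSuc_Card_order) (rule card_of_Card_order)
  have "Rep_succ_card ` {..<\<alpha>} \<subseteq> underS ?r (Rep_succ_card \<alpha>)"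
    by (auto simp: underS_def less_succ_card_def less_eq_succ_card_def Rep_succ_card_inject)
  then have "|Rep_succ_card ` {..<\<alpha>}| \<le>o |underS ?r (Rep_succ_card \<alpha>)|"
    by (rule card_of_mono1)
  moreover have "|underS ?r (Rep_succ_card \<alpha>)| <o ?r"
    using co Rep_succ_card by (rule card_of_underS)
  moreover have "|{..<\<alpha>}| =o |Rep_succ_card ` {..<\<alpha>}|"
    using card_of_ordIso[of "{..<\<alpha>}" "Rep_succ_card ` {..<\<alpha>}"]
    by (metis Rep_succ_card_inject inj_on_imp_bij_betw inj_onI)
  ultimately have "|{..<\<alpha>}| <o ?r"
    by (meson ordIso_ordLeq_trans ordLeq_ordLess_trans)
  then show ?thesis
    using cardSuc_ordLeq_ordLess[OF card_of_Card_order card_of_Card_order] by blast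
qed

lemma ex_bijections:
  assumes "infinite (UNIV :: 'k::wellorder set)"
  shows "\<exists>\<pi> :: 'k succ_card \<Rightarrow> 'k \<Rightarrow> 'k succ_card. bijections \<pi>"
proof -
  have "\<exists>f. bij_betw f (UNIV :: 'k set) {..<\<alpha>}"
    if "|UNIV :: 'k set| \<le>o |{..<\<alpha>}|" for \<alpha> :: "'k succ_card"
    using that card_below_succ_card[OF assms] by (simp add: card_of_ordIso ordIso_iff_ordLeq)
  then show ?thesis
    unfolding bijections_def by metis
qed


subsection \<open>Souslin trees\<close>

text \<open>A tree is given by its reflexive order relation \<open>r\<close>, with underlying set \<open>Field r\<close>;
  \<open>underS r x\<close> is the set of strict predecessors of \<open>x\<close>, whose order type is the height of \<open>x\<close>.\<close>

definition tree :: "'b rel \<Rightarrow> bool" where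
  "tree r \<longleftrightarrow> Partial_order r \<and> (\<forall>x \<in> Field r. Well_order (Restr r (underS r x)))"

text \<open>The height of a tree is the set of those \<open>\<alpha>\<close> such that the \<open>\<alpha>\<close>-th level is nonempty;
  here it is required to be \<open>\<kappa>\<close>.\<close>

definition tree_of_height :: "'k::wellorder itself \<Rightarrow> 'b rel \<Rightarrow> bool" where
  "tree_of_height _ r \<longleftrightarrow> tree r \<and>
     (\<forall>\<alpha> :: 'k. \<exists>x \<in> Field r. (Restr r (underS r x), ord_rel {..<\<alpha>}) \<in> ordIso) \<and>
     (\<forall>x \<in> Field r. \<exists>\<alpha> :: 'k. (Restr r (underS r x), ord_rel {..<\<alpha>}) \<in> ordIso)"

text \<open>Levels are antichains, so a Souslin tree automatically has levels of size less than \<open>\<kappa>\<close>.\<close>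

definition Souslin_tree :: "'k::wellorder itself \<Rightarrow> 'b rel \<Rightarrow> bool" where
  "Souslin_tree k r \<longleftrightarrow> tree_of_height k r \<and>
     (\<nexists>C. C \<in> Chains r \<and> |C| =o |UNIV :: 'k set| ) \<and>
     (\<nexists>A. A \<subseteq> Field r \<and> (\<forall>x\<in>A. \<forall>y\<in>A. (x, y) \<in> r \<longrightarrow> x = y) \<and> |A| =o |UNIV :: 'k set| )"

end

theory Submission
  imports Defs
begin

text \<open>
  The failure of \<open>onto(NS, \<theta>)\<close> is used through one consequence: for every regressive
  \<open>g : [\<kappa>]\<^sup>2 \<rightarrow> \<kappa>\<close> there are a stationary set \<open>B\<close> and a function \<open>\<epsilon> : \<kappa> \<rightarrow> \<kappa>\<close> such that \<open>g(\<eta>, \<beta>) < \<epsilon>(\<eta>)\<close> for all \<open>\<beta> \<in> B\<close> and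
  \<open>\<eta> < \<beta>\<close>. Otherwise, by Fodor's lemma, each stationary \<open>B\<close> has a row \<open>g(\<eta>, -)\<close> that is constant on stationary
  subsets of \<open>B\<close> with unboundedly many values, and these are turned into all colours below \<open>\<theta>\<close> by
  \<open>\<kappa>\<close> many functions \<open>e\<^sub>\<rho> : \<kappa> \<rightarrow> \<theta>\<close> such that every unbounded set is mapped onto \<open>\<theta>\<close> by one of them. Such functions
  come from walks on \<open>\<theta>\<^sup>+\<close>: colour \<open>((N, \<alpha>), \<beta>)\<close> by \<open>h(\<gamma>)\<close>, where \<open>\<gamma>\<close> is the first node on the walk from \<open>\<beta>\<close> to \<open>\<alpha>\<close>
  whose ladder has an element in \<open>[N, \<alpha>)\<close>, and \<open>h\<close> splits the points of cofinality \<open>\<theta>\<close> into \<open>\<theta>\<close> stationary sets.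

  The sets on which some \<open>g\<close> is unbounded in this sense form a normal ideal that contains the complement
  of \<open>Reg\<close>. Applied to next-element functions of clubs \<open>K\<^sub>\<beta> \<subseteq> \<beta>\<close>, \<open>\<beta> \<in> Reg\<close>, the bound \<open>\<epsilon>\<close> gives a club \<open>E\<close> with
  \<open>E \<inter> \<beta> \<subseteq> K\<^sub>\<beta>\<close> for stationarily many \<open>\<beta>\<close>. This yields closure of the dual filter under \<open>Tr\<close>, reflection and
  the failure of the square principles; a similar choice of \<open>g\<close> refutes diamond star. The negative square bracket relation
  follows by a pigeonhole on the missing colours, and a Souslin tree carries a colouring that
  reads off which member of an antichain above the \<open>\<eta>\<close>-th node lies below a node of level \<open>\<beta>\<close>.
\<close>

section \<open>Initial segments that are regular cardinals\<close>

lemma Field_ord_rel [simp]: "Field (ord_rel D) = D"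
  by (auto simp: ord_rel_def Field_def)

lemma ord_rel_iff [simp]: "(x, y) \<in> ord_rel D \<longleftrightarrow> x \<in> D \<and> y \<in> D \<and> x \<le> y"
  by (simp add: ord_rel_def)

lemma underS_ord_rel: "x \<in> D \<Longrightarrow> underS (ord_rel D) x = {y \<in> D. y < x}"
  by (auto simp: underS_def)

context
  fixes D :: "'k::wellorder set"
  assumes regular_D: "infinite_regular D"
begin

lemma Card_order_D: "Card_order (ord_rel D)"
  using regular_D by (simp add: infinite_regular_def cardinal_def)

lemma card_of_D: "|D| =o ord_rel D"
  using card_of_Field_ordIso[OF Card_order_D] by simp

lemma stable_D: "stable (ord_rel D)"
  using regularCard_stable[OF Card_order_D] regular_D by (simp add: infinite_regular_def)

lemma card_less_below: "a \<in> D \<Longrightarrow> |{x \<in> D. x < a}| <o |D|"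
  using card_of_underS[OF Card_order_D, of a] ordLess_ordIso_trans[OF _ ordIso_symmetric[OF card_of_D]]
  by (simp add: underS_ord_rel)

lemma ex_greater_in: "a \<in> D \<Longrightarrow> \<exists>b\<in>D. a < b"
  using infinite_Card_order_limit[OF Card_order_D, of a] regular_D
  by (auto simp: infinite_regular_def order.order_iff_strict)

lemma card_less_UN_in:
  assumes "|I| <o |D|" "\<And>i. i \<in> I \<Longrightarrow> |A i| <o |D|"
  shows "|\<Union>i\<in>I. A i| <o |D|"
proof -
  have "|I| <o ord_rel D" "\<And>i. i \<in> I \<Longrightarrow> |A i| <o ord_rel D"
    using assms card_of_D ordLess_ordIso_trans by blast+
  then have "|\<Union>i\<in>I. A i| <o ord_rel D"
    using stable_UNION[OF stable_D] by blast
  then show ?thesis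
    using card_of_D ordIso_symmetric ordLess_ordIso_trans by blast
qed

text \<open>Regularity is given as: every cofinal subset has full size. As \<open>D\<close> has no
  last element, a set without a strict upper bound in \<open>D\<close> is cofinal.\<close>

lemma card_less_bounded_in:
  assumes "X \<subseteq> D" "|X| <o |D|"
  shows "\<exists>b\<in>D. \<forall>x\<in>X. x < b"
proof (rule ccontr)
  assume nb: "\<not> ?thesis"
  have "cofinal X (ord_rel D)"
    unfolding cofinal_def
  proof
    fix a assume "a \<in> Field (ord_rel D)"
    then have "a \<in> D" by simp
    then obtain b where b: "b \<in> D" "a < b"
      using ex_greater_in by blast
    then obtain x where "x \<in> X" "\<not> x < b"
      using nb by blast
    then show "\<exists>x\<in>X. a \<noteq> x \<and> (a, x) \<in> ord_rel D"
      using b \<open>a \<in> D\<close> assms(1) by force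
  qed
  then have "|X| =o ord_rel D"
    using regular_D assms(1) by (simp add: infinite_regular_def regularCard_def)
  then have "|X| =o |D|"
    using card_of_D ordIso_symmetric ordIso_transitive by blast
  then show False
    using assms(2) not_ordLess_ordIso by blast
qed

end

text \<open>The product embeds into the square of \<open>A <+> B\<close>, and an infinite set has
  the size of its square. A finite sum is treated apart.\<close>

lemma card_less_Times:
  assumes "infinite C" "|A| <o |C|" "|B| <o |C|"
  shows "|A \<times> B| <o |C|"
proof (cases "finite (A <+> B)")
  case True
  then show ?thesis
    using assms(1) finite_ordLess_infinite[OF card_of_Well_order card_of_Well_order, of "A \<times> B" C]
    by (simp add: Field_card_of)
next
  case False
  have "|A <+> B| <o |C|"
    using card_of_Plus_ordLess_infinite assms by blast
  moreover have "|A \<times> B| \<le>o |(A <+> B) \<times> (A <+> B)|"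
    by (rule ordLeq_transitive[OF card_of_Times_mono1[OF card_of_Plus1] card_of_Times_mono2[OF card_of_Plus2]])
  moreover have "|(A <+> B) \<times> (A <+> B)| =o |A <+> B|"
    using card_of_Times_same_infinite False by blast
  ultimately show ?thesis
    using ordLeq_ordIso_trans ordLeq_ordLess_trans by blast
qed

text \<open>These sets form a base of the club filter of a regular uncountable cardinal.\<close>

definition closed_points :: "('k::wellorder \<Rightarrow> 'k) \<Rightarrow> 'k set" where
  "closed_points F = {\<beta>. {..<\<beta>} \<noteq> {} \<and> (\<forall>x<\<beta>. F x < \<beta>)}"

section \<open>Small, club and stationary subsets of \<kappa>\<close>

locale regular_pair =
  fixes \<theta> :: "'k::wellorder"
  assumes regular: "infinite_regular (UNIV :: 'k set)"
    and theta: "\<theta> \<in> Reg"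
begin

definition small :: "'a set \<Rightarrow> bool" where
  "small X \<longleftrightarrow> |X| <o |UNIV :: 'k set|"

definition unbounded :: "'k set \<Rightarrow> bool" where
  "unbounded X \<longleftrightarrow> (\<forall>a. \<exists>x\<in>X. a < x)"

lemma infinite_UNIV: "infinite (UNIV :: 'k set)"
  using regular by (simp add: infinite_regular_def)

lemma small_lessThan [simp]: "small {..<a::'k}"
  using card_less_below[OF regular, of a] by (simp add: small_def lessThan_def)

lemma ex_greater: "\<exists>b::'k. a < b"
  using ex_greater_in[OF regular] by blast

lemma small_subset: "small Y \<Longrightarrow> X \<subseteq> Y \<Longrightarrow> small X"
  unfolding small_def using card_of_mono1 ordLeq_ordLess_trans by blast

lemma small_atMost [simp]: "small {..a::'k}"
proof -
  obtain b where "a < b" using ex_greater by blast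
  then show ?thesis
    by (intro small_subset[OF small_lessThan[of b]]) auto
qed

lemma small_image: "small X \<Longrightarrow> small (f ` X)"
  unfolding small_def using card_of_image ordLeq_ordLess_trans by blast

lemma small_UN: "small I \<Longrightarrow> (\<And>i. i \<in> I \<Longrightarrow> small (A i)) \<Longrightarrow> small (\<Union>i\<in>I. A i)"
  unfolding small_def by (rule card_less_UN_in[OF regular])

lemma small_Times: "small A \<Longrightarrow> small B \<Longrightarrow> small (A \<times> B)"
  unfolding small_def using card_less_Times[OF infinite_UNIV] .

lemma small_bounded: "small (X :: 'k set) \<Longrightarrow> \<exists>b. \<forall>x\<in>X. x < b"
  unfolding small_def using card_less_bounded_in[OF regular] by blast

lemma small_iff_not_unbounded: "small (X :: 'k set) \<longleftrightarrow> \<not> unbounded X"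
proof
  assume "small X" then show "\<not> unbounded X"
    using small_bounded unbounded_def by (metis less_asym)
next
  assume "\<not> unbounded X"
  then obtain a where "X \<subseteq> {..a}" by (auto simp: unbounded_def not_less)
  then show "small X" using small_subset small_atMost by blast
qed

lemma unbounded_card: "unbounded X \<Longrightarrow> |X| =o |UNIV :: 'k set|"
  using small_iff_not_unbounded[of X] card_of_mono1[of X UNIV]
  by (simp add: small_def ordIso_iff_ordLeq not_ordLess_iff_ordLeq card_of_Well_order)

lemma unbounded_subset: "unbounded X \<Longrightarrow> X \<subseteq> Y \<Longrightarrow> unbounded Y"
  unfolding unbounded_def by blast

lemma unbounded_greaterThan: "unbounded X \<Longrightarrow> unbounded (X \<inter> {a<..})"
  unfolding unbounded_def by (metis IntI greaterThan_iff max.strict_boundedE)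

lemma unbounded_pigeonhole:
  assumes "unbounded X" "small I" "f ` X \<subseteq> I"
  shows "\<exists>i\<in>I. unbounded {x \<in> X. f x = i}"
proof (rule ccontr)
  assume "\<not> ?thesis"
  then have "small (\<Union>i\<in>I. {x \<in> X. f x = i})"
    by (intro small_UN assms) (simp add: small_iff_not_unbounded)
  moreover have "X \<subseteq> (\<Union>i\<in>I. {x \<in> X. f x = i})"
    using assms(3) by auto
  ultimately show False
    using assms(1) small_iff_not_unbounded small_subset by blast
qed

text \<open>This merges \<kappa> many functions into one: a closed point of \<open>F\<close> is
  closed under \<open>G \<eta>\<close> for every \<eta> below it, which is how diagonal
  intersections of clubs are formed.\<close>

lemma diagonal_bound:
  obtains F where "\<And>\<eta> y x. \<eta> \<le> x \<Longrightarrow> y \<le> x \<Longrightarrow> (G \<eta> y :: 'k) < F (x :: 'k)"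
proof -
  have "\<exists>b. \<forall>p \<in> {..x} \<times> {..x}. G (fst p) (snd p) < b" for x :: 'k
    using small_bounded[OF small_image[OF small_Times[OF small_atMost[of x] small_atMost[of x]],
          of "\<lambda>p. G (fst p) (snd p)"]]
    by blast
  then obtain F where "\<forall>x. \<forall>p \<in> {..x} \<times> {..x}. G (fst p) (snd p) < F x"
    using choice[of "\<lambda>x b. \<forall>p \<in> {..x} \<times> {..x}. G (fst p) (snd p) < b"] by blast
  then show ?thesis
    by (intro that[of F]) force
qed

lemma theta_regular: "infinite_regular {..<\<theta>}"
  using theta by (simp add: Reg_def)

text \<open>This is where \<open>\<kappa>\<close> has to be uncountable.\<close>

lemma small_countable: "small (range (f :: nat \<Rightarrow> 'a))"
proof -
  have "|range f| \<le>o |UNIV :: nat set|" by (rule card_of_image)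
  also have "|UNIV :: nat set| \<le>o |{..<\<theta>}|"
    using theta_regular by (simp add: infinite_iff_card_of_nat infinite_regular_def)
  also have "|{..<\<theta>}| <o |UNIV :: 'k set|"
    using small_lessThan[of \<theta>] by (simp only: small_def)
  finally show ?thesis by (simp add: small_def)
qed

text \<open>A function is iterated \<omega> times above \<open>a\<close>; the supremum stays below
  \<kappa> because countable sets are small.\<close>

lemma ex_closed_point: "\<exists>\<beta>\<in>closed_points F. a < (\<beta> :: 'k)"
proof -
  \<comment> \<open>\<open>F'\<close> dominates \<open>F\<close> and the identity on all of
    \<open>{..x}\<close>, so its iterates increase although \<open>F\<close> may fail to be
    monotone.\<close>
  obtain F' where F': "\<And>y x. y \<le> x \<Longrightarrow> max (F y) y < F' (x :: 'k)"
    by (rule diagonal_bound[of "\<lambda>_ y. max (F y) y"]) blast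
  define s where "s n = (F' ^^ n) a" for n
  have s: "s (Suc n) = F' (s n)" for n by (simp add: s_def)
  have inc: "s n < s (Suc n)" for n
    using F'[of "s n" "s n"] by (simp add: s)
  obtain b where b: "\<forall>x\<in>range s. x < b"
    using small_bounded[OF small_countable] by blast
  \<comment> \<open>The supremum of the iterates, taken as their least strict upper bound.\<close>
  define \<beta> where "\<beta> = (LEAST b. \<forall>x\<in>range s. x < b)"
  have \<beta>: "\<forall>x\<in>range s. x < \<beta>"
    unfolding \<beta>_def using b by (rule LeastI)
  have "\<exists>n. x \<le> s n" if "x < \<beta>" for x
    using not_less_Least[OF that[unfolded \<beta>_def]] by (auto simp: not_less)
  note below = this
  have "F x < \<beta>" if x: "x < \<beta>" for x
  proof -
    obtain n where "x \<le> s n"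
      using below[OF x] by blast
    then have "F x < s (Suc n)"
      using F'[of x "s n"] s by simp
    also have "\<dots> < \<beta>" using \<beta> by blast
    finally show ?thesis .
  qed
  moreover have "s 0 < \<beta>" using \<beta> by blast
  ultimately show ?thesis
    by (intro bexI[of _ \<beta>]) (auto simp: closed_points_def s_def)
qed

lemma club_closed_points: "club_in UNIV (closed_points (F :: 'k \<Rightarrow> 'k))"
  unfolding club_in_def
proof
  show "unbounded_in UNIV (closed_points F)"
    unfolding unbounded_in_def using ex_closed_point less_imp_le by blast
  show "acc_points (closed_points F) \<inter> UNIV \<subseteq> closed_points F"
  proof
    fix \<beta> assume "\<beta> \<in> acc_points (closed_points F) \<inter> UNIV"
    then have ne: "{..<\<beta>} \<noteq> {}" and acc: "\<And>x. x < \<beta> \<Longrightarrow> \<exists>\<delta>\<in>closed_points F. x < \<delta> \<and> \<delta> < \<beta>"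
      by (auto simp: acc_points_def)
    have "F x < \<beta>" if "x < \<beta>" for x
      using acc[OF that] by (auto simp: closed_points_def intro: less_trans)
    then show "\<beta> \<in> closed_points F"
      using ne by (simp add: closed_points_def)
  qed
qed

text \<open>The closed points of a next-element function of \<open>C\<close> are accumulation points
  of \<open>C\<close>.\<close>

lemma club_contains_closed_points:
  assumes "club_in UNIV (C :: 'k set)"
  obtains F where "closed_points F \<subseteq> C"
proof -
  have "\<exists>y\<in>C. x < y" for x
    using assms ex_greater[of x] unfolding club_in_def unbounded_in_def
    by (meson UNIV_I less_le_trans)
  then obtain F where F: "\<And>x. F x \<in> C \<and> x < F x" by metis
  have "closed_points F \<subseteq> acc_points C"
    using F by (auto simp: closed_points_def acc_points_def)
  then show ?thesis
    using assms that unfolding club_in_def by blast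
qed

lemma stationary_iff: "stationary_in UNIV (S :: 'k set) \<longleftrightarrow> (\<forall>F. \<exists>\<beta>\<in>S. \<beta> \<in> closed_points F)"
  unfolding stationary_in_def
proof safe
  fix F assume "\<forall>C. club_in UNIV C \<longrightarrow> S \<inter> C \<noteq> {}"
  then show "\<exists>\<beta>\<in>S. \<beta> \<in> closed_points F"
    using club_closed_points by blast
next
  fix C assume *: "\<forall>F. \<exists>\<beta>\<in>S. \<beta> \<in> closed_points F" "club_in UNIV C" "S \<inter> C = {}"
  obtain F where "closed_points F \<subseteq> C"
    using club_contains_closed_points * by blast
  then show False using * by blast
qed auto

lemma stationary_subset:
  "stationary_in UNIV (S :: 'k set) \<Longrightarrow> S \<subseteq> S' \<Longrightarrow> stationary_in UNIV S'"
  unfolding stationary_iff by blast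

lemma closed_points_subset_greater: "closed_points (\<lambda>x. max (F x) a) \<subseteq> closed_points F \<inter> {a<..}"
  by (auto simp: closed_points_def)

lemma stationary_unbounded: "stationary_in UNIV (S :: 'k set) \<Longrightarrow> unbounded S"
  unfolding unbounded_def
proof
  fix a assume "stationary_in UNIV S"
  then obtain \<beta> where "\<beta> \<in> S" "\<beta> \<in> closed_points (\<lambda>x. max x a)"
    unfolding stationary_iff by blast
  then show "\<exists>x\<in>S. a < x"
    by (auto simp: closed_points_def)
qed

lemma stationary_ex_greater: "stationary_in UNIV (S :: 'k set) \<Longrightarrow> \<exists>\<beta>\<in>S. a < \<beta>"
  using stationary_unbounded[of S] unfolding unbounded_def by blast

text \<open>The functions whose closed points avoid the single sets \<open>S \<eta>\<close> are
  merged by \<open>diagonal_bound\<close>; Fodor's lemma is the case of the fibres of a regressive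
  function.\<close>

lemma nonstationary_diagonal_union:
  assumes "\<And>\<eta>. \<not> stationary_in UNIV (S \<eta> :: 'k set)"
  obtains F where "\<And>\<eta> \<beta>. \<beta> \<in> closed_points F \<Longrightarrow> \<eta> < \<beta> \<Longrightarrow> \<beta> \<notin> S \<eta>"
proof -
  have "\<exists>F. \<forall>\<beta>\<in>S \<eta>. \<beta> \<notin> closed_points F" for \<eta>
    using assms unfolding stationary_iff by blast
  then obtain G where G: "\<And>\<eta> \<beta>. \<beta> \<in> S \<eta> \<Longrightarrow> \<beta> \<notin> closed_points (G \<eta>)" by metis
  obtain F where F: "\<And>\<eta> y x. \<eta> \<le> x \<Longrightarrow> y \<le> x \<Longrightarrow> G \<eta> y < F x"
    by (rule diagonal_bound[of G]) blast
  show ?thesis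
  proof (rule that)
    fix \<eta> \<beta> assume *: "\<beta> \<in> closed_points F" "\<eta> < \<beta>"
    have "G \<eta> y < \<beta>" if "y < \<beta>" for y
    proof -
      have "F (max \<eta> y) < \<beta>"
        using * that by (simp add: closed_points_def)
      then show ?thesis
        using F[of \<eta> "max \<eta> y" y] by simp
    qed
    then have "\<beta> \<in> closed_points (G \<eta>)"
      using * by (auto simp: closed_points_def)
    then show "\<beta> \<notin> S \<eta>" using G by blast
  qed
qed

lemma Fodor:
  assumes "stationary_in UNIV (S :: 'k set)" "\<And>\<beta>. \<beta> \<in> S \<Longrightarrow> f \<beta> < \<beta>"
  obtains v where "stationary_in UNIV {\<beta> \<in> S. f \<beta> = v}"
proof (rule ccontr)
  assume "\<not> thesis"
  then have "\<And>\<eta>. \<not> stationary_in UNIV {\<beta> \<in> S. f \<beta> = \<eta>}"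
    using that by blast
  then obtain F where "\<And>\<eta> \<beta>. \<beta> \<in> closed_points F \<Longrightarrow> \<eta> < \<beta> \<Longrightarrow> \<beta> \<notin> {\<beta> \<in> S. f \<beta> = \<eta>}"
    by (rule nonstationary_diagonal_union[of "\<lambda>\<eta>. {\<beta> \<in> S. f \<beta> = \<eta>}"]) blast
  moreover obtain \<beta> where "\<beta> \<in> S" "\<beta> \<in> closed_points F"
    using assms(1) unfolding stationary_iff by blast
  ultimately show False using assms(2) by blast
qed

lemma stationary_Int_closed_points:
  assumes "stationary_in UNIV (S :: 'k set)"
  shows "stationary_in UNIV (S \<inter> closed_points F)"
  unfolding stationary_iff
proof
  fix G
  obtain \<beta> where "\<beta> \<in> S" "\<beta> \<in> closed_points (\<lambda>x. max (F x) (G x))"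
    using assms unfolding stationary_iff by blast
  then show "\<exists>\<beta>\<in>S \<inter> closed_points F. \<beta> \<in> closed_points G"
    by (auto simp: closed_points_def)
qed

lemma stationary_Int_greater:
  assumes "stationary_in UNIV (S :: 'k set)"
  shows "stationary_in UNIV (S \<inter> {a<..})"
  using stationary_subset[OF stationary_Int_closed_points[OF assms, of "\<lambda>x. max x a"]]
    closed_points_subset_greater[of "\<lambda>x. x" a] by blast

text \<open>Once the small set \<open>I\<close> is injected into some \<open>b\<close> below
  \<kappa>, the index of \<beta> is a regressive function above \<open>b\<close> and Fodor's lemma
  applies.\<close>

lemma stationary_pigeonhole:
  assumes "stationary_in UNIV (S :: 'k set)" "small I" "f ` S \<subseteq> I"
  obtains i where "i \<in> I" "stationary_in UNIV {\<beta> \<in> S. f \<beta> = i}"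
proof -
  have "|I| \<le>o |UNIV :: 'k set|"
    using assms(2) unfolding small_def by (rule ordLess_imp_ordLeq)
  then obtain j :: "_ \<Rightarrow> 'k" where j: "inj_on j I"
    using card_of_ordLeq[of I "UNIV :: 'k set"] by auto
  obtain b where b: "\<forall>x\<in>j ` I. x < b"
    using small_bounded[OF small_image[OF assms(2)]] by blast
  have "j (f \<beta>) < \<beta>" if "\<beta> \<in> S \<inter> {b<..}" for \<beta>
  proof -
    have "j (f \<beta>) < b"
      using that b assms(3) by blast
    also have "b < \<beta>" using that by simp
    finally show ?thesis .
  qed
  then obtain v where v: "stationary_in UNIV {\<beta> \<in> S \<inter> {b<..}. j (f \<beta>) = v}"
    by (rule Fodor[OF stationary_Int_greater[OF assms(1), of b], of "\<lambda>\<beta>. j (f \<beta>)"])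
  then obtain \<beta>0 where \<beta>0: "\<beta>0 \<in> S" "j (f \<beta>0) = v"
    using stationary_unbounded[OF v] unfolding unbounded_def by blast
  have "{\<beta> \<in> S \<inter> {b<..}. j (f \<beta>) = v} \<subseteq> {\<beta> \<in> S. f \<beta> = f \<beta>0}"
  proof
    fix \<beta> assume \<beta>: "\<beta> \<in> {\<beta> \<in> S \<inter> {b<..}. j (f \<beta>) = v}"
    then have "f \<beta> \<in> I" "f \<beta>0 \<in> I" "j (f \<beta>) = j (f \<beta>0)"
      using \<beta>0 assms(3) by auto
    then show "\<beta> \<in> {\<beta> \<in> S. f \<beta> = f \<beta>0}"
      using \<beta> inj_onD[OF j, of "f \<beta>" "f \<beta>0"] by simp
  qed
  then show ?thesis
    using that[of "f \<beta>0"] stationary_subset[OF v] \<beta>0 assms(3) by blast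
qed

end

subsection \<open>Walks on the successor of \<open>\<theta>\<close>\<close>

text \<open>The node at which the walk from \<open>\<beta>\<close> down to \<open>\<alpha>\<close> along \<open>C\<close> first finds a set \<open>C \<gamma>\<close> with
  an element in \<open>[N, \<alpha>)\<close>.\<close>

function walk_stop :: "('k::wellorder \<Rightarrow> 'k set) \<Rightarrow> 'k \<Rightarrow> 'k \<Rightarrow> 'k \<Rightarrow> 'k" where
  "walk_stop C N \<alpha> \<beta> =
     (if C \<beta> \<inter> {N..<\<alpha>} \<noteq> {} \<or> C \<beta> \<inter> {\<alpha>..<\<beta>} = {} then \<beta>
      else walk_stop C N \<alpha> (LEAST \<xi>. \<xi> \<in> C \<beta> \<inter> {\<alpha>..<\<beta>}))"
  by pat_completeness auto
termination
proof (relation "inv_image {(x, y). x < y} (\<lambda>(C, N, \<alpha>, \<beta>). \<beta>)", goal_cases)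
  case 1
  then show ?case by (simp add: wf)
next
  case (2 C N \<alpha> \<beta>)
  then have "(LEAST \<xi>. \<xi> \<in> C \<beta> \<inter> {\<alpha>..<\<beta>}) \<in> C \<beta> \<inter> {\<alpha>..<\<beta>}"
    by (metis (mono_tags, lifting) LeastI ex_in_conv)
  then show ?case by simp
qed

declare walk_stop.simps [simp del]

context regular_pair
begin

definition theta_small :: "'a set \<Rightarrow> bool" where
  "theta_small X \<longleftrightarrow> |X| \<le>o |{..<\<theta>}|"

text \<open>The ordinal \<open>\<theta>\<^sup>+\<close> as an initial segment of \<open>\<kappa>\<close>, possibly all of \<open>\<kappa>\<close>.\<close>

definition theta_suc :: "'k set" where
  "theta_suc = {x. theta_small {..<x}}"

lemma infinite_theta: "infinite {..<\<theta>}"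
  using theta_regular by (simp add: infinite_regular_def)

lemma theta_limit: "i < \<theta> \<Longrightarrow> \<exists>j<\<theta>. i < j"
  using ex_greater_in[OF theta_regular, of i] by auto

lemma theta_small_subset: "theta_small Y \<Longrightarrow> X \<subseteq> Y \<Longrightarrow> theta_small X"
  unfolding theta_small_def by (rule ordLeq_transitive[OF card_of_mono1])

lemma theta_small_image: "theta_small X \<Longrightarrow> theta_small (f ` X)"
  unfolding theta_small_def by (rule ordLeq_transitive[OF card_of_image])

lemma theta_small_UN:
  "theta_small I \<Longrightarrow> (\<And>i. i \<in> I \<Longrightarrow> theta_small (A i)) \<Longrightarrow> theta_small (\<Union>i\<in>I. A i)"
  unfolding theta_small_def by (rule card_of_UNION_ordLeq_infinite[OF infinite_theta]) auto

lemma theta_small_lessThan_theta: "theta_small {..<\<theta>}"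
  unfolding theta_small_def by (rule card_of_mono1) simp

lemma theta_small_finite: "finite X \<Longrightarrow> theta_small X"
  using finite_ordLess_infinite[OF card_of_Well_order card_of_Well_order, of X "{..<\<theta>}"]
    infinite_theta ordLess_imp_ordLeq
  by (auto simp: theta_small_def Field_card_of)

lemma theta_small_Un: "theta_small X \<Longrightarrow> theta_small Y \<Longrightarrow> theta_small (X \<union> Y)"
  using theta_small_UN[of "{True, False}" "\<lambda>b. if b then X else Y"] theta_small_finite[of "{True, False}"]
  by (auto simp: Un_commute)

lemma theta_small_less_theta: "i < \<theta> \<Longrightarrow> theta_small {..<i}"
  by (rule theta_small_subset[OF theta_small_lessThan_theta]) auto

lemma theta_suc_down: "x \<in> theta_suc \<Longrightarrow> y \<le> x \<Longrightarrow> y \<in> theta_suc"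
  unfolding theta_suc_def by (auto elim!: theta_small_subset)

lemma theta_small_lessThan: "x \<in> theta_suc \<Longrightarrow> theta_small {..<x}"
  by (simp add: theta_suc_def)

lemma theta_small_atMost:
  assumes "x \<in> theta_suc"
  shows "theta_small {..x}"
proof -
  have "theta_small ({..<x} \<union> {x})"
    using assms by (intro theta_small_Un theta_small_lessThan theta_small_finite) auto
  moreover have "{..x} = {..<x} \<union> {x}" by auto
  ultimately show ?thesis by simp
qed

text \<open>The bound is the least ordinal outside the downward closure of \<open>X\<close>. It
  exists since \<kappa> has more than \<theta> elements, and it is in \<open>theta_suc\<close> since
  all ordinals below it lie in that closure.\<close>

lemma theta_small_bounded:
  assumes "X \<subseteq> theta_suc" "theta_small X"
  shows "\<exists>d\<in>theta_suc. \<forall>x\<in>X. x < d"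
proof -
  define U where "U = (\<Union>x\<in>X. {..x})"
  have U: "theta_small U"
    unfolding U_def using assms by (intro theta_small_UN theta_small_atMost) auto
  have "|{..<\<theta>}| <o |UNIV :: 'k set|"
    using small_lessThan[of \<theta>] by (simp only: small_def)
  then have "U \<noteq> UNIV"
    using U not_ordLess_ordLeq unfolding theta_small_def by blast
  then obtain d0 where "d0 \<notin> U" by blast
  define d where "d = (LEAST d. d \<notin> U)"
  have d: "d \<notin> U"
    unfolding d_def using \<open>d0 \<notin> U\<close> by (rule LeastI)
  have "x < d" if "x \<in> X" for x
    using d that by (auto simp: U_def not_le)
  moreover have "{..<d} \<subseteq> U"
    using not_less_Least[of _ "\<lambda>d. d \<notin> U"] by (auto simp: d_def)
  then have "d \<in> theta_suc"
    using theta_small_subset[OF U] by (simp add: theta_suc_def)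
  ultimately show ?thesis by blast
qed

lemma theta_suc_ex_greater: "x \<in> theta_suc \<Longrightarrow> \<exists>y\<in>theta_suc. x < y"
  using theta_small_bounded[of "{x}"] theta_small_finite[of "{x}"] by auto

lemma theta_suc_not_small: "\<not> theta_small theta_suc"
  using theta_small_bounded[of theta_suc] by auto

lemma theta_suc_pigeonhole:
  assumes "\<And>x. x \<in> theta_suc \<Longrightarrow> g x < \<theta>"
  shows "\<exists>j<\<theta>. \<not> theta_small {x \<in> theta_suc. g x = j}"
proof (rule ccontr)
  assume "\<not> ?thesis"
  then have "theta_small (\<Union>j\<in>{..<\<theta>}. {x \<in> theta_suc. g x = j})"
    by (intro theta_small_UN theta_small_lessThan_theta) auto
  moreover have "theta_suc \<subseteq> (\<Union>j\<in>{..<\<theta>}. {x \<in> theta_suc. g x = j})"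
    using assms by auto
  ultimately show False
    using theta_suc_not_small theta_small_subset by blast
qed

lemma not_theta_small_unbounded:
  assumes "X \<subseteq> theta_suc" "\<not> theta_small X" "d \<in> theta_suc"
  shows "\<exists>x\<in>X. d < x"
proof (rule ccontr)
  assume "\<not> ?thesis"
  then have "X \<subseteq> {..d}" by (auto simp: not_less)
  then show False
    using theta_small_subset[OF theta_small_atMost] assms by blast
qed

text \<open>The cofinality is at most \<theta> because \<delta> has at most \<theta> elements, and
  at least \<theta> by the bounds. The empty set excludes 0, and singletons exclude
  successors.\<close>

definition theta_cof :: "'k set" where
  "theta_cof = {\<delta> \<in> theta_suc. \<forall>X\<subseteq>{..<\<delta>}. |X| <o |{..<\<theta>}| \<longrightarrow> (\<exists>\<gamma><\<delta>. \<forall>x\<in>X. x < \<gamma>)}"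

text \<open>Closed points of functions replace clubs, as in \<open>stationary_iff\<close>, so that
  \<open>\<theta>\<^sup>+ < \<kappa>\<close> and \<open>\<theta>\<^sup>+ = \<kappa>\<close> are
  treated alike.\<close>

definition stationary_theta :: "'k set \<Rightarrow> bool" where
  "stationary_theta S \<longleftrightarrow>
     (\<forall>F. (\<forall>x\<in>theta_suc. F x \<in> theta_suc) \<longrightarrow> (\<exists>\<delta>\<in>S. \<delta> \<in> closed_points F))"

lemma theta_small_diagonal_bound:
  assumes "\<And>x. x \<in> theta_suc \<Longrightarrow> A x \<subseteq> theta_suc \<and> theta_small (A x)"
  obtains F where "\<And>x y. x \<in> theta_suc \<Longrightarrow> y \<in> A x \<Longrightarrow> y < F x" "\<And>x. x \<in> theta_suc \<Longrightarrow> F x \<in> theta_suc"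
proof -
  have "\<forall>x. \<exists>d. x \<in> theta_suc \<longrightarrow> d \<in> theta_suc \<and> (\<forall>y\<in>A x. y < d)"
    using theta_small_bounded assms by meson
  then obtain F where "\<forall>x. x \<in> theta_suc \<longrightarrow> F x \<in> theta_suc \<and> (\<forall>y\<in>A x. y < F x)"
    using choice[of "\<lambda>x d. x \<in> theta_suc \<longrightarrow> d \<in> theta_suc \<and> (\<forall>y\<in>A x. y < d)"] by blast
  then show ?thesis
    by (intro that[of F]) auto
qed

text \<open>An increasing sequence of length \<theta> is closed off under \<open>F\<close>. Its
  supremum is a closed point, and fewer than \<theta> points below it are bounded by one term of the
  sequence, since \<theta> is regular.\<close>

lemma stationary_theta_cof: "stationary_theta theta_cof"
  unfolding stationary_theta_def
proof (intro allI impI)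
  fix F assume F: "\<forall>x\<in>theta_suc. F x \<in> theta_suc"
  \<comment> \<open>\<open>P f i y\<close> admits \<open>y\<close> as the \<open>i\<close>-th term
    after the terms given by \<open>f\<close>. The recursion runs through all of \<kappa>, so the
    condition is void from \<theta> on.\<close>
  define P where "P f i y \<longleftrightarrow> (i < \<theta> \<longrightarrow> y \<in> theta_suc \<and> (\<forall>i'<i. f i' < y \<and> (\<forall>x\<le>f i'. F x < y)))"
    for f :: "'k \<Rightarrow> 'k" and i y :: 'k
  have "\<exists>a. \<forall>i. P a i (a i)"
  proof (rule dependent_wellorder_choice)
    fix r and f g :: "'k \<Rightarrow> 'k" and x :: 'k assume "\<And>y. y < x \<Longrightarrow> f y = g y"
    then show "P f x r = P g x r" by (auto simp: P_def)
  next
    fix i and f :: "'k \<Rightarrow> 'k" assume f: "\<And>i'. i' < i \<Longrightarrow> P f i' (f i')"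
    show "\<exists>y. P f i y"
    proof (cases "i < \<theta>")
      case True
      then have fD: "f i' \<in> theta_suc" if "i' < i" for i'
        using f[OF that] that by (auto simp: P_def)
      define X where "X = f ` {..<i} \<union> F ` (\<Union>i'\<in>{..<i}. {..f i'})"
      have "theta_small X"
        unfolding X_def using fD True
        by (intro theta_small_Un theta_small_image theta_small_UN theta_small_atMost
            theta_small_less_theta) auto
      moreover have "X \<subseteq> theta_suc"
        unfolding X_def using fD F theta_suc_down by fastforce
      ultimately obtain d where "d \<in> theta_suc" "\<forall>x\<in>X. x < d"
        using theta_small_bounded by blast
      then have "P f i d"
        unfolding P_def X_def by auto
      then show ?thesis by blast
    qed (simp add: P_def)
  qed
  then obtain a where a: "\<And>i. P a i (a i)" by blast
  have aD: "a i \<in> theta_suc" if "i < \<theta>" for i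
    using a[of i] that by (simp add: P_def)
  have a_less: "a i' < a i" and F_less: "x \<le> a i' \<Longrightarrow> F x < a i" if "i' < i" "i < \<theta>" for i i' x
    using a[of i] that by (auto simp: P_def)
  have "\<exists>d\<in>theta_suc. \<forall>x\<in>a ` {..<\<theta>}. x < d"
    using aD by (intro theta_small_bounded theta_small_image theta_small_lessThan_theta) auto
  then obtain d where d: "d \<in> theta_suc" "\<forall>x\<in>a ` {..<\<theta>}. x < d" by blast
  define \<delta> where "\<delta> = (LEAST d. \<forall>x\<in>a ` {..<\<theta>}. x < d)"
  have above: "a i < \<delta>" if "i < \<theta>" for i
  proof -
    have "\<forall>x\<in>a ` {..<\<theta>}. x < \<delta>"
      unfolding \<delta>_def using d(2) by (rule LeastI)
    then show ?thesis using that by blast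
  qed
  have "\<delta> \<le> d"
    unfolding \<delta>_def using d(2) by (rule Least_le)
  then have \<delta>D: "\<delta> \<in> theta_suc"
    using theta_suc_down d(1) by blast
  have below: "\<exists>i<\<theta>. x \<le> a i" if "x < \<delta>" for x
    using not_less_Least[OF that[unfolded \<delta>_def]] by (auto simp: not_less)
  have "F x < \<delta>" if x: "x < \<delta>" for x
  proof -
    obtain i where i: "i < \<theta>" "x \<le> a i" using below[OF x] by blast
    obtain i' where i': "i' < \<theta>" "i < i'" using theta_limit[OF i(1)] by blast
    have "F x < a i'" using F_less[OF i'(2,1) i(2)] .
    also have "\<dots> < \<delta>" using above[OF i'(1)] .
    finally show ?thesis .
  qed
  moreover obtain i0 where "i0 < \<theta>"
    using infinite_theta by (metis finite.emptyI lessThan_iff subsetI subset_empty all_not_in_conv)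
  then have "{..<\<delta>} \<noteq> {}" using above by blast
  ultimately have "\<delta> \<in> closed_points F" by (simp add: closed_points_def)
  moreover have "\<exists>\<gamma><\<delta>. \<forall>x\<in>X. x < \<gamma>" if X: "X \<subseteq> {..<\<delta>}" "|X| <o |{..<\<theta>}|" for X
  proof -
    have "\<forall>x\<in>X. \<exists>i. i < \<theta> \<and> x \<le> a i" using below X(1) by blast
    then obtain idx where idx: "\<forall>x\<in>X. idx x < \<theta> \<and> x \<le> a (idx x)"
      using bchoice[of X "\<lambda>x i. i < \<theta> \<and> x \<le> a i"] by blast
    have "|idx ` X| <o |{..<\<theta>}|"
      using ordLeq_ordLess_trans[OF card_of_image X(2)] .
    then obtain i where i: "i \<in> {..<\<theta>}" "\<forall>x\<in>idx ` X. x < i"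
      using card_less_bounded_in[OF theta_regular, of "idx ` X"] idx by blast
    have "x < a i" if "x \<in> X" for x
      using idx that a_less[of "idx x" i] i by (meson image_eqI le_less_trans lessThan_iff)
    then show ?thesis
      using above i(1) by blast
  qed
  ultimately show "\<exists>\<delta>\<in>theta_cof. \<delta> \<in> closed_points F"
    using \<delta>D by (auto simp: theta_cof_def)
qed

definition enum :: "'k \<Rightarrow> 'k \<Rightarrow> 'k" where
  "enum d = (SOME f. inj_on f {..<d} \<and> f ` {..<d} \<subseteq> {..<\<theta>})"

lemma enum:
  assumes "d \<in> theta_suc"
  shows "inj_on (enum d) {..<d}" "x < d \<Longrightarrow> enum d x < \<theta>"
proof -
  have "\<exists>f. inj_on f {..<d} \<and> f ` {..<d} \<subseteq> {..<\<theta>}"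
    using assms card_of_ordLeq[of "{..<d}" "{..<\<theta>}"] by (simp add: theta_suc_def theta_small_def)
  then have *: "inj_on (enum d) {..<d} \<and> enum d ` {..<d} \<subseteq> {..<\<theta>}"
    unfolding enum_def by (rule someI_ex)
  then show "inj_on (enum d) {..<d}" "x < d \<Longrightarrow> enum d x < \<theta>"
    by auto
qed

text \<open>An Ulam matrix argument splits the points of cofinality \<open>\<theta>\<close> into \<open>\<theta>\<close> stationary sets.\<close>

lemma ex_stationary_fibres:
  obtains h where "\<And>\<delta>. h \<delta> < \<theta>" "\<And>j. j < \<theta> \<Longrightarrow> stationary_theta {\<delta> \<in> theta_cof. h \<delta> = j}"
proof -
  \<comment> \<open>The entries of the Ulam matrix, disjoint in \<open>i\<close> for fixed
    \<open>y\<close>. The aim is a row with \<theta> many stationary entries.\<close>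
  define S where "S y i = {\<delta> \<in> theta_cof. y < \<delta> \<and> enum \<delta> y = i}" for y i
  define I where "I y = {i. i < \<theta> \<and> stationary_theta (S y i)}" for y
  have "\<exists>y\<in>theta_suc. \<not> |I y| <o |{..<\<theta>}|"
  proof (rule ccontr)
    assume "\<not> ?thesis"
    then have small_I: "|I y| <o |{..<\<theta>}|" if "y \<in> theta_suc" for y
      using that by blast
    have "\<exists>b. y \<in> theta_suc \<longrightarrow> b < \<theta> \<and> (\<forall>i\<in>I y. i < b)" for y
      using card_less_bounded_in[OF theta_regular, of "I y"] small_I[of y] by (auto simp: I_def)
    then obtain b where b: "\<And>y. y \<in> theta_suc \<Longrightarrow> b y < \<theta> \<and> (\<forall>i\<in>I y. i < b y)" by metis
    \<comment> \<open>If every row has fewer than \<theta> stationary entries, their indices are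
      bounded below \<theta>, and more than \<theta> many rows share one bound
      \<open>j\<close>.\<close>
    obtain j where j: "j < \<theta>" "\<not> theta_small {y \<in> theta_suc. b y = j}"
      using theta_suc_pigeonhole[of b] b by blast
    define Y where "Y = {y \<in> theta_suc. b y = j}"
    have "|{..<\<theta>}| \<le>o |Y|"
      using j(2) not_ordLeq_iff_ordLess[OF card_of_Well_order card_of_Well_order] ordLess_imp_ordLeq
      unfolding theta_small_def Y_def by blast
    then obtain e where e: "inj_on e {..<\<theta>}" "e ` {..<\<theta>} \<subseteq> Y"
      using card_of_ordLeq[of "{..<\<theta>}" Y] by auto
    obtain x0 where x0: "x0 \<in> theta_suc" "\<forall>x\<in>e ` {..<\<theta>}. x < x0"
      using theta_small_bounded[OF _ theta_small_image[OF theta_small_lessThan_theta], of e] e(2)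
      by (auto simp: Y_def)
    have "\<exists>F. (\<forall>x\<in>theta_suc. F x \<in> theta_suc) \<and> (y \<in> Y \<and> j \<le> i \<and> i < \<theta> \<longrightarrow> (\<forall>\<delta>\<in>S y i. \<delta> \<notin> closed_points F))"
      for y i
    proof (cases "y \<in> Y \<and> j \<le> i \<and> i < \<theta>")
      case True
      then have "i \<notin> I y" using b[of y] by (auto simp: Y_def)
      then show ?thesis using True by (auto simp: I_def stationary_theta_def)
    next
      case False
      then show ?thesis by (intro exI[of _ "\<lambda>x. x"]) auto
    qed
    then obtain F where F: "\<And>y i x. x \<in> theta_suc \<Longrightarrow> F y i x \<in> theta_suc"
      and F_S: "\<And>y i \<delta>. y \<in> Y \<Longrightarrow> j \<le> i \<Longrightarrow> i < \<theta> \<Longrightarrow> \<delta> \<in> S y i \<Longrightarrow> \<delta> \<notin> closed_points (F y i)"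
      by metis
    define A where "A x = insert x0 (\<Union>y\<in>{..x}. \<Union>i\<in>{..<\<theta>}. F y i ` {..x})" for x
    have A: "A x \<subseteq> theta_suc \<and> theta_small (A x)" if "x \<in> theta_suc" for x
    proof
      show "A x \<subseteq> theta_suc"
        using that x0(1) F theta_suc_down[OF that] by (auto simp: A_def)
      have "theta_small ({x0} \<union> (\<Union>y\<in>{..x}. \<Union>i\<in>{..<\<theta>}. F y i ` {..x}))"
        by (intro theta_small_Un theta_small_UN theta_small_image theta_small_atMost
            theta_small_lessThan_theta theta_small_finite that) auto
      then show "theta_small (A x)" by (simp add: A_def)
    qed
    \<comment> \<open>A closed point \<delta> of \<open>G\<close> above the range of
      \<open>e\<close> lies in no nonstationary entry, so \<open>enum \<delta>\<close> injects
      \<theta> many rows into \<open>j\<close>, which is too small.\<close>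
    obtain G where G: "\<And>x y. x \<in> theta_suc \<Longrightarrow> y \<in> A x \<Longrightarrow> y < G x"
      and GD: "\<And>x. x \<in> theta_suc \<Longrightarrow> G x \<in> theta_suc"
      by (rule theta_small_diagonal_bound[of A]) (use A in blast)+
    obtain \<delta> where \<delta>: "\<delta> \<in> theta_cof" "\<delta> \<in> closed_points G"
      using stationary_theta_cof GD unfolding stationary_theta_def by blast
    then have \<delta>D: "\<delta> \<in> theta_suc" by (simp add: theta_cof_def)
    obtain x1 where x1: "x1 < \<delta>" "G x1 < \<delta>"
      using \<delta>(2) by (auto simp: closed_points_def)
    have "x0 < \<delta>"
      using G[of x1 x0] x1 theta_suc_down[OF \<delta>D, of x1] by (auto simp: A_def intro: less_trans)
    have "enum \<delta> y < j" if y: "y \<in> Y" "y < \<delta>" for y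
    proof (rule ccontr)
      assume "\<not> enum \<delta> y < j"
      then have *: "j \<le> enum \<delta> y" "enum \<delta> y < \<theta>"
        using enum(2)[OF \<delta>D y(2)] by auto
      have "\<delta> \<in> S y (enum \<delta> y)"
        using \<delta>(1) y(2) by (simp add: S_def)
      then have "\<delta> \<notin> closed_points (F y (enum \<delta> y))"
        using F_S[OF y(1) *] by blast
      moreover have "F y (enum \<delta> y) x < \<delta>" if "x < \<delta>" for x
      proof -
        have m: "max x y < \<delta>" using y(2) that by simp
        have "F y (enum \<delta> y) x \<in> A (max x y)"
          unfolding A_def using *(2) by (intro insertI2 UN_I[of y] UN_I[of "enum \<delta> y"] imageI) auto
        then have "F y (enum \<delta> y) x < G (max x y)"
          using G theta_suc_down[OF \<delta>D] m by (meson less_imp_le)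
        also have "\<dots> < \<delta>"
          using \<delta>(2) m by (simp add: closed_points_def)
        finally show ?thesis .
      qed
      ultimately show False
        using \<delta>(2) by (simp add: closed_points_def)
    qed
    moreover have e_less: "e x < \<delta>" if "x < \<theta>" for x
      using x0(2) \<open>x0 < \<delta>\<close> that by (auto intro: less_trans)
    ultimately have "(enum \<delta> \<circ> e) ` {..<\<theta>} \<subseteq> {..<j}"
      using e(2) by (simp add: image_subset_iff)
    moreover have "inj_on (enum \<delta> \<circ> e) {..<\<theta>}"
      using e_less by (intro comp_inj_on e(1) inj_on_subset[OF enum(1)[OF \<delta>D]]) auto
    ultimately have "|{..<\<theta>}| \<le>o |{..<j}|"
      using card_of_ordLeq[of "{..<\<theta>}" "{..<j}"] by blast
    moreover have "{x \<in> {..<\<theta>}. x < j} = {..<j}" using j(1) by auto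
    ultimately show False
      using card_less_below[OF theta_regular, of j] j(1) not_ordLess_ordLeq[of "|{..<j}|"] by auto
  qed
  then obtain y where y: "\<not> |I y| <o |{..<\<theta>}|" by blast
  then have "|{..<\<theta>}| \<le>o |I y|"
    using not_ordLess_iff_ordLeq[OF card_of_Well_order card_of_Well_order] by blast
  moreover have "|I y| \<le>o |{..<\<theta>}|"
    by (rule card_of_mono1) (auto simp: I_def)
  ultimately have "|I y| =o |{..<\<theta>}|"
    by (simp add: ordIso_iff_ordLeq)
  then obtain p where p: "bij_betw p (I y) {..<\<theta>}"
    using card_of_ordIso[of "I y" "{..<\<theta>}"] by blast
  obtain i0 where i0: "i0 < \<theta>"
    using infinite_theta by (metis finite.emptyI lessThan_iff all_not_in_conv)
  \<comment> \<open>The stationary entries of row \<open>y\<close> are relabelled by \<theta>; all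
    remaining points get the default colour \<open>i0\<close>.\<close>
  define h where "h \<delta> = (if enum \<delta> y \<in> I y then p (enum \<delta> y) else i0)" for \<delta>
  show ?thesis
  proof (rule that[of h])
    show "h \<delta> < \<theta>" for \<delta>
      using bij_betwE[OF p] i0 by (auto simp: h_def)
    fix j assume "j < \<theta>"
    then obtain i where i: "i \<in> I y" "p i = j"
      using p by (metis bij_betw_iff_bijections lessThan_iff)
    then have "S y i \<subseteq> {\<delta> \<in> theta_cof. h \<delta> = j}"
      by (auto simp: S_def h_def)
    then show "stationary_theta {\<delta> \<in> theta_cof. h \<delta> = j}"
      using i(1) unfolding I_def stationary_theta_def by (simp only: mem_Collect_eq) blast
  qed
qed

text \<open>A cofinal subset of \<open>\<beta> < \<theta>\<^sup>+\<close> all of whose proper initial segments have size less than \<open>\<theta>\<close>: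
  the record points of an injection into \<open>\<theta>\<close>.\<close>

definition ladder :: "'k \<Rightarrow> 'k set" where
  "ladder \<beta> = {\<xi>. \<xi> < \<beta> \<and> (\<forall>\<zeta><\<beta>. enum \<beta> \<zeta> < enum \<beta> \<xi> \<longrightarrow> \<zeta> < \<xi>)}"

text \<open>The point of [\<gamma>, \<beta>) with the least value of \<open>enum \<beta>\<close> is
  a record point: whatever has a smaller value lies below \<gamma>.\<close>

lemma ladder_cofinal:
  assumes "\<gamma> < \<beta>"
  shows "\<exists>\<xi>\<in>ladder \<beta>. \<gamma> \<le> \<xi>"
proof -
  define P where "P m \<longleftrightarrow> (\<exists>\<xi>. \<gamma> \<le> \<xi> \<and> \<xi> < \<beta> \<and> enum \<beta> \<xi> = m)" for m
  have "P (enum \<beta> \<gamma>)" using assms by (auto simp: P_def)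
  then have "P (LEAST m. P m)" by (rule LeastI)
  then obtain \<xi> where \<xi>: "\<gamma> \<le> \<xi>" "\<xi> < \<beta>" "enum \<beta> \<xi> = (LEAST m. P m)"
    by (auto simp: P_def)
  have "\<zeta> < \<xi>" if "\<zeta> < \<beta>" "enum \<beta> \<zeta> < enum \<beta> \<xi>" for \<zeta>
  proof -
    have "\<not> P (enum \<beta> \<zeta>)"
      using not_less_Least that(2) \<xi>(3) by metis
    then have "\<zeta> < \<gamma>" using that(1) by (auto simp: P_def not_le)
    then show ?thesis using \<xi>(1) by simp
  qed
  then show ?thesis
    using \<xi> by (auto simp: ladder_def)
qed

text \<open>Fix a record point at or above \<delta>. All record points below \<delta> have smaller
  values than it, so there are fewer than \<theta> of them and the cofinality of \<delta> bounds
  them.\<close>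

lemma ladder_bounded:
  assumes "\<delta> \<in> theta_cof" "\<beta> \<in> theta_suc" "\<delta> < \<beta>"
  shows "\<exists>\<gamma><\<delta>. \<forall>\<xi>\<in>ladder \<beta> \<inter> {..<\<delta>}. \<xi> < \<gamma>"
proof -
  obtain \<xi>0 where \<xi>0: "\<xi>0 \<in> ladder \<beta>" "\<delta> \<le> \<xi>0"
    using ladder_cofinal[OF assms(3)] by blast
  then have \<xi>0': "\<xi>0 < \<beta>" by (simp add: ladder_def)
  have inj: "inj_on (enum \<beta>) (ladder \<beta> \<inter> {..<\<delta>})"
    by (rule inj_on_subset[OF enum(1)[OF assms(2)]]) (auto simp: ladder_def)
  have "enum \<beta> \<xi> < enum \<beta> \<xi>0" if "\<xi> \<in> ladder \<beta>" "\<xi> < \<delta>" for \<xi>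
  proof -
    have "\<xi> < \<beta>" "\<xi> \<noteq> \<xi>0" "\<not> \<xi>0 < \<xi>"
      using that \<xi>0 by (auto simp: ladder_def)
    moreover have "enum \<beta> \<xi> \<noteq> enum \<beta> \<xi>0"
      using inj_onD[OF enum(1)[OF assms(2)], of \<xi> \<xi>0] \<xi>0' calculation by auto
    moreover have "\<not> enum \<beta> \<xi>0 < enum \<beta> \<xi>"
      using that(1) \<xi>0' calculation(3) by (auto simp: ladder_def)
    ultimately show ?thesis by simp
  qed
  then have "enum \<beta> ` (ladder \<beta> \<inter> {..<\<delta>}) \<subseteq> {x \<in> {..<\<theta>}. x < enum \<beta> \<xi>0}"
    using enum(2)[OF assms(2)] by (auto simp: ladder_def)
  then have "|ladder \<beta> \<inter> {..<\<delta>}| \<le>o |{x \<in> {..<\<theta>}. x < enum \<beta> \<xi>0}|"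
    using inj card_of_ordLeq[of "ladder \<beta> \<inter> {..<\<delta>}"] by blast
  moreover have "|{x \<in> {..<\<theta>}. x < enum \<beta> \<xi>0}| <o |{..<\<theta>}|"
    using card_less_below[OF theta_regular] enum(2)[OF assms(2) \<xi>0'] by simp
  ultimately have "|ladder \<beta> \<inter> {..<\<delta>}| <o |{..<\<theta>}|"
    by (rule ordLeq_ordLess_trans)
  then show ?thesis
    using assms(1) by (simp add: theta_cof_def)
qed

text \<open>Below \<open>\<delta>\<close> of cofinality \<open>\<theta>\<close>, the sets \<open>ladder \<gamma>\<close> met on the walk from \<open>\<beta>\<close> to \<open>\<delta>\<close> are
  bounded by some \<open>\<mu>\<close>, so a walk with \<open>\<mu> < N\<close> cannot stop before \<open>\<delta>\<close>.\<close>

lemma walk_stop_theta_cof: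
  assumes "\<delta> \<in> theta_cof"
  shows "\<beta> \<in> theta_suc \<Longrightarrow> \<delta> \<le> \<beta> \<Longrightarrow> \<exists>\<mu><\<delta>. \<forall>N \<alpha>. \<mu> < N \<longrightarrow> \<alpha> < \<delta> \<longrightarrow>
     ladder \<delta> \<inter> {N..<\<alpha>} \<noteq> {} \<longrightarrow> walk_stop ladder N \<alpha> \<beta> = \<delta>"
proof (induction \<beta> rule: less_induct)
  case (less \<beta>)
  show ?case
  proof (cases "\<beta> = \<delta>")
    case True
    \<comment> \<open>The walk starting at \<delta> stops at once, so any \<mu> below \<delta> will
      do; the empty set supplies one.\<close>
    have "\<exists>\<mu><\<delta>. \<forall>x\<in>{}. x < \<mu>"
    proof -
      have "|{} :: 'k set| <o |{..<\<theta>}|"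
        using infinite_theta finite_ordLess_infinite[OF card_of_Well_order card_of_Well_order, of "{}"]
        by (simp add: Field_card_of)
      then show ?thesis
        using assms unfolding theta_cof_def by (auto dest!: spec[of _ "{} :: 'k set"])
    qed
    then show ?thesis
      using True by (auto simp: walk_stop.simps[of ladder _ _ \<delta>])
  next
    case False
    then have \<delta>: "\<delta> < \<beta>" using less.prems by simp
    obtain \<mu>0 where \<mu>0: "\<mu>0 < \<delta>" "\<forall>\<xi>\<in>ladder \<beta> \<inter> {..<\<delta>}. \<xi> < \<mu>0"
      using ladder_bounded[OF assms less.prems(1) \<delta>] by blast
    define \<beta>' where "\<beta>' = (LEAST \<xi>. \<xi> \<in> ladder \<beta> \<inter> {\<delta>..<\<beta>})"
    have "\<exists>\<xi>. \<xi> \<in> ladder \<beta> \<inter> {\<delta>..<\<beta>}"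
      using ladder_cofinal[OF \<delta>] by (auto simp: ladder_def)
    then have \<beta>': "\<beta>' \<in> ladder \<beta> \<inter> {\<delta>..<\<beta>}"
      unfolding \<beta>'_def by (rule LeastI_ex)
    then obtain \<mu>1 where \<mu>1: "\<mu>1 < \<delta>" "\<And>N \<alpha>. \<mu>1 < N \<Longrightarrow> \<alpha> < \<delta> \<Longrightarrow>
        ladder \<delta> \<inter> {N..<\<alpha>} \<noteq> {} \<Longrightarrow> walk_stop ladder N \<alpha> \<beta>' = \<delta>"
      using less.IH[of \<beta>'] theta_suc_down[OF less.prems(1), of \<beta>'] by auto
    have "walk_stop ladder N \<alpha> \<beta> = \<delta>"
      if N: "max \<mu>0 \<mu>1 < N" "\<alpha> < \<delta>" "ladder \<delta> \<inter> {N..<\<alpha>} \<noteq> {}" for N \<alpha>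
    proof -
      have "N < \<alpha>" using N(3) by auto
      have no: "\<not> N \<le> \<xi>" if "\<xi> \<in> ladder \<beta>" "\<xi> < \<delta>" for \<xi>
      proof -
        have "\<xi> < \<mu>0" using \<mu>0(2) that by simp
        also have "\<dots> < N" using N(1) by simp
        finally show ?thesis by simp
      qed
      then have "ladder \<beta> \<inter> {N..<\<alpha>} = {}"
        using N(2) by force
      \<comment> \<open>As \<open>ladder \<beta>\<close> has no point in [N, \<delta>), the walks
        towards \<alpha> and towards \<delta> take the same next step.\<close>
      moreover have eq: "ladder \<beta> \<inter> {\<alpha>..<\<beta>} = ladder \<beta> \<inter> {\<delta>..<\<beta>}"
        using no N(2) \<open>N < \<alpha>\<close> by (force simp: not_le)
      ultimately have "walk_stop ladder N \<alpha> \<beta> = walk_stop ladder N \<alpha> \<beta>'"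
        using \<beta>' by (subst walk_stop.simps) (auto simp: \<beta>'_def)
      then show ?thesis
        using \<mu>1(2) N by simp
    qed
    then show ?thesis
      using \<mu>0(1) \<mu>1(1) by (intro exI[of _ "max \<mu>0 \<mu>1"]) auto
  qed
qed

text \<open>A row \<open>(N, \<alpha>)\<close> that misses a colour does so at the same colour \<open>j\<close> for unboundedly many \<open>N\<close>
  and, given \<open>N\<close>, for unboundedly many \<open>\<alpha>\<close>; walks through a suitable \<open>\<delta>\<close> of colour \<open>j\<close> refute this.\<close>

lemma ex_onto_theta_suc:
  obtains c :: "'k \<Rightarrow> 'k \<Rightarrow> 'k \<Rightarrow> 'k"
  where "\<And>N \<alpha> \<beta>. c N \<alpha> \<beta> < \<theta>"
    "\<And>Z. Z \<subseteq> theta_suc \<Longrightarrow> \<forall>d\<in>theta_suc. \<exists>z\<in>Z. d < z \<Longrightarrow> \<exists>N \<alpha>. \<forall>j<\<theta>. \<exists>\<beta>\<in>Z. c N \<alpha> \<beta> = j"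
proof -
  obtain h where h: "\<And>\<delta>. h \<delta> < \<theta>"
    and fib: "\<And>j. j < \<theta> \<Longrightarrow> stationary_theta {\<delta> \<in> theta_cof. h \<delta> = j}"
    using ex_stationary_fibres by blast
  show ?thesis
  proof (rule that[of "\<lambda>N \<alpha> \<beta>. h (walk_stop ladder N \<alpha> \<beta>)"])
    show "h (walk_stop ladder N \<alpha> \<beta>) < \<theta>" for N \<alpha> \<beta> by (rule h)
    fix Z assume Z: "Z \<subseteq> theta_suc" "\<forall>d\<in>theta_suc. \<exists>z\<in>Z. d < z"
    show "\<exists>N \<alpha>. \<forall>j<\<theta>. \<exists>\<beta>\<in>Z. h (walk_stop ladder N \<alpha> \<beta>) = j"
    proof (rule ccontr)
      assume "\<not> ?thesis"
      then have "\<forall>N \<alpha>. \<exists>j. j < \<theta> \<and> (\<forall>\<beta>\<in>Z. h (walk_stop ladder N \<alpha> \<beta>) \<noteq> j)" by blast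
      then obtain J where J: "\<And>N \<alpha>. J N \<alpha> < \<theta>"
        "\<And>N \<alpha> \<beta>. \<beta> \<in> Z \<Longrightarrow> h (walk_stop ladder N \<alpha> \<beta>) \<noteq> J N \<alpha>" by metis
      have "\<exists>j<\<theta>. \<not> theta_small {\<alpha> \<in> theta_suc. J N \<alpha> = j}" for N
        using theta_suc_pigeonhole[of "J N"] J(1) by blast
      then obtain jN where jN: "\<And>N. jN N < \<theta>" "\<And>N. \<not> theta_small {\<alpha> \<in> theta_suc. J N \<alpha> = jN N}"
        by metis
      obtain j where j: "j < \<theta>" "\<not> theta_small {N \<in> theta_suc. jN N = j}"
        using theta_suc_pigeonhole[of jN] jN(1) by blast
      have "\<exists>N. x \<in> theta_suc \<longrightarrow> N \<in> theta_suc \<and> jN N = j \<and> x < N" for x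
        using not_theta_small_unbounded[OF _ j(2), of x] by auto
      then obtain nN where nN: "\<And>x. x \<in> theta_suc \<Longrightarrow> nN x \<in> theta_suc \<and> jN (nN x) = j \<and> x < nN x"
        by metis
      define nA where "nA N x = (SOME \<alpha>. \<alpha> \<in> theta_suc \<and> J N \<alpha> = jN N \<and> x < \<alpha>)" for N x
      have nA: "nA N x \<in> theta_suc \<and> J N (nA N x) = jN N \<and> x < nA N x" if "x \<in> theta_suc" for N x
        unfolding nA_def
        by (rule someI_ex) (use not_theta_small_unbounded[OF _ jN(2)[of N] that] in auto)
      \<comment> \<open>A point closed under \<open>F\<close> is closed under finding a larger
        \<open>N\<close> with final colour \<open>j\<close> and, for each smaller \<open>N\<close>,
        a larger \<alpha> at which row (N, \<alpha>) misses \<open>jN N\<close>.\<close>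
      define A where "A x = {nN x} \<union> (\<lambda>N. nA N x) ` {..x}" for x
      have A: "A x \<subseteq> theta_suc \<and> theta_small (A x)" if "x \<in> theta_suc" for x
      proof
        show "A x \<subseteq> theta_suc"
          using nN nA that by (auto simp: A_def)
        show "theta_small (A x)"
          unfolding A_def
          by (intro theta_small_Un theta_small_image theta_small_atMost theta_small_finite that) auto
      qed
      obtain F where F: "\<And>x y. x \<in> theta_suc \<Longrightarrow> y \<in> A x \<Longrightarrow> y < F x"
        and FD: "\<And>x. x \<in> theta_suc \<Longrightarrow> F x \<in> theta_suc"
        by (rule theta_small_diagonal_bound[of A]) (use A in blast)+
      obtain \<delta> where \<delta>: "\<delta> \<in> theta_cof" "h \<delta> = j" "\<delta> \<in> closed_points F"
        using fib[OF j(1)] FD unfolding stationary_theta_def by blast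
      then have \<delta>D: "x \<in> theta_suc" if "x \<le> \<delta>" for x
        using theta_suc_down that by (auto simp: theta_cof_def)
      have A\<delta>: "y < \<delta>" if "y \<in> A x" "x < \<delta>" for x y
      proof -
        have "y < F x" using F that \<delta>D by (meson less_imp_le)
        also have "F x < \<delta>" using \<delta>(3) that(2) by (simp add: closed_points_def)
        finally show ?thesis .
      qed
      obtain \<beta> where \<beta>: "\<beta> \<in> Z" "\<delta> < \<beta>"
        using Z(2) \<delta>D by blast
      obtain \<mu> where \<mu>: "\<mu> < \<delta>" "\<forall>N \<alpha>. \<mu> < N \<longrightarrow> \<alpha> < \<delta> \<longrightarrow>
          ladder \<delta> \<inter> {N..<\<alpha>} \<noteq> {} \<longrightarrow> walk_stop ladder N \<alpha> \<beta> = \<delta>"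
        using walk_stop_theta_cof[OF \<delta>(1) subsetD[OF Z(1) \<beta>(1)] less_imp_le[OF \<beta>(2)]]
        by (elim exE conjE)
      \<comment> \<open>With \<open>N\<close> above \<mu>, a ladder point \<xi> of \<delta> at or
        above \<open>N\<close>, and \<alpha> above \<xi>, the walk must stop at \<delta>, whose
        colour \<open>j\<close> is the one missed by row (N, \<alpha>).\<close>
      define N where "N = nN \<mu>"
      have N: "jN N = j" "\<mu> < N" "N < \<delta>"
        using nN[of \<mu>] \<delta>D[of \<mu>] A\<delta>[of "nN \<mu>" \<mu>] \<mu>(1) by (auto simp: N_def A_def)
      obtain \<xi> where \<xi>: "\<xi> \<in> ladder \<delta>" "N \<le> \<xi>"
        using ladder_cofinal[OF N(3)] by blast
      then have "\<xi> < \<delta>" by (simp add: ladder_def)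
      define \<alpha> where "\<alpha> = nA N \<xi>"
      have \<alpha>: "J N \<alpha> = j" "\<xi> < \<alpha>" "\<alpha> < \<delta>"
        using nA[of \<xi> N] \<delta>D[of \<xi>] A\<delta>[of "nA N \<xi>" \<xi>] \<open>\<xi> < \<delta>\<close> \<xi>(2) N(1) by (auto simp: \<alpha>_def A_def)
      have "walk_stop ladder N \<alpha> \<beta> = \<delta>"
      proof -
        have "\<xi> \<in> ladder \<delta> \<inter> {N..<\<alpha>}" using \<xi> \<alpha>(2) by simp
        then show ?thesis using \<mu>(2) N(2) \<alpha>(3) by blast
      qed
      then show False
        using J(2)[OF \<beta>(1), of N \<alpha>] \<alpha>(1) \<delta>(2) by simp
    qed
  qed
qed

section \<open>From \<open>\<theta>\<^sup>+\<close> to \<kappa>, and from colourings to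
  bounds\<close>

lemma unbounded_enum:
  assumes "unbounded Z"
  shows "\<exists>a :: 'k \<Rightarrow> 'k. range a \<subseteq> Z \<and> strict_mono a"
proof -
  define P where "P f i y \<longleftrightarrow> y \<in> Z \<and> (\<forall>i'<i. f i' < y)" for f :: "'k \<Rightarrow> 'k" and i y :: 'k
  have "\<exists>a. \<forall>i. P a i (a i)"
  proof (rule dependent_wellorder_choice)
    fix r and f g :: "'k \<Rightarrow> 'k" and x :: 'k assume "\<And>y. y < x \<Longrightarrow> f y = g y"
    then show "P f x r = P g x r" by (auto simp: P_def)
  next
    fix i and f :: "'k \<Rightarrow> 'k"
    obtain b where b: "\<forall>x\<in>f ` {..<i}. x < b"
      using small_bounded[OF small_image[OF small_lessThan]] by blast
    obtain z where z: "z \<in> Z" "b < z"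
      using assms unfolding unbounded_def by blast
    have "f i' < z" if "i' < i" for i'
      using b that z(2) less_trans by blast
    then show "\<exists>y. P f i y"
      using z(1) by (auto simp: P_def)
  qed
  then obtain a where a: "\<And>i. P a i (a i)" by blast
  then have "range a \<subseteq> Z" "strict_mono a"
    by (auto simp: P_def strict_mono_def)
  then show ?thesis by blast
qed

text \<open>The failure of \<open>onto_NS \<theta>\<close> is used in this form for the normal
  ideal, the square bracket relation and Souslin trees, each of which supplies its own
  colouring.\<close>

lemma not_onto_missing_colour:
  fixes c :: "'k \<times> 'k \<Rightarrow> 'k"
  assumes "\<not> onto_NS \<theta>" "\<And>\<eta> \<beta>. \<eta> < \<beta> \<Longrightarrow> c (\<eta>, \<beta>) < \<theta>"
  shows "\<exists>B. stationary_in UNIV B \<and> (\<forall>\<eta>. \<exists>j<\<theta>. \<forall>\<beta>\<in>B. \<eta> < \<beta> \<longrightarrow> c (\<eta>, \<beta>) \<noteq> j)"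
proof (rule ccontr)
  assume no: "\<not> ?thesis"
  have "\<exists>\<eta>. c ` ({\<eta>} \<circledast> B) = {..<\<theta>}" if B: "stationary_in UNIV B" for B
  proof -
    obtain \<eta> where \<eta>: "\<forall>j<\<theta>. \<exists>\<beta>\<in>B. \<eta> < \<beta> \<and> c (\<eta>, \<beta>) = j"
      using no B by blast
    have "c ` ({\<eta>} \<circledast> B) \<subseteq> {..<\<theta>}"
      using assms(2) by (auto simp: circledast_def)
    moreover have "{..<\<theta>} \<subseteq> c ` ({\<eta>} \<circledast> B)"
    proof
      fix j assume "j \<in> {..<\<theta>}"
      then obtain \<beta> where "\<beta> \<in> B" "\<eta> < \<beta>" "c (\<eta>, \<beta>) = j" using \<eta> by auto
      then show "j \<in> c ` ({\<eta>} \<circledast> B)"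
        by (intro image_eqI[of _ _ "(\<eta>, \<beta>)"]) (auto simp: circledast_def)
    qed
    ultimately show ?thesis by blast
  qed
  moreover have "c \<in> UNIV \<circledast> UNIV \<rightarrow> {..<\<theta>}"
    using assms(2) by (auto simp: circledast_def)
  ultimately have "onto_NS \<theta>"
    unfolding onto_NS_def by (intro bexI[of _ c]) auto
  with assms(1) show False ..
qed

text \<open>Such a \<open>g\<close> pulls a colouring of \<open>\<theta>\<^sup>+\<close> back to
  \<delta> while cofinal subsets of \<delta> keep cofinal images.\<close>

definition cofinal_map :: "'k \<Rightarrow> ('k \<Rightarrow> 'k) \<Rightarrow> bool" where
  "cofinal_map \<delta> g \<longleftrightarrow> (\<forall>\<epsilon><\<delta>. g \<epsilon> \<in> theta_suc) \<and>
     (\<forall>Z\<subseteq>{..<\<delta>}. (\<forall>x<\<delta>. \<exists>z\<in>Z. x \<le> z) \<longrightarrow> (\<forall>d\<in>theta_suc. \<exists>z\<in>Z. d < g z))"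

text \<open>\<delta> is the supremum of \<open>\<theta>\<^sup>+\<close> many elements of
  \<open>Z\<close> in increasing order, and \<open>g\<close> returns the first index whose element
  reaches its argument.\<close>

lemma ex_cofinal_map:
  assumes "small theta_suc" "unbounded Z"
  shows "\<exists>\<delta> g. cofinal_map \<delta> g \<and> (\<forall>x<\<delta>. \<exists>z\<in>Z \<inter> {..<\<delta>}. x \<le> z)"
proof -
  obtain a :: "'k \<Rightarrow> 'k" where a: "range a \<subseteq> Z" "strict_mono a"
    using unbounded_enum[OF assms(2)] by (elim exE conjE)
  have aZ: "a i \<in> Z" for i using a(1) by blast
  have a_less: "a i' < a i" if "i' < i" for i' i using a(2) that by (rule strict_monoD)
  obtain b where b: "\<forall>x\<in>a ` theta_suc. x < b"
    using small_bounded[OF small_image[OF assms(1)]] by blast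
  define \<delta> where "\<delta> = (LEAST d. \<forall>x\<in>a ` theta_suc. x < d)"
  have \<delta>: "\<forall>x\<in>a ` theta_suc. x < \<delta>"
    unfolding \<delta>_def using b by (rule LeastI)
  have below: "\<exists>i. i \<in> theta_suc \<and> x \<le> a i" if "x < \<delta>" for x
    using not_less_Least[OF that[unfolded \<delta>_def]] by (auto simp: not_less)
  define g where "g \<epsilon> = (LEAST i. i \<in> theta_suc \<and> \<epsilon> \<le> a i)" for \<epsilon>
  have g: "g \<epsilon> \<in> theta_suc \<and> \<epsilon> \<le> a (g \<epsilon>)" if "\<epsilon> < \<delta>" for \<epsilon>
    unfolding g_def using below[OF that] by (rule LeastI_ex)
  have "\<exists>z\<in>Z'. d < g z" if Z': "Z' \<subseteq> {..<\<delta>}" "\<forall>x<\<delta>. \<exists>z\<in>Z'. x \<le> z" and d: "d \<in> theta_suc" for Z' d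
  proof -
    obtain d' where d': "d' \<in> theta_suc" "d < d'"
      using theta_suc_ex_greater[OF d] by blast
    obtain z where z: "z \<in> Z'" "a d' \<le> z"
      using Z'(2) \<delta> d'(1) by blast
    have "\<not> g z < d'"
    proof
      assume "g z < d'"
      then have "a (g z) < a d'" by (rule a_less)
      moreover have "a d' \<le> a (g z)"
        using g[of z] z Z'(1) by (auto intro: order_trans)
      ultimately show False by simp
    qed
    then have "d < g z"
      using d'(2) by (meson less_le_trans not_less)
    then show ?thesis using z(1) by blast
  qed
  then have "cofinal_map \<delta> g"
    using g by (simp add: cofinal_map_def)
  moreover have "\<exists>z\<in>Z \<inter> {..<\<delta>}. x \<le> z" if "x < \<delta>" for x
    using below[OF that] aZ \<delta> by auto
  ultimately show ?thesis by blast
qed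

text \<open>If \<open>\<theta>\<^sup>+ < \<kappa>\<close>, the colouring of \<open>\<theta>\<^sup>+\<close> is transferred to every \<open>\<delta>\<close> of cofinality \<open>\<theta>\<^sup>+\<close>.\<close>

lemma ex_onto_unbounded:
  obtains e :: "'k \<times> 'k \<times> 'k \<Rightarrow> 'k \<Rightarrow> 'k"
  where "\<And>\<rho> \<epsilon>. e \<rho> \<epsilon> < \<theta>" "\<And>Z. unbounded Z \<Longrightarrow> \<exists>\<rho>. \<forall>j<\<theta>. \<exists>\<epsilon>\<in>Z. e \<rho> \<epsilon> = j"
proof -
  obtain c :: "'k \<Rightarrow> 'k \<Rightarrow> 'k \<Rightarrow> 'k" where c: "\<And>N \<alpha> \<beta>. c N \<alpha> \<beta> < \<theta>"
    and c_onto: "\<And>Z. Z \<subseteq> theta_suc \<Longrightarrow> \<forall>d\<in>theta_suc. \<exists>z\<in>Z. d < z \<Longrightarrow>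
      \<exists>N \<alpha>. \<forall>j<\<theta>. \<exists>\<beta>\<in>Z. c N \<alpha> \<beta> = j"
    by (rule ex_onto_theta_suc) blast
  show ?thesis
  proof (cases "theta_suc = UNIV")
    case True
    show ?thesis
    \<comment> \<open>The first component is a dummy that gives both cases the same index
      type.\<close>
    proof (rule that[of "\<lambda>(\<delta>, N, \<alpha>). c N \<alpha>"])
      fix Z assume "unbounded Z"
      then obtain N \<alpha> where "\<forall>j<\<theta>. \<exists>\<beta>\<in>Z. c N \<alpha> \<beta> = j"
        using c_onto[of Z] True by (auto simp: unbounded_def)
      then have "\<forall>j<\<theta>. \<exists>\<epsilon>\<in>Z. (case (N, N, \<alpha>) of (\<delta>, N, \<alpha>) \<Rightarrow> c N \<alpha>) \<epsilon> = j"
        by simp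
      then show "\<exists>\<rho>. \<forall>j<\<theta>. \<exists>\<epsilon>\<in>Z. (case \<rho> of (\<delta> :: 'k, N, \<alpha>) \<Rightarrow> c N \<alpha>) \<epsilon> = j"
        by (rule exI[of _ "(N, N, \<alpha>)"])
    qed (auto simp: c)
  next
    case False
    then obtain x where "x \<notin> theta_suc" by blast
    then have "theta_suc \<subseteq> {..<x}"
      using theta_suc_down not_le by blast
    then have small_suc: "small theta_suc"
      using small_subset small_lessThan by blast
    \<comment> \<open>One map is fixed for each \<delta>, independently of \<open>Z\<close>, so that
      triples of ordinals suffice as indices.\<close>
    define g where "g \<delta> = (SOME g. cofinal_map \<delta> g)" for \<delta>
    show ?thesis
    proof (rule that[of "\<lambda>(\<delta>, N, \<alpha>) \<epsilon>. c N \<alpha> (g \<delta> \<epsilon>)"])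
      fix Z assume "unbounded Z"
      then obtain \<delta> g' where \<delta>: "cofinal_map \<delta> g'" "\<forall>x<\<delta>. \<exists>z\<in>Z \<inter> {..<\<delta>}. x \<le> z"
        using ex_cofinal_map[OF small_suc] by blast
      have g: "cofinal_map \<delta> (g \<delta>)"
        using someI_ex[of "cofinal_map \<delta>"] \<delta>(1) unfolding g_def by auto
      have sub: "g \<delta> ` (Z \<inter> {..<\<delta>}) \<subseteq> theta_suc"
        using g by (auto simp: cofinal_map_def)
      have unb: "\<forall>d\<in>theta_suc. \<exists>z\<in>g \<delta> ` (Z \<inter> {..<\<delta>}). d < z"
      proof
        fix d assume d: "d \<in> theta_suc"
        have "\<forall>x<\<delta>. \<exists>z\<in>Z \<inter> {..<\<delta>}. x \<le> z" using \<delta>(2) .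
        then have "\<exists>z\<in>Z \<inter> {..<\<delta>}. d < g \<delta> z"
          using g d unfolding cofinal_map_def by (meson inf_le2)
        then show "\<exists>z\<in>g \<delta> ` (Z \<inter> {..<\<delta>}). d < z" by blast
      qed
      obtain N \<alpha> where "\<forall>j<\<theta>. \<exists>\<beta>\<in>g \<delta> ` (Z \<inter> {..<\<delta>}). c N \<alpha> \<beta> = j"
        using c_onto[OF sub unb] by (elim exE)
      then have "\<forall>j<\<theta>. \<exists>\<epsilon>\<in>Z. (case (\<delta>, N, \<alpha>) of (\<delta>, N, \<alpha>) \<Rightarrow> \<lambda>\<epsilon>. c N \<alpha> (g \<delta> \<epsilon>)) \<epsilon> = j"
        by auto
      then show "\<exists>\<rho>. \<forall>j<\<theta>. \<exists>\<epsilon>\<in>Z. (case \<rho> of (\<delta>, N, \<alpha>) \<Rightarrow> \<lambda>\<epsilon>. c N \<alpha> (g \<delta> \<epsilon>)) \<epsilon> = j"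
        by (rule exI[of _ "(\<delta>, N, \<alpha>)"])
    qed (auto simp: c)
  qed
qed

text \<open>The negligible sets form a normal ideal, which is proper if \<open>onto(NS, \<theta>)\<close> fails.\<close>

definition bounding :: "('k \<Rightarrow> 'k \<Rightarrow> 'k) \<Rightarrow> 'k set \<Rightarrow> bool" where
  "bounding g B \<longleftrightarrow> (\<exists>\<epsilon>. \<forall>\<beta>\<in>B. \<forall>\<eta><\<beta>. g \<eta> \<beta> < \<epsilon> \<eta>)"

definition regressive :: "('k \<Rightarrow> 'k \<Rightarrow> 'k) \<Rightarrow> bool" where
  "regressive g \<longleftrightarrow> (\<forall>\<eta> \<beta>. \<eta> < \<beta> \<longrightarrow> g \<eta> \<beta> < \<beta>)"

definition negligible :: "'k set \<Rightarrow> bool" where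
  "negligible S \<longleftrightarrow>
     (\<exists>g. regressive g \<and> (\<forall>B\<subseteq>S. stationary_in UNIV B \<longrightarrow> \<not> bounding g B))"

text \<open>A row of the colouring codes \<eta> together with an index \<rho>, and the pair with
  \<beta> gets the colour \<open>e \<rho> (g \<eta> \<beta>)\<close>. If \<open>B\<close> misses a
  colour in every row, each \<open>g \<eta>\<close> is bounded on \<open>B\<close> off a
  nonstationary set, and a diagonal intersection makes these bounds simultaneous.\<close>

lemma not_negligible_UNIV:
  assumes "\<not> onto_NS \<theta>"
  shows "\<not> negligible UNIV"
  unfolding negligible_def
proof clarify
  fix g assume g: "regressive g" "\<forall>B\<subseteq>UNIV. stationary_in UNIV B \<longrightarrow> \<not> bounding g B"
  obtain e where e: "\<And>\<rho> \<epsilon>. e \<rho> \<epsilon> < \<theta>"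
    and e_onto: "\<And>Z. unbounded Z \<Longrightarrow> \<exists>\<rho> :: 'k \<times> 'k \<times> 'k. \<forall>j<\<theta>. \<exists>\<epsilon>\<in>Z. e \<rho> \<epsilon> = j"
    by (rule ex_onto_unbounded) blast
  have sq: "|(UNIV :: 'k set) \<times> (UNIV :: 'k set)| =o |UNIV :: 'k set|"
    by (rule card_of_Times_same_infinite[OF infinite_UNIV])
  then obtain q where q: "bij_betw q (UNIV :: 'k set) (UNIV :: ('k \<times> 'k) set)"
    using card_of_ordIso[of "UNIV :: 'k set" "UNIV :: ('k \<times> 'k) set"] ordIso_symmetric[OF sq] by auto
  \<comment> \<open>Three uses of the pairing function code \<eta> and the triple \<rho> by a single
    ordinal.\<close>
  define row where "row x = (let (\<eta>, y) = q x; (\<delta>, z) = q y; (N, \<alpha>) = q z in (\<eta>, \<delta>, N, \<alpha>))" for x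
  have row: "\<exists>x. row x = r" for r
  proof -
    obtain \<eta> \<delta> N \<alpha> where r: "r = (\<eta>, \<delta>, N, \<alpha>)" by (cases r)
    have surj: "\<exists>x. q x = p" for p
      using q unfolding bij_betw_def by (metis UNIV_I image_iff)
    obtain z where "q z = (N, \<alpha>)" using surj by blast
    moreover obtain y where "q y = (\<delta>, z)" using surj by blast
    moreover obtain x where "q x = (\<eta>, y)" using surj by blast
    ultimately have "row x = r" using r by (simp add: row_def)
    then show ?thesis ..
  qed
  define c where "c p = e (snd (row (fst p))) (g (fst (row (fst p))) (snd p))" for p
  have "c (\<eta>, \<beta>) < \<theta>" for \<eta> \<beta>
    by (simp add: c_def e)
  then obtain B where B: "stationary_in UNIV B"
    "\<And>\<eta>. \<exists>j<\<theta>. \<forall>\<beta>\<in>B. \<eta> < \<beta> \<longrightarrow> c (\<eta>, \<beta>) \<noteq> j"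
    using not_onto_missing_colour[OF assms, of c] by auto
  have "\<exists>\<epsilon>. \<not> stationary_in UNIV {\<beta> \<in> B. \<eta> < \<beta> \<and> \<epsilon> \<le> g \<eta> \<beta>}" for \<eta>
  proof (rule ccontr)
    assume "\<not> ?thesis"
    then have st: "stationary_in UNIV {\<beta> \<in> B. \<eta> < \<beta> \<and> \<epsilon> \<le> g \<eta> \<beta>}" for \<epsilon> by blast
    \<comment> \<open>Values attained on stationary sets recur beyond every ordinal, in particular
      beyond the code \<open>x\<close> of the row, which may exceed \<eta>.\<close>
    define Z where "Z = {v. stationary_in UNIV {\<beta> \<in> B. \<eta> < \<beta> \<and> g \<eta> \<beta> = v}}"
    have "unbounded Z"
      unfolding unbounded_def
    proof
      fix a :: "'k"
      obtain a' where a': "a < a'" using ex_greater by blast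
      obtain v where v: "stationary_in UNIV {\<beta> \<in> {\<beta> \<in> B. \<eta> < \<beta> \<and> a' \<le> g \<eta> \<beta>}. g \<eta> \<beta> = v}"
        by (rule Fodor[OF st[of a'], of "g \<eta>"]) (use g(1) in \<open>auto simp: regressive_def\<close>)
      then have "\<exists>\<beta>. a' \<le> g \<eta> \<beta> \<and> g \<eta> \<beta> = v"
        using stationary_ex_greater[OF v, of a'] by blast
      then have "a < v" using a' by auto
      moreover have "v \<in> Z"
        unfolding Z_def by (rule CollectI, rule stationary_subset[OF v]) blast
      ultimately show "\<exists>v\<in>Z. a < v" by blast
    qed
    then obtain \<rho> where \<rho>: "\<forall>j<\<theta>. \<exists>v\<in>Z. e \<rho> v = j"
      using e_onto by blast
    obtain x where x: "row x = (\<eta>, \<rho>)" using row by blast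
    have "\<exists>\<beta>\<in>B. x < \<beta> \<and> c (x, \<beta>) = j" if j: "j < \<theta>" for j
    proof -
      obtain v where v: "stationary_in UNIV {\<beta> \<in> B. \<eta> < \<beta> \<and> g \<eta> \<beta> = v}" "e \<rho> v = j"
        using \<rho> j unfolding Z_def by blast
      obtain \<beta> where "\<beta> \<in> B" "g \<eta> \<beta> = v" "x < \<beta>"
        using stationary_ex_greater[OF v(1), of x] by blast
      then show ?thesis
        using v(2) x by (auto simp: c_def)
    qed
    then show False using B(2)[of x] by blast
  qed
  then obtain \<epsilon> where \<epsilon>: "\<And>\<eta>. \<not> stationary_in UNIV {\<beta> \<in> B. \<eta> < \<beta> \<and> \<epsilon> \<eta> \<le> g \<eta> \<beta>}" by metis
  obtain F where F: "\<And>\<eta> \<beta>. \<beta> \<in> closed_points F \<Longrightarrow> \<eta> < \<beta> \<Longrightarrow> \<beta> \<notin> {\<beta> \<in> B. \<eta> < \<beta> \<and> \<epsilon> \<eta> \<le> g \<eta> \<beta>}"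
    by (rule nonstationary_diagonal_union[of "\<lambda>\<eta>. {\<beta> \<in> B. \<eta> < \<beta> \<and> \<epsilon> \<eta> \<le> g \<eta> \<beta>}"]) (use \<epsilon> in blast)+
  have "bounding g (B \<inter> closed_points F)"
    unfolding bounding_def
  proof (intro exI[of _ \<epsilon>] ballI allI impI)
    fix \<beta> \<eta> assume "\<beta> \<in> B \<inter> closed_points F" "\<eta> < \<beta>"
    then show "g \<eta> \<beta> < \<epsilon> \<eta>" using F[of \<beta> \<eta>] by (auto simp: not_le)
  qed
  then show False
    using g(2) stationary_Int_closed_points[OF B(1)] by blast
qed

end

subsection \<open>The normal ideal\<close>

lemma Well_order_ord_rel: "Well_order (ord_rel (D :: 'k::wellorder set))"
proof -
  have "wf (ord_rel D - Id)"
    by (rule wf_subset[OF wf]) auto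
  then show ?thesis
    by (auto simp: well_order_on_def linear_order_on_def partial_order_on_def preorder_on_def
        refl_on_def trans_def antisym_def total_on_def)
qed

context regular_pair
begin

lemma small_finite: "finite X \<Longrightarrow> small X"
  using finite_ordLess_infinite[OF card_of_Well_order card_of_Well_order, of X "UNIV :: 'k set"]
    infinite_UNIV
  by (simp add: small_def Field_card_of)

lemma negligible_subset: "negligible S \<Longrightarrow> S' \<subseteq> S \<Longrightarrow> negligible S'"
  unfolding negligible_def by (meson subset_trans)

lemma nonstationary_negligible:
  assumes "\<not> stationary_in UNIV S"
  shows "negligible S"
  unfolding negligible_def
proof (intro exI[of _ "\<lambda>\<eta> \<beta>. \<eta>"] conjI allI impI)
  fix B assume "B \<subseteq> S" "stationary_in UNIV B"
  then show "\<not> bounding (\<lambda>\<eta> \<beta>. \<eta>) B"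
    using assms stationary_subset by blast
qed (simp add: regressive_def)

text \<open>The witnesses \<open>G i\<close> are glued along \<open>f\<close>. A stationary set with
  bounded glued function would have a stationary part in one fibre, where the glued function is
  \<open>G i\<close>. Fodor's lemma and the pigeonhole principle provide \<open>const\<close> in the
  two applications.\<close>

lemma negligible_partition:
  assumes neg: "\<And>i. i \<in> I \<Longrightarrow> negligible (S i)"
    and mem: "\<And>\<beta>. \<beta> \<in> T \<Longrightarrow> f \<beta> \<in> I \<and> \<beta> \<in> S (f \<beta>)"
    and const: "\<And>B. stationary_in UNIV B \<Longrightarrow> B \<subseteq> T \<Longrightarrow> \<exists>i\<in>I. stationary_in UNIV {\<beta> \<in> B. f \<beta> = i}"
  shows "negligible T"
proof -
  have "\<forall>i. \<exists>g. i \<in> I \<longrightarrow> regressive g \<and> (\<forall>B\<subseteq>S i. stationary_in UNIV B \<longrightarrow> \<not> bounding g B)"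
    using neg unfolding negligible_def by blast
  then obtain G where G: "\<And>i. i \<in> I \<Longrightarrow> regressive (G i)"
    "\<And>i B. i \<in> I \<Longrightarrow> B \<subseteq> S i \<Longrightarrow> stationary_in UNIV B \<Longrightarrow> \<not> bounding (G i) B"
    by metis
  define g where "g \<eta> \<beta> = (if \<beta> \<in> T then G (f \<beta>) \<eta> \<beta> else \<eta>)" for \<eta> \<beta>
  have "regressive g"
    using G(1) mem by (simp add: regressive_def g_def)
  moreover have "\<not> bounding g B" if B: "B \<subseteq> T" "stationary_in UNIV B" for B
  proof
    assume "bounding g B"
    then obtain \<epsilon> where \<epsilon>: "\<And>\<beta> \<eta>. \<beta> \<in> B \<Longrightarrow> \<eta> < \<beta> \<Longrightarrow> g \<eta> \<beta> < \<epsilon> \<eta>"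
      unfolding bounding_def by blast
    obtain i where i: "i \<in> I" "stationary_in UNIV {\<beta> \<in> B. f \<beta> = i}"
      using const[OF B(2,1)] by blast
    have sub: "{\<beta> \<in> B. f \<beta> = i} \<subseteq> S i"
      using mem B(1) by blast
    have "bounding (G i) {\<beta> \<in> B. f \<beta> = i}"
      unfolding bounding_def
    proof (intro exI[of _ \<epsilon>] ballI allI impI)
      fix \<beta> \<eta> assume "\<beta> \<in> {\<beta> \<in> B. f \<beta> = i}" "\<eta> < \<beta>"
      then show "G i \<eta> \<beta> < \<epsilon> \<eta>"
        using \<epsilon>[of \<beta> \<eta>] B(1) by (auto simp: g_def)
    qed
    then show False
      using G(2)[OF i(1) sub i(2)] by blast
  qed
  ultimately show ?thesis
    unfolding negligible_def by blast
qed

lemma negligible_diagonal_union: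
  assumes "\<And>i. negligible (S i)"
  shows "negligible {\<beta>. \<exists>i<\<beta>. \<beta> \<in> S i}"
proof (rule negligible_partition[of UNIV S _ "\<lambda>\<beta>. SOME i. i < \<beta> \<and> \<beta> \<in> S i"])
  have some: "(SOME i. i < \<beta> \<and> \<beta> \<in> S i) < \<beta> \<and> \<beta> \<in> S (SOME i. i < \<beta> \<and> \<beta> \<in> S i)"
    if "\<beta> \<in> {\<beta>. \<exists>i<\<beta>. \<beta> \<in> S i}" for \<beta>
    by (rule someI_ex) (use that in blast)
  show "(SOME i. i < \<beta> \<and> \<beta> \<in> S i) \<in> UNIV \<and> \<beta> \<in> S (SOME i. i < \<beta> \<and> \<beta> \<in> S i)"
    if "\<beta> \<in> {\<beta>. \<exists>i<\<beta>. \<beta> \<in> S i}" for \<beta>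
    using some[OF that] by blast
  fix B assume B: "stationary_in UNIV B" "B \<subseteq> {\<beta>. \<exists>i<\<beta>. \<beta> \<in> S i}"
  have "(SOME i. i < \<beta> \<and> \<beta> \<in> S i) < \<beta>" if "\<beta> \<in> B" for \<beta>
    using some B(2) that by blast
  then obtain v where "stationary_in UNIV {\<beta> \<in> B. (SOME i. i < \<beta> \<and> \<beta> \<in> S i) = v}"
    by (rule Fodor[OF B(1)])
  then show "\<exists>i\<in>UNIV. stationary_in UNIV {\<beta> \<in> B. (SOME i. i < \<beta> \<and> \<beta> \<in> S i) = i}"
    by blast
qed (rule assms)

lemma negligible_UN:
  assumes "small I" "\<And>i. i \<in> I \<Longrightarrow> negligible (S i)"
  shows "negligible (\<Union>i\<in>I. S i)"
proof (rule negligible_partition[of I S _ "\<lambda>\<beta>. SOME i. i \<in> I \<and> \<beta> \<in> S i"])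
  show some: "(SOME i. i \<in> I \<and> \<beta> \<in> S i) \<in> I \<and> \<beta> \<in> S (SOME i. i \<in> I \<and> \<beta> \<in> S i)"
    if "\<beta> \<in> (\<Union>i\<in>I. S i)" for \<beta>
    by (rule someI_ex) (use that in blast)
  fix B assume B: "stationary_in UNIV B" "B \<subseteq> (\<Union>i\<in>I. S i)"
  have "(\<lambda>\<beta>. SOME i. i \<in> I \<and> \<beta> \<in> S i) ` B \<subseteq> I"
    using some B(2) by blast
  then obtain i where "i \<in> I" "stationary_in UNIV {\<beta> \<in> B. (SOME i. i \<in> I \<and> \<beta> \<in> S i) = i}"
    by (rule stationary_pigeonhole[OF B(1) assms(1)])
  then show "\<exists>i\<in>I. stationary_in UNIV {\<beta> \<in> B. (SOME i. i \<in> I \<and> \<beta> \<in> S i) = i}"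
    by blast
qed (rule assms(2))

lemma negligible_Un: "negligible S \<Longrightarrow> negligible T \<Longrightarrow> negligible (S \<union> T)"
  using negligible_UN[OF small_finite, of "{True, False}" "\<lambda>b. if b then S else T"]
  by (auto simp: Un_commute)

lemma negligible_atMost: "negligible {..a}"
proof (rule nonstationary_negligible)
  show "\<not> stationary_in UNIV {..a}"
    using stationary_ex_greater[of "{..a}" a] by auto
qed

text \<open>A bound for the next-element functions of the clubs \<open>K \<beta>\<close> gives one club that is contained
  in all of them.\<close>

lemma club_sequence_captures:
  assumes "\<not> negligible S" and clubs: "\<forall>\<beta>\<in>S. club_in {..<\<beta>} (K \<beta>)"
  shows "\<exists>B F. B \<subseteq> S \<and> stationary_in UNIV B \<and> (\<forall>\<beta>\<in>B. closed_points F \<inter> {..<\<beta>} \<subseteq> K \<beta>)"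
proof -
  note K = bspec[OF clubs]
  define g where "g \<eta> \<beta> = (if \<beta> \<in> S \<and> \<eta> < \<beta> then SOME x. x \<in> K \<beta> \<and> \<eta> \<le> x else \<eta>)" for \<eta> \<beta>
  have g: "g \<eta> \<beta> \<in> K \<beta> \<and> \<eta> \<le> g \<eta> \<beta>" if "\<beta> \<in> S" "\<eta> < \<beta>" for \<eta> \<beta>
  proof -
    have "\<exists>x. x \<in> K \<beta> \<and> \<eta> \<le> x"
      using K[OF that(1)] that(2) unfolding club_in_def unbounded_in_def by blast
    then have "(SOME x. x \<in> K \<beta> \<and> \<eta> \<le> x) \<in> K \<beta> \<and> \<eta> \<le> (SOME x. x \<in> K \<beta> \<and> \<eta> \<le> x)"
      by (rule someI_ex)
    then show ?thesis using that by (simp add: g_def)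
  qed
  have "regressive g"
    unfolding regressive_def
  proof (intro allI impI)
    fix \<eta> \<beta> :: 'k assume "\<eta> < \<beta>"
    show "g \<eta> \<beta> < \<beta>"
    proof (cases "\<beta> \<in> S")
      case True
      then show ?thesis
        using g[OF True \<open>\<eta> < \<beta>\<close>] K[OF True] unfolding club_in_def unbounded_in_def by blast
    qed (simp add: g_def \<open>\<eta> < \<beta>\<close>)
  qed
  then obtain B where B: "B \<subseteq> S" "stationary_in UNIV B" "bounding g B"
    using assms(1) unfolding negligible_def by blast
  then obtain \<epsilon> where \<epsilon>: "\<And>\<beta> \<eta>. \<beta> \<in> B \<Longrightarrow> \<eta> < \<beta> \<Longrightarrow> g \<eta> \<beta> < \<epsilon> \<eta>"
    unfolding bounding_def by blast
  \<comment> \<open>Starting the search at \<open>s \<eta>\<close> makes the element found in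
    \<open>K \<beta>\<close> strictly larger than \<eta>, as accumulation points require.\<close>
  obtain s where s: "\<And>x :: 'k. x < s x"
    using ex_greater by metis
  show ?thesis
  proof (intro exI[of _ B] exI[of _ "\<lambda>x. max (s x) (\<epsilon> (s x))"] conjI ballI B(1,2))
    fix \<beta> assume \<beta>: "\<beta> \<in> B"
    show "closed_points (\<lambda>x. max (s x) (\<epsilon> (s x))) \<inter> {..<\<beta>} \<subseteq> K \<beta>"
    proof
      fix \<gamma> assume \<gamma>: "\<gamma> \<in> closed_points (\<lambda>x. max (s x) (\<epsilon> (s x))) \<inter> {..<\<beta>}"
      have "\<exists>\<delta>\<in>K \<beta>. \<eta> < \<delta> \<and> \<delta> < \<gamma>" if "\<eta> < \<gamma>" for \<eta>
      proof -
        have *: "s \<eta> < \<gamma>" "\<epsilon> (s \<eta>) < \<gamma>" "\<gamma> < \<beta>"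
          using \<gamma> that by (auto simp: closed_points_def)
        then have "s \<eta> < \<beta>" by simp
        then have "g (s \<eta>) \<beta> \<in> K \<beta>" "s \<eta> \<le> g (s \<eta>) \<beta>" "g (s \<eta>) \<beta> < \<epsilon> (s \<eta>)"
          using g[of \<beta> "s \<eta>"] \<epsilon>[OF \<beta>] \<beta> B(1) by auto
        then show ?thesis
          using s[of \<eta>] *(2) by (intro bexI[of _ "g (s \<eta>) \<beta>"]) auto
      qed
      then have "\<gamma> \<in> acc_points (K \<beta>) \<inter> {..<\<beta>}"
        using \<gamma> by (simp add: acc_points_def closed_points_def)
      then show "\<gamma> \<in> K \<beta>"
        using K[of \<beta>] \<beta> B(1) unfolding club_in_def by blast
    qed
  qed
qed

text \<open>As a well-order, the cardinal of \<open>X\<close> is isomorphic to a proper initial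
  segment \<nu> of \<beta>, and \<open>f\<close> lists \<open>X\<close> along \<nu>.\<close>

lemma ex_cofinal_fun:
  assumes "X \<subseteq> {..<\<beta> :: 'k}" "\<And>\<gamma>. \<gamma> < \<beta> \<Longrightarrow> \<exists>x\<in>X. \<gamma> \<le> x" "|X| <o ord_rel {..<\<beta>}"
  shows "\<exists>\<nu> f. \<nu> < \<beta> \<and> (\<forall>i<\<nu>. f i < \<beta>) \<and> (\<forall>\<gamma><\<beta>. \<exists>i<\<nu>. \<gamma> \<le> f i)"
proof -
  obtain \<nu> where \<nu>: "\<nu> < \<beta>" "|X| =o Restr (ord_rel {..<\<beta>}) (underS (ord_rel {..<\<beta>}) \<nu>)"
    using iffD1[OF ordLess_iff_ordIso_Restr[OF Well_order_ord_rel card_of_Well_order] assms(3)]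
    by auto
  have "Restr (ord_rel {..<\<beta>}) (underS (ord_rel {..<\<beta>}) \<nu>) = ord_rel {..<\<nu>}"
    using \<nu>(1) by (auto simp: underS_def)
  then have "|X| =o |{..<\<nu>}|"
    using card_of_cong[OF \<nu>(2)] by (simp add: Field_card_of)
  then obtain f where f: "bij_betw f {..<\<nu>} X"
    using card_of_ordIso[of "{..<\<nu>}" X] ordIso_symmetric by blast
  have "f i < \<beta>" if "i < \<nu>" for i
    using bij_betwE[OF f] that assms(1) by blast
  moreover have "\<exists>i<\<nu>. \<gamma> \<le> f i" if \<gamma>: "\<gamma> < \<beta>" for \<gamma>
  proof -
    obtain x where "x \<in> X" "\<gamma> \<le> x" using assms(2)[OF \<gamma>] by blast
    moreover have "X = f ` {..<\<nu>}" using f by (simp add: bij_betw_def)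
    ultimately show ?thesis by auto
  qed
  ultimately show ?thesis using \<nu>(1) by blast
qed

text \<open>If \<beta> is not a cardinal, all of \<beta> can be listed in length below \<beta>; if
  it is a singular cardinal, a short cofinal set can.\<close>

lemma singular_cofinal_fun:
  assumes "infinite {..<\<beta>}" "\<beta> \<notin> (Reg :: 'k set)"
  shows "\<exists>\<nu> f. \<nu> < \<beta> \<and> (\<forall>i<\<nu>. f i < \<beta>) \<and> (\<forall>\<gamma><\<beta>. \<exists>i<\<nu>. \<gamma> \<le> f i)"
proof (cases "cardinal {..<\<beta>}")
  case False
  have "|{..<\<beta>}| \<le>o ord_rel {..<\<beta>}"
    using card_of_least[of "{..<\<beta>}" "ord_rel {..<\<beta>}"] Well_order_ord_rel[of "{..<\<beta>}"] by simp
  moreover have "\<not> ord_rel {..<\<beta>} \<le>o |{..<\<beta>}|"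
    using False Card_order_iff_ordLeq_card_of[of "ord_rel {..<\<beta>}"] by (simp add: cardinal_def)
  ultimately have "|{..<\<beta>}| <o ord_rel {..<\<beta>}"
    using not_ordLeq_iff_ordLess[of "|{..<\<beta>}|" "ord_rel {..<\<beta>}"]
      not_ordLeq_iff_ordLess[of "ord_rel {..<\<beta>}" "|{..<\<beta>}|"]
      Well_order_ord_rel[of "{..<\<beta>}"] card_of_Well_order[of "{..<\<beta>}"]
    by blast
  then show ?thesis
    by (intro ex_cofinal_fun[of "{..<\<beta>}"]) auto
next
  case True
  then have "\<not> regularCard (ord_rel {..<\<beta>})"
    using assms by (simp add: Reg_def infinite_regular_def)
  then obtain X where X: "X \<subseteq> {..<\<beta>}" "cofinal X (ord_rel {..<\<beta>})" "\<not> |X| =o ord_rel {..<\<beta>}"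
    by (auto simp: regularCard_def)
  have "|X| \<le>o |{..<\<beta>}|"
    using X(1) by (rule card_of_mono1)
  moreover have "|{..<\<beta>}| =o ord_rel {..<\<beta>}"
    using True card_of_Field_ordIso[of "ord_rel {..<\<beta>}"] by (simp add: cardinal_def)
  ultimately have "|X| \<le>o ord_rel {..<\<beta>}"
    by (rule ordLeq_ordIso_trans)
  then have "|X| <o ord_rel {..<\<beta>}"
    using X(3) by (simp add: ordLeq_iff_ordLess_or_ordIso)
  moreover have "\<exists>x\<in>X. \<gamma> \<le> x" if "\<gamma> < \<beta>" for \<gamma>
    using X(2) that unfolding cofinal_def by auto
  ultimately show ?thesis
    by (intro ex_cofinal_fun[OF X(1)]) auto
qed

text \<open>\<open>g\<close> lists a short cofinal sequence in each \<beta>. Fodor's lemma fixes the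
  length \<nu> on a stationary set; a bound for \<open>g\<close> would have its values on \<nu>
  below some \<open>b\<close>, against cofinality in \<beta> above \<open>b\<close>. Cutting off at
  \<theta> ensures that \<beta> is infinite.\<close>

lemma negligible_Compl_Reg: "negligible (- Reg)"
proof -
  define S where "S = - Reg \<inter> {\<theta><..}"
  have "infinite {..<\<beta>}" if "\<theta> < \<beta>" for \<beta>
    using infinite_theta finite_subset[of "{..<\<theta>}" "{..<\<beta>}"] less_imp_le[OF that]
    by (meson lessThan_subset_iff)
  then have "\<forall>\<beta>\<in>S. \<exists>p. fst p < \<beta> \<and> (\<forall>i<fst p. snd p i < \<beta>) \<and> (\<forall>\<gamma><\<beta>. \<exists>i<fst p. \<gamma> \<le> snd p i)"
    using singular_cofinal_fun unfolding S_def by (simp add: split_paired_Ex)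
  then obtain p where p: "\<And>\<beta>. \<beta> \<in> S \<Longrightarrow> fst (p \<beta>) < \<beta>"
    "\<And>\<beta> i. \<beta> \<in> S \<Longrightarrow> i < fst (p \<beta>) \<Longrightarrow> snd (p \<beta>) i < \<beta>"
    "\<And>\<beta> \<gamma>. \<beta> \<in> S \<Longrightarrow> \<gamma> < \<beta> \<Longrightarrow> \<exists>i<fst (p \<beta>). \<gamma> \<le> snd (p \<beta>) i"
    by metis
  define g where "g \<eta> \<beta> = (if \<beta> \<in> S \<and> \<eta> < fst (p \<beta>) then snd (p \<beta>) \<eta> else \<eta>)" for \<eta> \<beta>
  have "regressive g"
    using p(2) by (simp add: regressive_def g_def)
  moreover have "\<not> bounding g B" if B: "B \<subseteq> S" "stationary_in UNIV B" for B
  proof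
    assume "bounding g B"
    then obtain \<epsilon> where \<epsilon>: "\<And>\<beta> \<eta>. \<beta> \<in> B \<Longrightarrow> \<eta> < \<beta> \<Longrightarrow> g \<eta> \<beta> < \<epsilon> \<eta>"
      unfolding bounding_def by blast
    have "fst (p \<beta>) < \<beta>" if "\<beta> \<in> B" for \<beta>
      using p(1) B(1) that by blast
    then obtain \<nu> where \<nu>: "stationary_in UNIV {\<beta> \<in> B. fst (p \<beta>) = \<nu>}"
      by (rule Fodor[OF B(2)])
    obtain b where b: "\<forall>x\<in>\<epsilon> ` {..<\<nu>}. x < b"
      using small_bounded[OF small_image[OF small_lessThan]] by blast
    obtain \<beta> where \<beta>: "\<beta> \<in> B" "fst (p \<beta>) = \<nu>" "b < \<beta>"
      using stationary_ex_greater[OF \<nu>, of b] by blast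
    have \<beta>S: "\<beta> \<in> S" using \<beta>(1) B(1) by blast
    obtain i where i: "i < \<nu>" "b \<le> snd (p \<beta>) i"
      using p(3)[OF \<beta>S \<beta>(3)] \<beta>(2) by blast
    have "i < \<beta>" using i(1) \<beta>(2) p(1)[OF \<beta>S] by simp
    then have "snd (p \<beta>) i < \<epsilon> i"
      using \<epsilon>[OF \<beta>(1), of i] \<beta>S \<beta>(2) i(1) by (simp add: g_def)
    also have "\<epsilon> i < b" using b i(1) by simp
    finally show False using i(2) by simp
  qed
  ultimately have "negligible S"
    unfolding negligible_def by blast
  then have "negligible (S \<union> {..\<theta>})"
    using negligible_atMost by (rule negligible_Un)
  then show ?thesis
    by (rule negligible_subset) (auto simp: S_def)
qed

text \<open>An unbounded set of order type at most \<omega> has fewer elements than \<delta>, so it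
  is bounded in the regular \<delta>. This meets the cofinality clause of \<open>Tr\<close>.\<close>

lemma omega_less_cf:
  assumes "\<delta> \<in> (Reg :: 'k set)" "omega < \<delta>"
  shows "omega < cf \<delta>"
proof (rule ccontr)
  assume "\<not> omega < cf \<delta>"
  define P where "P \<gamma> \<longleftrightarrow> (\<exists>X. unbounded_in {..<\<delta>} X \<and> (ord_rel X, ord_rel {..<\<gamma>}) \<in> ordIso)" for \<gamma> :: 'k
  have reg: "infinite_regular {..<\<delta>}" using assms(1) by (simp add: Reg_def)
  have "P \<delta>"
    unfolding P_def using ordIso_reflexive[OF Well_order_ord_rel]
    by (intro exI[of _ "{..<\<delta>}"]) (auto simp: unbounded_in_def)
  then have "P (cf \<delta>)"
    unfolding cf_def P_def[symmetric] by (rule LeastI)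
  then obtain X where X: "unbounded_in {..<\<delta>} X" "ord_rel X =o ord_rel {..<cf \<delta>}"
    unfolding P_def by blast
  have "|X| =o |{..<cf \<delta>}|"
    using card_of_cong[OF X(2)] by simp
  moreover have "|{..<cf \<delta>}| \<le>o |{x \<in> {..<\<delta>}. x < omega}|"
    using assms(2) \<open>\<not> omega < cf \<delta>\<close> by (intro card_of_mono1) auto
  moreover have "|{x \<in> {..<\<delta>}. x < omega}| <o |{..<\<delta>}|"
    using card_less_below[OF reg] assms(2) by simp
  ultimately have "|X| <o |{..<\<delta>}|"
    by (metis ordIso_ordLeq_trans ordLeq_ordLess_trans)
  then obtain b where "b < \<delta>" "\<forall>x\<in>X. x < b"
    using card_less_bounded_in[OF reg, of X] X(1) by (auto simp: unbounded_in_def)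
  then show False
    using X(1) by (force simp: unbounded_in_def)
qed

lemma not_in_Tr_club:
  assumes "\<delta> \<in> (Reg :: 'k set)" "omega < \<delta>" "\<delta> \<notin> Tr S"
  shows "\<exists>K. club_in {..<\<delta>} K \<and> S \<inter> K = {}"
proof -
  have "\<not> stationary_in {..<\<delta>} (S \<inter> {..<\<delta>})"
    using assms omega_less_cf by (simp add: Tr_def)
  then obtain K where "club_in {..<\<delta>} K" "S \<inter> {..<\<delta>} \<inter> K = {}"
    by (auto simp: stationary_in_def)
  moreover from this(1) have "K \<subseteq> {..<\<delta>}"
    by (simp add: club_in_def unbounded_in_def)
  ultimately show ?thesis by blast
qed

end

section \<open>Mahloness, diamond star, reflection and square\<close>

locale not_onto_pair = regular_pair \<theta> for \<theta> :: "'k::wellorder" +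
  assumes not_onto: "\<not> onto_NS \<theta>"
begin

lemma proper: "\<not> negligible UNIV"
  using not_onto by (rule not_negligible_UNIV)

text \<open>"Full" refers to the filter dual to the negligible sets, which is proper here.\<close>

lemma full_stationary:
  assumes "negligible (- X)"
  shows "stationary_in UNIV X"
proof (rule ccontr)
  assume "\<not> stationary_in UNIV X"
  then have "negligible (X \<union> - X)"
    by (intro negligible_Un nonstationary_negligible assms)
  then show False using proper by (simp add: Compl_partition)
qed

lemma not_negligible_Reg: "\<not> negligible (Reg \<inter> {a<..})"
proof
  assume "negligible (Reg \<inter> {a<..})"
  then have "negligible (Reg \<inter> {a<..} \<union> (- Reg \<union> {..a}))"
    by (intro negligible_Un negligible_Compl_Reg negligible_atMost)
  moreover have "Reg \<inter> {a<..} \<union> (- Reg \<union> {..a}) = UNIV" by auto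
  ultimately show False using proper by simp
qed

text \<open>At a regular point above \<omega> outside \<open>Tr X\<close> some club misses
  \<open>X\<close>. If these points were not negligible, one club of \<kappa> would be contained,
  below stationarily many \<beta>, in the clubs chosen there, although it meets the stationary set
  \<open>X\<close>.\<close>

lemma full_Tr:
  assumes "negligible (- X)"
  shows "negligible (- Tr X)"
proof -
  define S where "S = - Tr X \<inter> (Reg \<inter> {omega<..})"
  have "negligible S"
  proof (rule ccontr)
    assume S: "\<not> negligible S"
    have "\<forall>\<beta>. \<exists>K. \<beta> \<in> S \<longrightarrow> club_in {..<\<beta>} K \<and> X \<inter> K = {}"
      using not_in_Tr_club by (auto simp: S_def)
    then obtain K where K: "\<And>\<beta>. \<beta> \<in> S \<Longrightarrow> club_in {..<\<beta>} (K \<beta>)" "\<And>\<beta>. \<beta> \<in> S \<Longrightarrow> X \<inter> K \<beta> = {}"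
      by metis
    obtain B F where B: "B \<subseteq> S" "stationary_in UNIV B"
      "\<forall>\<beta>\<in>B. closed_points F \<inter> {..<\<beta>} \<subseteq> K \<beta>"
      using club_sequence_captures[OF S, of K] K(1) by blast
    obtain \<gamma> where \<gamma>: "\<gamma> \<in> X" "\<gamma> \<in> closed_points F"
      using full_stationary[OF assms] unfolding stationary_iff by blast
    obtain \<beta> where \<beta>: "\<beta> \<in> B" "\<gamma> < \<beta>"
      using stationary_ex_greater[OF B(2)] by blast
    then show False
      using B(3) \<beta>(1) K(2)[of \<beta>] B(1) \<gamma> by blast
  qed
  then have "negligible (S \<union> (- Reg \<union> {..omega}))"
    by (intro negligible_Un negligible_Compl_Reg negligible_atMost)
  then show ?thesis
    by (rule negligible_subset) (auto simp: S_def)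
qed

text \<open>Successors are handled by \<open>full_Tr\<close>, limits of size below \<kappa> by
  \<kappa>-completeness of the ideal, and larger limits by its normality.\<close>

lemma full_Tr_iter:
  assumes "bijections \<pi>"
  shows "negligible (- Tr_iter \<pi> (Reg :: 'k set) \<alpha>)"
proof (induction \<alpha> rule: less_induct)
  case (less \<alpha>)
  consider "{..<\<alpha>} = {}" | \<beta> where "succ_of \<beta> \<alpha>"
    | "{..<\<alpha>} \<noteq> {}" "\<nexists>\<beta>. succ_of \<beta> \<alpha>" "|{..<\<alpha>}| <o |UNIV :: 'k set|"
    | "{..<\<alpha>} \<noteq> {}" "\<nexists>\<beta>. succ_of \<beta> \<alpha>" "|UNIV :: 'k set| \<le>o |{..<\<alpha>}|"
    using not_ordLess_iff_ordLeq[OF card_of_Well_order card_of_Well_order] by blast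
  then show ?case
  proof cases
    case 1
    then show ?thesis
      using negligible_Compl_Reg by (simp add: Tr_iter_zero)
  next
    case 2
    then show ?thesis
      using full_Tr[OF less.IH[of \<beta>]] by (simp add: Tr_iter_succ) (simp add: succ_of_def)
  next
    case 3
    have "negligible (\<Union>\<alpha>'\<in>{..<\<alpha>}. - Tr_iter \<pi> Reg \<alpha>')"
      using 3(3) less.IH by (intro negligible_UN) (auto simp: small_def)
    then show ?thesis
      using Tr_iter_small_limit[OF 3, of \<pi> Reg] by (simp add: Compl_INT)
  next
    case 4
    have lt: "\<pi> \<alpha> i < \<alpha>" for i
    proof -
      have "bij_betw (\<pi> \<alpha>) UNIV {..<\<alpha>}"
        using assms 4 unfolding bijections_def by blast
      then show ?thesis by (auto simp: bij_betw_def)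
    qed
    have "negligible {\<beta>. \<exists>i<\<beta>. \<beta> \<in> - Tr_iter \<pi> Reg (\<pi> \<alpha> i)}"
      by (rule negligible_diagonal_union) (rule less.IH[OF lt])
    then show ?thesis
      using Tr_iter_large_limit[OF 4 assms, of Reg]
      by (elim negligible_subset) auto
  qed
qed

lemma greatly_Mahlo: "greatly_Mahlo TYPE('k)"
  unfolding greatly_Mahlo_def using full_Tr_iter full_stationary by blast

text \<open>A bound for \<open>g\<close> yields a club \<open>E\<close> none of whose initial segments \<open>E \<inter> \<beta>\<close> is the \<open>\<eta>\<close>-th
  member of \<open>\<A> \<beta>\<close>: the element \<open>g \<eta> \<beta>\<close> of that member lies strictly between \<open>\<eta>\<close> and the next
  element of \<open>E\<close>.\<close>

lemma not_diamond_star: "\<not> diamond_star (Reg :: 'k set)"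
proof
  assume "diamond_star (Reg :: 'k set)"
  then obtain \<A> :: "'k \<Rightarrow> 'k set set" where \<A>: "\<And>\<beta>. \<beta> \<in> Reg \<Longrightarrow> |\<A> \<beta>| \<le>o |{..<\<beta>}|"
    and guess: "\<And>A. \<exists>C. club_in UNIV C \<and> (\<forall>\<beta> \<in> C \<inter> Reg. A \<inter> {..<\<beta>} \<in> \<A> \<beta>)"
    unfolding diamond_star_def by blast
  have "\<exists>a. \<beta> \<in> Reg \<longrightarrow> \<A> \<beta> \<subseteq> a ` {..<\<beta>}" for \<beta>
  proof (cases "\<A> \<beta> = {}")
    case False
    then show ?thesis
      using \<A>[of \<beta>] card_of_ordLeq2[of "\<A> \<beta>" "{..<\<beta>}"] by auto
  qed auto
  then obtain a where a: "\<And>\<beta>. \<beta> \<in> Reg \<Longrightarrow> \<A> \<beta> \<subseteq> a \<beta> ` {..<\<beta>}" by metis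
  define Q where "Q \<eta> \<beta> y \<longleftrightarrow> y \<in> a \<beta> \<eta> \<and> \<eta> < y \<and> y < \<beta>" for \<eta> \<beta> y
  define g where "g \<eta> \<beta> = (if \<exists>y. Q \<eta> \<beta> y then SOME y. Q \<eta> \<beta> y else \<eta>)" for \<eta> \<beta>
  have g: "Q \<eta> \<beta> (g \<eta> \<beta>)" if "Q \<eta> \<beta> y" for \<eta> \<beta> y
  proof -
    have "Q \<eta> \<beta> (SOME y. Q \<eta> \<beta> y)" using that by (rule someI)
    then show ?thesis using that by (auto simp: g_def)
  qed
  have "g \<eta> \<beta> < \<beta>" if "\<eta> < \<beta>" for \<eta> \<beta>
    using g[of \<eta> \<beta>] that by (cases "\<exists>y. Q \<eta> \<beta> y") (auto simp: Q_def g_def)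
  then have "regressive g" by (simp add: regressive_def)
  moreover have "\<not> negligible (Reg :: 'k set)"
    using not_negligible_Reg negligible_subset by blast
  ultimately obtain B where B: "B \<subseteq> Reg" "stationary_in UNIV B" "bounding g B"
    unfolding negligible_def by blast
  then obtain \<epsilon> where \<epsilon>: "\<And>\<beta> \<eta>. \<beta> \<in> B \<Longrightarrow> \<eta> < \<beta> \<Longrightarrow> g \<eta> \<beta> < \<epsilon> \<eta>"
    unfolding bounding_def by blast
  obtain C where C: "club_in UNIV C" "\<forall>\<beta> \<in> C \<inter> Reg. closed_points \<epsilon> \<inter> {..<\<beta>} \<in> \<A> \<beta>"
    using guess by blast
  obtain F where F: "closed_points F \<subseteq> C"
    using club_contains_closed_points[OF C(1)] by blast
  have "\<forall>x. \<exists>y. y \<in> closed_points \<epsilon> \<and> x < y"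
    using ex_closed_point by blast
  then obtain n where n: "\<And>x. n x \<in> closed_points \<epsilon> \<and> x < n x" by metis
  \<comment> \<open>Closure under \<open>F\<close> puts \<beta> into the club of correct guesses;
    closure under \<open>n\<close> makes \<open>closed_points \<epsilon>\<close> unbounded in
    \<beta>.\<close>
  obtain \<beta> where \<beta>: "\<beta> \<in> B" "\<beta> \<in> closed_points (\<lambda>x. max (F x) (n x))"
    using B(2) unfolding stationary_iff by blast
  have "\<beta> \<in> C"
    using \<beta>(2) F by (auto simp: closed_points_def)
  then have "closed_points \<epsilon> \<inter> {..<\<beta>} \<in> \<A> \<beta>"
    using C(2) \<beta>(1) B(1) by blast
  then obtain \<eta> where \<eta>: "\<eta> < \<beta>" "closed_points \<epsilon> \<inter> {..<\<beta>} = a \<beta> \<eta>"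
    using a[of \<beta>] \<beta>(1) B(1) by blast
  have "n \<eta> < \<beta>" using \<beta>(2) \<eta>(1) by (simp add: closed_points_def)
  then have "Q \<eta> \<beta> (n \<eta>)"
    using n[of \<eta>] unfolding Q_def \<eta>(2)[symmetric] by simp
  then have "Q \<eta> \<beta> (g \<eta> \<beta>)" by (rule g)
  then have "g \<eta> \<beta> \<in> closed_points \<epsilon>" "\<eta> < g \<eta> \<beta>"
    unfolding Q_def \<eta>(2)[symmetric] by auto
  then have "\<epsilon> \<eta> < g \<eta> \<beta>" by (simp add: closed_points_def)
  then show False using \<epsilon>[OF \<beta>(1) \<eta>(1)] by simp
qed

text \<open>A counterexample assigns to each \<delta> an index below \<delta> and a club missing
  that set. Fodor's lemma fixes the index \<open>i\<close>, and the club captured by the chosen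
  clubs cannot miss \<open>S i\<close>.\<close>

lemma stationary_Refl: "stationary_Refl (Reg :: 'k set)"
  unfolding stationary_Refl_def
proof (intro allI impI)
  fix S :: "'k \<Rightarrow> 'k set" assume S: "\<forall>i. stationary_in UNIV (S i)"
  show "\<exists>\<delta>\<in>Reg. \<delta> \<in> (\<Inter>i\<in>{..<\<delta>}. Tr (S i))"
  proof (rule ccontr)
    assume "\<not> ?thesis"
    then have "\<exists>i<\<delta>. \<delta> \<notin> Tr (S i)" if "\<delta> \<in> Reg" for \<delta>
      using that by auto
    then have "\<forall>\<delta>. \<exists>p. \<delta> \<in> Reg \<inter> {omega<..} \<longrightarrow>
        fst p < \<delta> \<and> club_in {..<\<delta>} (snd p) \<and> S (fst p) \<inter> snd p = {}"
      using not_in_Tr_club by (simp add: split_paired_Ex) blast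
    then obtain p where p: "\<And>\<delta>. \<delta> \<in> Reg \<inter> {omega<..} \<Longrightarrow> fst (p \<delta>) < \<delta>"
      "\<And>\<delta>. \<delta> \<in> Reg \<inter> {omega<..} \<Longrightarrow> club_in {..<\<delta>} (snd (p \<delta>))"
      "\<And>\<delta>. \<delta> \<in> Reg \<inter> {omega<..} \<Longrightarrow> S (fst (p \<delta>)) \<inter> snd (p \<delta>) = {}"
      by metis
    obtain B F where B: "B \<subseteq> Reg \<inter> {omega<..}" "stationary_in UNIV B"
      "\<forall>\<beta>\<in>B. closed_points F \<inter> {..<\<beta>} \<subseteq> snd (p \<beta>)"
      using club_sequence_captures[OF not_negligible_Reg, of omega "\<lambda>\<delta>. snd (p \<delta>)"] p(2) by blast
    have "fst (p \<beta>) < \<beta>" if "\<beta> \<in> B" for \<beta>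
      using p(1) B(1) that by blast
    then obtain i where i: "stationary_in UNIV {\<beta> \<in> B. fst (p \<beta>) = i}"
      by (rule Fodor[OF B(2)])
    obtain \<gamma> where \<gamma>: "\<gamma> \<in> S i" "\<gamma> \<in> closed_points F"
      using S unfolding stationary_iff by blast
    obtain \<beta> where \<beta>: "\<beta> \<in> B" "fst (p \<beta>) = i" "\<gamma> < \<beta>"
      using stationary_ex_greater[OF i, of \<gamma>] by blast
    then show False
      using B(3) \<beta>(1) p(3)[of \<beta>] B(1) \<gamma> by blast
  qed
qed

text \<open>The clubs \<open>K \<beta>\<close> chosen from \<open>\<C> \<beta>\<close> all contain \<open>E \<inter> \<beta>\<close> for one club \<open>E\<close>, so \<open>K \<beta> \<inter> \<alpha> \<in> \<C> \<alpha>\<close> for the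
  limits \<open>\<alpha>\<close> of \<open>E\<close>; as the members of \<open>\<C> \<alpha>\<close> already differ below some \<open>\<gamma> < \<alpha>\<close>, stationarily many of the \<open>K \<beta>\<close>
  cohere.\<close>

lemma not_square: "\<not> square (\<mu> :: 'k)"
proof
  assume "square \<mu>"
  then obtain \<C> :: "'k \<Rightarrow> 'k set set" where sq:
    "(\<forall>\<alpha>. \<C> \<alpha> \<noteq> {} \<and> |\<C> \<alpha>| <o |{..<\<mu>}| \<and> (\<forall>C \<in> \<C> \<alpha>. club_in {..<\<alpha>} C)) \<and>
      (\<forall>\<alpha>. \<forall>C \<in> \<C> \<alpha>. \<forall>\<beta> \<in> acc_points C \<inter> {..<\<alpha>}. C \<inter> {..<\<beta>} \<in> \<C> \<beta>) \<and>
      \<not> (\<exists>D. club_in UNIV D \<and> (\<forall>\<alpha> \<in> acc_points D. D \<inter> {..<\<alpha>} \<in> \<C> \<alpha>))"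
    unfolding square_def by (elim exE)
  have C: "\<C> \<alpha> \<noteq> {}" "|\<C> \<alpha>| <o |{..<\<mu>}|" "C \<in> \<C> \<alpha> \<Longrightarrow> club_in {..<\<alpha>} C" for \<alpha> C
    using sq by simp_all
  have coh: "C \<inter> {..<\<beta>} \<in> \<C> \<beta>" if "C \<in> \<C> \<alpha>" "\<beta> \<in> acc_points C" "\<beta> < \<alpha>" for \<alpha> C \<beta>
    using sq that by (meson IntI lessThan_iff)
  have no: "\<not> (\<exists>D. club_in UNIV D \<and> (\<forall>\<alpha> \<in> acc_points D. D \<inter> {..<\<alpha>} \<in> \<C> \<alpha>))"
    using sq by simp
  define K where "K \<alpha> = (SOME C. C \<in> \<C> \<alpha>)" for \<alpha>
  have K: "K \<alpha> \<in> \<C> \<alpha>" for \<alpha>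
    unfolding K_def using C(1) by (simp add: some_in_eq)
  have K_sub: "c \<subseteq> {..<\<alpha>}" if "c \<in> \<C> \<alpha>" for c \<alpha>
    using C(3)[OF that] by (simp add: club_in_def unbounded_in_def)
  obtain B F where B: "B \<subseteq> Reg \<inter> {\<mu><..}" "stationary_in UNIV B"
    "\<forall>\<beta>\<in>B. closed_points F \<inter> {..<\<beta>} \<subseteq> K \<beta>"
      using club_sequence_captures[OF not_negligible_Reg, of \<mu> K] C(3)[OF K] by blast
  have "\<forall>x. \<exists>y. y \<in> closed_points F \<and> x < y"
    using ex_closed_point by blast
  then obtain n where n: "\<And>x. n x \<in> closed_points F \<and> x < n x" by metis
  \<comment> \<open>Closed points of \<open>n\<close> are limits of closed points of
    \<open>F\<close> and hence accumulation points of \<open>K \<beta>\<close>.\<close>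
  have restr: "K \<beta> \<inter> {..<\<alpha>} \<in> \<C> \<alpha>" if "\<beta> \<in> B" "\<alpha> \<in> closed_points n" "\<alpha> < \<beta>" for \<alpha> \<beta>
  proof (rule coh[OF K _ that(3)])
    have "n \<gamma> \<in> K \<beta> \<and> \<gamma> < n \<gamma> \<and> n \<gamma> < \<alpha>" if "\<gamma> < \<alpha>" for \<gamma>
    proof -
      have "n \<gamma> < \<alpha>" using \<open>\<alpha> \<in> closed_points n\<close> that by (simp add: closed_points_def)
      then have "n \<gamma> \<in> closed_points F \<inter> {..<\<beta>}"
        using n[of \<gamma>] \<open>\<alpha> < \<beta>\<close> by simp
      then have "n \<gamma> \<in> K \<beta>"
        using bspec[OF B(3) \<open>\<beta> \<in> B\<close>] by (rule rev_subsetD)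
      then show ?thesis using n[of \<gamma>] \<open>n \<gamma> < \<alpha>\<close> by simp
    qed
    then show "\<alpha> \<in> acc_points (K \<beta>)"
      using that(2) unfolding acc_points_def closed_points_def by blast
  qed
  \<comment> \<open>For each pair of distinct members of \<open>\<C> \<alpha>\<close> a point of
    difference is chosen; there are fewer pairs than elements of the regular \<alpha>, so these
    points are bounded.\<close>
  have "\<exists>\<gamma><\<alpha>. \<forall>c\<in>\<C> \<alpha>. \<forall>c'\<in>\<C> \<alpha>. c \<inter> {..<\<gamma>} = c' \<inter> {..<\<gamma>} \<longrightarrow> c = c'" if "\<alpha> \<in> B" for \<alpha>
  proof -
    have \<alpha>: "infinite_regular {..<\<alpha>}" "\<mu> < \<alpha>"
      using that B(1) by (auto simp: Reg_def)
    have "|{x \<in> {..<\<alpha>}. x < \<mu>}| <o |{..<\<alpha>}|"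
      using card_less_below[OF \<alpha>(1)] \<alpha>(2) by simp
    moreover have "{x \<in> {..<\<alpha>}. x < \<mu>} = {..<\<mu>}" using \<alpha>(2) by auto
    ultimately have "|\<C> \<alpha>| <o |{..<\<alpha>}|"
      using ordLess_transitive[OF C(2)] by simp
    then have times: "|\<C> \<alpha> \<times> \<C> \<alpha>| <o |{..<\<alpha>}|"
      using \<alpha>(1) by (intro card_less_Times) (auto simp: infinite_regular_def)
    define d where "d p = (SOME x. x < \<alpha> \<and> (fst p = snd p \<or> (x \<in> fst p) \<noteq> (x \<in> snd p)))" for p
    have d: "d (c, c') < \<alpha> \<and> (c = c' \<or> (d (c, c') \<in> c) \<noteq> (d (c, c') \<in> c'))"
      if "c \<in> \<C> \<alpha>" "c' \<in> \<C> \<alpha>" for c c'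
    proof -
      have "\<exists>x. x < \<alpha> \<and> (c = c' \<or> (x \<in> c) \<noteq> (x \<in> c'))"
        using K_sub[OF that(1)] K_sub[OF that(2)] \<alpha>(2) by blast
      then show ?thesis
        unfolding d_def fst_conv snd_conv by (rule someI_ex)
    qed
    have "|d ` (\<C> \<alpha> \<times> \<C> \<alpha>)| <o |{..<\<alpha>}|"
      using ordLeq_ordLess_trans[OF card_of_image times] .
    moreover have "d ` (\<C> \<alpha> \<times> \<C> \<alpha>) \<subseteq> {..<\<alpha>}"
      using d by auto
    ultimately obtain \<gamma> where \<gamma>: "\<gamma> < \<alpha>" "\<forall>x\<in>d ` (\<C> \<alpha> \<times> \<C> \<alpha>). x < \<gamma>"
      using card_less_bounded_in[OF \<alpha>(1)] by blast
    have "c = c'" if c: "c \<in> \<C> \<alpha>" "c' \<in> \<C> \<alpha>" "c \<inter> {..<\<gamma>} = c' \<inter> {..<\<gamma>}" for c c'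
    proof -
      have "d (c, c') \<in> {..<\<gamma>}" using \<gamma>(2) c(1,2) by blast
      then show ?thesis using d[OF c(1,2)] c(3) by blast
    qed
    then show ?thesis using \<gamma>(1) by blast
  qed
  then obtain sep where sep: "\<And>\<alpha>. \<alpha> \<in> B \<Longrightarrow> sep \<alpha> < \<alpha>"
    "\<And>\<alpha> c c'. \<alpha> \<in> B \<Longrightarrow> c \<in> \<C> \<alpha> \<Longrightarrow> c' \<in> \<C> \<alpha> \<Longrightarrow> c \<inter> {..<sep \<alpha>} = c' \<inter> {..<sep \<alpha>} \<Longrightarrow> c = c'"
    by metis
  obtain \<gamma> where \<gamma>: "stationary_in UNIV {\<alpha> \<in> B. sep \<alpha> = \<gamma>}"
    by (rule Fodor[OF B(2) sep(1)])
  obtain \<gamma>' where \<gamma>': "\<gamma>' \<in> closed_points n" "\<gamma> < \<gamma>'"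
    using ex_closed_point by blast
  \<comment> \<open>Beyond \<gamma>' the trace of \<open>K \<alpha>\<close> on \<gamma>' belongs to
    the small family \<open>\<C> \<gamma>'\<close>, so a single trace occurs stationarily
    often.\<close>
  define B2 where "B2 = ({\<alpha> \<in> B. sep \<alpha> = \<gamma>} \<inter> closed_points n) \<inter> {\<gamma>'<..}"
  have B2: "stationary_in UNIV B2"
    unfolding B2_def by (intro stationary_Int_greater stationary_Int_closed_points \<gamma>)
  have small: "small (\<C> \<gamma>')"
    using ordLess_transitive[OF C(2)[of \<gamma>'], of "|UNIV :: 'k set|"] small_lessThan[of \<mu>]
    by (simp add: small_def)
  have "(\<lambda>\<alpha>. K \<alpha> \<inter> {..<\<gamma>'}) ` B2 \<subseteq> \<C> \<gamma>'"
    using restr \<gamma>'(1) by (auto simp: B2_def)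
  then obtain c where c: "stationary_in UNIV {\<alpha> \<in> B2. K \<alpha> \<inter> {..<\<gamma>'} = c}"
    by (rule stationary_pigeonhole[OF B2 small])
  define B3 where "B3 = {\<alpha> \<in> B2. K \<alpha> \<inter> {..<\<gamma>'} = c}"
  \<comment> \<open>Both sets belong to \<open>\<C> \<alpha>\<close> and agree below \<gamma>',
    which exceeds the separation point \<gamma>.\<close>
  have cohere: "K \<beta> \<inter> {..<\<alpha>} = K \<alpha>" if "\<alpha> \<in> B3" "\<beta> \<in> B3" "\<alpha> < \<beta>" for \<alpha> \<beta>
  proof (rule sep(2)[of \<alpha>])
    have \<alpha>: "\<alpha> \<in> B" "\<alpha> \<in> closed_points n" "sep \<alpha> = \<gamma>" "\<beta> \<in> B" "\<gamma>' < \<alpha>"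
      "K \<alpha> \<inter> {..<\<gamma>'} = K \<beta> \<inter> {..<\<gamma>'}"
      using that by (auto simp: B3_def B2_def)
    then show "\<alpha> \<in> B" "K \<beta> \<inter> {..<\<alpha>} \<in> \<C> \<alpha>" "K \<alpha> \<in> \<C> \<alpha>"
      using restr that(3) K by auto
    have "x \<in> K \<beta> \<inter> {..<\<alpha>} \<inter> {..<sep \<alpha>} \<longleftrightarrow> x \<in> K \<alpha> \<inter> {..<sep \<alpha>}" for x
    proof (cases "x < sep \<alpha>")
      case True
      then have "x < \<gamma>'" "x < \<alpha>"
        using \<alpha>(3,5) \<gamma>'(2) by simp_all
      then have "x \<in> K \<alpha> \<longleftrightarrow> x \<in> K \<beta>"
        using \<alpha>(6) by (metis IntD1 IntI lessThan_iff)
      then show ?thesis using True \<open>x < \<alpha>\<close> by simp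
    qed simp
    then show "K \<beta> \<inter> {..<\<alpha>} \<inter> {..<sep \<alpha>} = K \<alpha> \<inter> {..<sep \<alpha>}"
      by (rule set_eqI)
  qed
  define D where "D = (\<Union>\<alpha>\<in>B3. K \<alpha>)"
  have D: "D \<inter> {..<\<alpha>} = K \<alpha>" if "\<alpha> \<in> B3" for \<alpha>
  proof
    show "K \<alpha> \<subseteq> D \<inter> {..<\<alpha>}" using that K_sub[OF K] by (auto simp: D_def)
    show "D \<inter> {..<\<alpha>} \<subseteq> K \<alpha>"
    proof
      fix x assume "x \<in> D \<inter> {..<\<alpha>}"
      then obtain \<beta> where \<beta>: "\<beta> \<in> B3" "x \<in> K \<beta>" "x < \<alpha>" by (auto simp: D_def)
      then have "x < \<beta>" using K_sub[OF K] by blast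
      show "x \<in> K \<alpha>"
      proof (cases \<alpha> \<beta> rule: linorder_cases)
        case less
        then show ?thesis using cohere[OF that \<beta>(1)] \<beta> by blast
      next
        case greater
        then show ?thesis using cohere[OF \<beta>(1) that] \<beta> by blast
      qed (use \<beta> in simp)
    qed
  qed
  have acc: "\<exists>\<alpha>\<in>B3. x < \<alpha> \<and> x \<in> acc_points (K \<alpha>)" if x: "x \<in> acc_points D" for x
  proof -
    obtain \<alpha> where \<alpha>: "\<alpha> \<in> B3" "x < \<alpha>"
      using stationary_ex_greater[OF c, of x] by (auto simp: B3_def)
    have "\<exists>\<delta>\<in>K \<alpha>. \<gamma> < \<delta> \<and> \<delta> < x" if \<gamma>: "\<gamma> < x" for \<gamma>
    proof -
      obtain \<delta> where \<delta>: "\<delta> \<in> D" "\<gamma> < \<delta>" "\<delta> < x"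
        using x \<gamma> by (auto simp: acc_points_def)
      then have "\<delta> \<in> D \<inter> {..<\<alpha>}" using \<alpha>(2) by auto
      then show ?thesis using D[OF \<alpha>(1)] \<delta> by blast
    qed
    then have "x \<in> acc_points (K \<alpha>)"
      using x by (simp add: acc_points_def)
    then show ?thesis using \<alpha> by blast
  qed
  have "club_in UNIV D"
    unfolding club_in_def unbounded_in_def
  proof (intro conjI ballI subsetI)
    fix a :: 'k
    obtain \<alpha> where \<alpha>: "\<alpha> \<in> B3" "a < \<alpha>"
      using stationary_ex_greater[OF c, of a] by (auto simp: B3_def)
    then obtain \<beta> where "\<beta> \<in> K \<alpha>" "a \<le> \<beta>"
      using C(3)[OF K, of \<alpha>] unfolding club_in_def unbounded_in_def by blast
    then show "\<exists>\<beta>\<in>D. a \<le> \<beta>"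
      using \<alpha>(1) by (auto simp: D_def)
  next
    fix x assume "x \<in> acc_points D \<inter> UNIV"
    then obtain \<alpha> where \<alpha>: "\<alpha> \<in> B3" "x < \<alpha>" "x \<in> acc_points (K \<alpha>)"
      using acc[of x] by auto
    then have "x \<in> K \<alpha>"
      using C(3)[OF K, of \<alpha>] by (auto simp: club_in_def)
    then show "x \<in> D"
      using \<alpha>(1) by (auto simp: D_def)
  qed auto
  moreover have "D \<inter> {..<x} \<in> \<C> x" if x: "x \<in> acc_points D" for x
  proof -
    obtain \<alpha> where \<alpha>: "\<alpha> \<in> B3" "x < \<alpha>" "x \<in> acc_points (K \<alpha>)"
      using acc[OF x] by blast
    have "y \<in> K \<alpha> \<longleftrightarrow> y \<in> D" if "y < x" for y
      unfolding D[OF \<alpha>(1), symmetric] using \<alpha>(2) that by auto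
    then have "K \<alpha> \<inter> {..<x} = D \<inter> {..<x}"
      by blast
    then show ?thesis
      using coh[OF K \<alpha>(3,2)] by simp
  qed
  ultimately have "club_in UNIV D \<and> (\<forall>\<alpha>\<in>acc_points D. D \<inter> {..<\<alpha>} \<in> \<C> \<alpha>)"
    by simp
  then have "\<exists>D. club_in UNIV D \<and> (\<forall>\<alpha>\<in>acc_points D. D \<inter> {..<\<alpha>} \<in> \<C> \<alpha>)"
    by (rule exI)
  with no show False by (rule notE)
qed

end

subsection \<open>Souslin trees\<close>

lemma Partial_order_trans: "Partial_order r \<Longrightarrow> (x, y) \<in> r \<Longrightarrow> (y, z) \<in> r \<Longrightarrow> (x, z) \<in> r"
  unfolding partial_order_on_def preorder_on_def trans_def by blast

lemma Partial_order_antisym: "Partial_order r \<Longrightarrow> (x, y) \<in> r \<Longrightarrow> (y, x) \<in> r \<Longrightarrow> x = y"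
  unfolding partial_order_on_def antisym_def by blast

lemma Partial_order_refl: "Partial_order r \<Longrightarrow> x \<in> Field r \<Longrightarrow> (x, x) \<in> r"
  unfolding partial_order_on_def preorder_on_def refl_on_def by blast

lemma ord_rel_lessThan_unique:
  assumes "(R, ord_rel {..<\<alpha>}) \<in> ordIso" "(R, ord_rel {..<\<beta> :: 'k::wellorder}) \<in> ordIso"
  shows "\<alpha> = \<beta>"
proof -
  have less: "ord_rel {..<\<alpha>} <o ord_rel {..<\<beta>}" if "\<alpha> < \<beta>" for \<alpha> \<beta> :: 'k
  proof -
    have "Restr (ord_rel {..<\<beta>}) (underS (ord_rel {..<\<beta>}) \<alpha>) = ord_rel {..<\<alpha>}"
      using that by (auto simp: underS_def)
    moreover have "Field (ord_rel {..<\<beta>}) \<noteq> {}" using that by auto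
    ultimately show ?thesis
      using underS_Restr_ordLess[OF Well_order_ord_rel, of "{..<\<beta>}" \<alpha>] by simp
  qed
  have "ord_rel {..<\<alpha>} =o ord_rel {..<\<beta>}"
    using ordIso_transitive[OF ordIso_symmetric[OF assms(1)] assms(2)] .
  then show ?thesis
    using less[of \<alpha> \<beta>] less[of \<beta> \<alpha>] not_ordLess_ordIso ordIso_symmetric
    by (cases \<alpha> \<beta> rule: linorder_cases) blast+
qed

context regular_pair
begin

lemma not_small_subset:
  assumes "\<not> small A"
  shows "\<exists>A'\<subseteq>A. |A'| =o |UNIV :: 'k set|"
proof -
  have "|UNIV :: 'k set| \<le>o |A|"
    using assms not_ordLess_iff_ordLeq[OF card_of_Well_order card_of_Well_order]
    unfolding small_def by blast
  then obtain f where f: "inj_on f (UNIV :: 'k set)" "range f \<subseteq> A"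
    using card_of_ordLeq[of "UNIV :: 'k set" A] by auto
  have "|UNIV :: 'k set| =o |range f|"
    using card_of_ordIso[of "UNIV :: 'k set" "range f"] inj_on_imp_bij_betw[OF f(1)] by blast
  then show ?thesis
    using f(2) ordIso_symmetric by blast
qed

end

locale height_tree = regular_pair \<theta> for \<theta> :: "'k::wellorder" +
  fixes r :: "'b rel"
  assumes tree: "tree_of_height TYPE('k) r"
begin

definition lev :: "'b \<Rightarrow> 'k" where
  "lev x = (SOME \<alpha>. (Restr r (underS r x), ord_rel {..<\<alpha>}) \<in> ordIso)"

lemma order: "Partial_order r"
  using tree by (simp add: tree_of_height_def tree_def)

lemmas trans = Partial_order_trans[OF order]
lemmas antisym = Partial_order_antisym[OF order]

lemma refl: "x \<in> Field r \<Longrightarrow> (x, x) \<in> r"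
  using Partial_order_refl[OF order] .

lemma FieldI: "(x, y) \<in> r \<Longrightarrow> x \<in> Field r" "(x, y) \<in> r \<Longrightarrow> y \<in> Field r"
  by (auto simp: Field_def)

lemma lev_ordIso: "x \<in> Field r \<Longrightarrow> (Restr r (underS r x), ord_rel {..<lev x}) \<in> ordIso"
  unfolding lev_def
  by (rule someI_ex) (use tree in \<open>simp add: tree_of_height_def\<close>)

lemma lev_eqI: "x \<in> Field r \<Longrightarrow> (Restr r (underS r x), ord_rel {..<\<alpha>}) \<in> ordIso \<Longrightarrow> lev x = \<alpha>"
  using ord_rel_lessThan_unique[OF lev_ordIso] by blast

lemma Field_Restr_underS: "Field (Restr r (underS r x)) = underS r x"
proof
  show "underS r x \<subseteq> Field (Restr r (underS r x))"
  proof
    fix w assume w: "w \<in> underS r x"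
    then have "(w, w) \<in> r" by (intro refl FieldI(1)[of w x]) (simp add: underS_def)
    then show "w \<in> Field (Restr r (underS r x))"
      using w by (intro FieldI1[of w w]) simp
  qed
qed (auto simp: Field_def)

text \<open>The collapse of the predecessors of \<open>x\<close> maps each of them to its level.\<close>

lemma lev_underS:
  assumes x: "x \<in> Field r"
  shows "bij_betw lev (underS r x) {..<lev x}"
    "a \<in> underS r x \<Longrightarrow> b \<in> underS r x \<Longrightarrow> (a, b) \<in> r \<longleftrightarrow> lev a \<le> lev b"
proof -
  obtain f where "iso (Restr r (underS r x)) (ord_rel {..<lev x}) f"
    using lev_ordIso[OF x] unfolding ordIso_def by blast
  then have f: "bij_betw f (underS r x) {..<lev x}"
    and f_iff: "\<And>a b. a \<in> underS r x \<Longrightarrow> b \<in> underS r x \<Longrightarrow>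
      (a, b) \<in> Restr r (underS r x) \<longleftrightarrow> (f a, f b) \<in> ord_rel {..<lev x}"
    by (auto simp: iso_iff2 Field_Restr_underS)
  have f_less: "f a < lev x" if "a \<in> underS r x" for a
    using bij_betwE[OF f] that by blast
  have f_le: "(a, b) \<in> r \<longleftrightarrow> f a \<le> f b" if "a \<in> underS r x" "b \<in> underS r x" for a b
    using f_iff[OF that] f_less that by simp
  have f_lev: "lev w = f w" if w: "w \<in> underS r x" for w
  proof (rule lev_eqI)
    show wF: "w \<in> Field r" using w by (auto simp: underS_def Field_def)
    have sub: "underS r w \<subseteq> underS r x"
      using w trans antisym unfolding underS_def by blast
    have img: "f ` underS r w = {..<f w}"
    proof
      show "f ` underS r w \<subseteq> {..<f w}"
      proof
        fix i assume "i \<in> f ` underS r w"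
        then obtain a where a: "a \<in> underS r w" "i = f a" by blast
        then have ax: "a \<in> underS r x" using sub by blast
        have "(a, w) \<in> r" "(w, a) \<notin> r"
          using a(1) antisym[of a w] by (auto simp: underS_def)
        then show "i \<in> {..<f w}"
          using f_le[OF ax w] f_le[OF w ax] a(2) by auto
      qed
      show "{..<f w} \<subseteq> f ` underS r w"
      proof
        fix i assume i: "i \<in> {..<f w}"
        then have "i \<in> f ` underS r x"
          using f f_less[OF w] by (auto simp: bij_betw_def)
        then obtain a where a: "a \<in> underS r x" "i = f a" by blast
        then have "(a, w) \<in> r" "a \<noteq> w"
          using f_le[OF a(1) w] i by auto
        then show "i \<in> f ` underS r w"
          using a(2) by (auto simp: underS_def)
      qed
    qed
    have "inj_on f (underS r w)"
      using f sub inj_on_subset unfolding bij_betw_def by blast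
    then have "iso (Restr r (underS r w)) (ord_rel {..<f w}) f"
      unfolding iso_iff2 Field_Restr_underS Field_ord_rel
      using img f_le sub by (auto simp: bij_betw_def)
    moreover have "Well_order (Restr r (underS r w))"
      using tree wF by (simp add: tree_of_height_def tree_def)
    ultimately show "(Restr r (underS r w), ord_rel {..<f w}) \<in> ordIso"
      using Well_order_ord_rel[of "{..<f w}"] unfolding ordIso_def by blast
  qed
  then show "bij_betw lev (underS r x) {..<lev x}"
    using f by (simp cong: bij_betw_cong)
  show "a \<in> underS r x \<Longrightarrow> b \<in> underS r x \<Longrightarrow> (a, b) \<in> r \<longleftrightarrow> lev a \<le> lev b"
    using f_lev f_le by simp
qed

lemma lev_less: "(x, y) \<in> r \<Longrightarrow> x \<noteq> y \<Longrightarrow> lev x < lev y"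
  using bij_betwE[OF lev_underS(1)[of y]] FieldI(2)[of x y] by (auto simp: underS_def)

lemma lev_mono: "(x, y) \<in> r \<Longrightarrow> lev x \<le> lev y"
  using lev_less by (cases "x = y") (auto intro: less_imp_le)

lemma ex_predecessor:
  assumes "x \<in> Field r" "\<gamma> < lev x"
  shows "\<exists>w. (w, x) \<in> r \<and> lev w = \<gamma>"
proof -
  have "\<gamma> \<in> lev ` underS r x"
    using lev_underS(1)[OF assms(1)] assms(2) by (simp add: bij_betw_def)
  then show ?thesis by (auto simp: underS_def)
qed

text \<open>The predecessors of \<open>y\<close> are ordered by their levels; the cases in which
  \<open>u\<close> or \<open>v\<close> is \<open>y\<close> itself are separate.\<close>

lemma below_common:
  assumes "(u, y) \<in> r" "(v, y) \<in> r" "lev u \<le> lev v"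
  shows "(u, v) \<in> r"
proof (cases "u = y \<or> v = y")
  case True
  then show ?thesis
    using assms lev_less[of v y] FieldI(1)[OF assms(1)] refl by fastforce
next
  case False
  then show ?thesis
    using lev_underS(2)[of y u v] assms FieldI(2) by (simp add: underS_def)
qed

text \<open>One fixed node per level lets ordinals below \<kappa> stand for tree nodes in the
  colouring.\<close>

definition node :: "'k \<Rightarrow> 'b" where
  "node \<beta> = (SOME x. x \<in> Field r \<and> lev x = \<beta>)"

lemma node: "node \<beta> \<in> Field r" "lev (node \<beta>) = \<beta>"
proof -
  obtain x where x: "x \<in> Field r" "(Restr r (underS r x), ord_rel {..<\<beta>}) \<in> ordIso"
    using tree unfolding tree_of_height_def by blast
  then have "x \<in> Field r \<and> lev x = \<beta>"
    using lev_eqI by blast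
  then have "node \<beta> \<in> Field r \<and> lev (node \<beta>) = \<beta>"
    unfolding node_def by (rule someI)
  then show "node \<beta> \<in> Field r" "lev (node \<beta>) = \<beta>" by auto
qed

definition above :: "'b \<Rightarrow> 'k set" where
  "above x = {\<beta>. (x, node \<beta>) \<in> r}"

text \<open>Restricting to these nodes plays the part of normalising the tree: in a Souslin tree
  they extend to every higher level and split.\<close>

definition branching :: "'b set" where
  "branching = {x \<in> Field r. unbounded (above x)}"

end

section \<open>The colouring of a Souslin tree\<close>

locale souslin = height_tree \<theta> r for \<theta> :: "'k::wellorder" and r :: "'b rel" +
  assumes no_chain: "\<nexists>C. C \<in> Chains r \<and> |C| =o |UNIV :: 'k set|"
    and no_antichain:
      "\<nexists>A. A \<subseteq> Field r \<and> (\<forall>x\<in>A. \<forall>y\<in>A. (x, y) \<in> r \<longrightarrow> x = y) \<and> |A| =o |UNIV :: 'k set|"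
begin

lemma small_antichain:
  assumes "A \<subseteq> Field r" "\<And>x y. x \<in> A \<Longrightarrow> y \<in> A \<Longrightarrow> (x, y) \<in> r \<Longrightarrow> x = y"
  shows "small A"
proof (rule ccontr)
  assume "\<not> small A"
  then obtain A' where "A' \<subseteq> A" "|A'| =o |UNIV :: 'k set|"
    using not_small_subset by blast
  then show False
    using no_antichain assms by (meson subset_iff)
qed

lemma small_chain:
  assumes "\<And>x y. x \<in> C \<Longrightarrow> y \<in> C \<Longrightarrow> (x, y) \<in> r \<or> (y, x) \<in> r"
  shows "small C"
proof (rule ccontr)
  assume "\<not> small C"
  then obtain C' where C': "C' \<subseteq> C" "|C'| =o |UNIV :: 'k set|"
    using not_small_subset by blast
  then have "C' \<in> Chains r"
    unfolding Chains_def using assms by blast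
  then show False
    using no_chain C'(2) by blast
qed

lemma small_level: "small {x \<in> Field r. lev x = \<gamma>}"
  by (rule small_antichain) (use lev_less in force)+

lemma small_levels: "small {x \<in> Field r. lev x \<le> \<gamma>}"
proof (rule small_subset)
  show "small (\<Union>i\<in>{..\<gamma>}. {x \<in> Field r. lev x = i})"
    by (intro small_UN small_atMost small_level)
qed auto

text \<open>Each chosen node above level \<delta> has a predecessor on that level. The level is an
  antichain and hence small, so one predecessor serves unboundedly many \<beta>.\<close>

lemma ex_node_below:
  assumes "unbounded B"
  shows "\<exists>z\<in>Field r. lev z = \<delta> \<and> unbounded (B \<inter> above z)"
proof -
  have "\<forall>\<beta>\<in>B \<inter> {\<delta><..}. \<exists>w. (w, node \<beta>) \<in> r \<and> lev w = \<delta>"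
    using ex_predecessor[OF node(1)] node(2) by auto
  then obtain w where w: "\<forall>\<beta>\<in>B \<inter> {\<delta><..}. (w \<beta>, node \<beta>) \<in> r \<and> lev (w \<beta>) = \<delta>"
    using bchoice[of "B \<inter> {\<delta><..}" "\<lambda>\<beta> w. (w, node \<beta>) \<in> r \<and> lev w = \<delta>"] by blast
  have "w ` (B \<inter> {\<delta><..}) \<subseteq> {x \<in> Field r. lev x = \<delta>}"
    using w FieldI(1) by blast
  then obtain z where z: "z \<in> Field r" "lev z = \<delta>" "unbounded {\<beta> \<in> B \<inter> {\<delta><..}. w \<beta> = z}"
    using unbounded_pigeonhole[OF unbounded_greaterThan[OF assms] small_level, of w \<delta> \<delta>] by blast
  have "{\<beta> \<in> B \<inter> {\<delta><..}. w \<beta> = z} \<subseteq> B \<inter> above z"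
    using w by (auto simp: above_def)
  then show ?thesis
    using unbounded_subset[OF z(3)] z(1,2) by blast
qed

lemma branching_down: "x \<in> branching \<Longrightarrow> (w, x) \<in> r \<Longrightarrow> w \<in> branching"
  using unbounded_subset[of "above x" "above w"] trans FieldI(1)
  unfolding branching_def above_def by blast

lemma branching_extend:
  assumes "x \<in> branching" "lev x < \<delta>"
  shows "\<exists>z\<in>branching. lev z = \<delta> \<and> (x, z) \<in> r"
proof -
  obtain z where z: "z \<in> Field r" "lev z = \<delta>" "unbounded (above x \<inter> above z)"
    using ex_node_below[of "above x" \<delta>] assms(1) by (auto simp: branching_def)
  then obtain \<beta> where "\<beta> \<in> above x" "\<beta> \<in> above z"
    unfolding unbounded_def by blast
  then have "(x, z) \<in> r"
    using below_common[of x "node \<beta>" z] assms(2) z(2) by (simp add: above_def)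
  moreover have "z \<in> branching"
    using z unbounded_subset[OF z(3), of "above z"] by (simp add: branching_def)
  ultimately show ?thesis using z(2) by blast
qed

text \<open>Otherwise the branching nodes above \<open>w\<close> would form a chain that meets every
  level above \<open>lev w\<close>.\<close>

lemma branching_split:
  assumes "w \<in> branching"
  shows "\<exists>u\<in>branching. \<exists>v\<in>branching. (w, u) \<in> r \<and> (w, v) \<in> r \<and> (u, v) \<notin> r \<and> (v, u) \<notin> r"
proof (rule ccontr)
  assume no: "\<not> ?thesis"
  have "small {z \<in> branching. (w, z) \<in> r}"
    by (rule small_chain) (use no in blast)
  then have "small (lev ` {z \<in> branching. (w, z) \<in> r})"
    by (rule small_image)
  moreover have "{lev w<..} \<subseteq> lev ` {z \<in> branching. (w, z) \<in> r}"
    using branching_extend[OF assms] by force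
  ultimately have "small {lev w<..}"
    by (rule small_subset)
  then show False
    using ex_greater small_bounded[of "{lev w<..}"]
    by (metis greaterThan_iff less_asym less_trans not_less_iff_gr_or_eq)
qed

text \<open>Along a branch of length greater than \<open>\<theta>\<close> above \<open>x\<close>, split off one node at each of \<open>\<theta>\<close> levels
  that are so sparse that each split occurs below the next level.\<close>

lemma ex_antichain:
  assumes "x \<in> branching"
  shows "\<exists>a. \<forall>i<\<theta>. a i \<in> branching \<and> (x, a i) \<in> r \<and> (\<forall>j<\<theta>. (a i, a j) \<in> r \<longrightarrow> i = j)"
proof -
  have "\<forall>w\<in>branching. \<exists>p. fst p \<in> branching \<and> snd p \<in> branching \<and> (w, fst p) \<in> r \<and> (w, snd p) \<in> r
      \<and> (fst p, snd p) \<notin> r \<and> (snd p, fst p) \<notin> r"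
    using branching_split by (simp add: split_paired_Ex) blast
  then obtain p where p: "\<forall>w\<in>branching. fst (p w) \<in> branching \<and> snd (p w) \<in> branching \<and>
      (w, fst (p w)) \<in> r \<and> (w, snd (p w)) \<in> r \<and> (fst (p w), snd (p w)) \<notin> r \<and> (snd (p w), fst (p w)) \<notin> r"
    using bchoice[of branching "\<lambda>w p. fst p \<in> branching \<and> snd p \<in> branching \<and> (w, fst p) \<in> r \<and>
      (w, snd p) \<in> r \<and> (fst p, snd p) \<notin> r \<and> (snd p, fst p) \<notin> r"] by blast
  have "\<exists>b. \<forall>w\<in>{w \<in> Field r. lev w \<le> \<gamma>}. max (lev (fst (p w))) (lev (snd (p w))) < b" for \<gamma>
    using small_bounded[OF small_image[OF small_levels, of "\<lambda>w. max (lev (fst (p w))) (lev (snd (p w)))"]]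
    by blast
  then obtain F where F: "\<And>\<gamma> w. w \<in> {w \<in> Field r. lev w \<le> \<gamma>} \<Longrightarrow>
      max (lev (fst (p w))) (lev (snd (p w))) < F \<gamma>" by metis
  have "unbounded (closed_points F)"
    unfolding unbounded_def using ex_closed_point by blast
  then have "\<exists>q :: 'k \<Rightarrow> 'k. range q \<subseteq> closed_points F \<inter> {lev x<..} \<and> strict_mono q"
    by (intro unbounded_enum unbounded_greaterThan)
  then obtain q :: "'k \<Rightarrow> 'k" where q_range: "range q \<subseteq> closed_points F \<inter> {lev x<..}"
    and q_mono: "strict_mono q"
    by (elim exE conjE)
  have q: "q i \<in> closed_points F \<inter> {lev x<..}" for i using q_range by blast
  have q_less: "q i < q j" if "i < j" for i j using q_mono that by (rule strict_monoD)
  obtain d where d: "\<forall>x\<in>q ` {..<\<theta>}. x < d"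
    using small_bounded[OF small_image[OF small_lessThan]] by blast
  obtain i0 where "i0 < \<theta>"
    using infinite_theta by (metis finite.emptyI lessThan_iff all_not_in_conv)
  then have "lev x < d"
    using d q[of i0] by (auto intro: less_trans)
  then obtain y where y: "y \<in> branching" "lev y = d" "(x, y) \<in> r"
    using branching_extend[OF assms] by blast
  have "\<forall>i. \<exists>w. i < \<theta> \<longrightarrow> (w, y) \<in> r \<and> lev w = q i"
    using ex_predecessor[of y] y(1,2) d by (auto simp: branching_def)
  then obtain w where w: "\<And>i. i < \<theta> \<Longrightarrow> (w i, y) \<in> r \<and> lev (w i) = q i" by metis
  \<comment> \<open>At most one half of the split at \<open>w i\<close> lies below \<open>y\<close>;
    the other half is chosen.\<close>
  define a where "a i = (if (fst (p (w i)), y) \<in> r then snd (p (w i)) else fst (p (w i)))" for i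
  have a: "a i \<in> branching \<and> (w i, a i) \<in> r \<and> (x, a i) \<in> r \<and> (a i, y) \<notin> r \<and> lev (a i) < F (q i)"
    if i: "i < \<theta>" for i
  proof -
    have wb: "w i \<in> branching" using branching_down[OF y(1)] w[OF i] by blast
    then have pw: "fst (p (w i)) \<in> branching" "snd (p (w i)) \<in> branching"
      "(w i, fst (p (w i))) \<in> r" "(w i, snd (p (w i))) \<in> r"
      "(fst (p (w i)), snd (p (w i))) \<notin> r" "(snd (p (w i)), fst (p (w i))) \<notin> r"
      using p by auto
    have "(snd (p (w i)), y) \<notin> r" if "(fst (p (w i)), y) \<in> r"
      using below_common[OF that, of "snd (p (w i))"] below_common[OF _ that, of "snd (p (w i))"]
        pw(5,6) linear by blast
    moreover have "(x, w i) \<in> r"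
      using below_common[OF y(3), of "w i"] w[OF i] q[of i] by (simp add: less_imp_le)
    moreover have "w i \<in> {w \<in> Field r. lev w \<le> q i}"
      using w[OF i] FieldI(1) by auto
    then have "lev (fst (p (w i))) < F (q i)" "lev (snd (p (w i))) < F (q i)"
      using F[of "w i" "q i"] by auto
    ultimately show ?thesis
      using pw trans unfolding a_def by auto
  qed
  have sep: "lev (a i) < q j" if "i < \<theta>" "i < j" for i j
  proof -
    have "F (q i) < q j"
      using q[of j] q_less[OF that(2)] by (simp add: closed_points_def)
    then show ?thesis using a[OF that(1)] by (auto intro: less_trans)
  qed
  \<comment> \<open>Below \<open>a j\<close>, the lower node \<open>a i\<close> would lie under
    \<open>w j\<close> and so under \<open>y\<close>.\<close>
  have "\<not> (a i, a j) \<in> r" if ij: "i < \<theta>" "j < \<theta>" "i < j" for i j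
  proof
    assume "(a i, a j) \<in> r"
    then have "(a i, w j) \<in> r"
      using below_common[of "a i" "a j" "w j"] a[OF ij(2)] w[OF ij(2)] sep[OF ij(1,3)] by simp
    then have "(a i, y) \<in> r" using w[OF ij(2)] trans by blast
    then show False using a[OF ij(1)] by blast
  qed
  moreover have "\<not> (a j, a i) \<in> r" if ij: "i < \<theta>" "j < \<theta>" "i < j" for i j
  proof
    assume "(a j, a i) \<in> r"
    then have "lev (w j) \<le> lev (a i)"
      using a[OF ij(2)] lev_mono order_trans by blast
    then show False using sep[OF ij(1,3)] w[OF ij(2)] by simp
  qed
  ultimately have "i = j" if "i < \<theta>" "j < \<theta>" "(a i, a j) \<in> r" for i j
    using that by (cases i j rule: linorder_cases) blast+
  then show ?thesis
    using a by blast
qed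

text \<open>The minimal bad nodes form an antichain, so they are small in number and the parts of
  \<open>B\<close> above them are bounded together by some \<open>b\<close>. Take \<open>z\<close>
  on a level above all of them, with unboundedly many points of \<open>B\<close> beyond
  \<open>b\<close> above it. A bad node above \<open>z\<close> would put a minimal bad node below
  \<open>z\<close>, against the choice of \<open>b\<close>.\<close>

lemma ex_dense_above:
  assumes "unbounded B"
  shows "\<exists>x\<in>branching. \<forall>y\<in>branching. (x, y) \<in> r \<longrightarrow> unbounded (B \<inter> above y)"
proof -
  define bad where "bad = {y \<in> Field r. \<not> unbounded (B \<inter> above y)}"
  define A where "A = {a \<in> bad. \<forall>w\<in>bad. (w, a) \<in> r \<longrightarrow> w = a}"
  have A: "small A"
    by (rule small_antichain) (auto simp: A_def bad_def)
  obtain \<gamma> where \<gamma>: "\<forall>i\<in>lev ` A. i < \<gamma>"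
    using small_bounded[OF small_image[OF A]] by blast
  have "small (\<Union>a\<in>A. B \<inter> above a)"
    using A by (rule small_UN) (auto simp: small_iff_not_unbounded A_def bad_def)
  then obtain b where b: "\<forall>\<beta>\<in>(\<Union>a\<in>A. B \<inter> above a). \<beta> < b"
    using small_bounded by blast
  obtain z where z: "z \<in> Field r" "lev z = \<gamma>" "unbounded (B \<inter> {b<..} \<inter> above z)"
    using ex_node_below[OF unbounded_greaterThan[OF assms]] by blast
  have "unbounded (B \<inter> above y)" if y: "y \<in> branching" "(z, y) \<in> r" for y
  proof (rule ccontr)
    assume "\<not> unbounded (B \<inter> above y)"
    then have "y \<in> bad" using y(1) by (simp add: bad_def branching_def)
    define P where "P i \<longleftrightarrow> (\<exists>a. a \<in> bad \<and> (a, y) \<in> r \<and> lev a = i)" for i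
    have "P (lev y)"
      using \<open>y \<in> bad\<close> refl[OF FieldI(2)[OF y(2)]] by (auto simp: P_def)
    then have "P (LEAST i. P i)" by (rule LeastI)
    then obtain a where a: "a \<in> bad" "(a, y) \<in> r" "lev a = (LEAST i. P i)"
      by (auto simp: P_def)
    have "w = a" if w: "w \<in> bad" "(w, a) \<in> r" for w
    proof (rule ccontr)
      assume "w \<noteq> a"
      then have "lev w < (LEAST i. P i)" using lev_less[OF w(2)] a(3) by simp
      then have "\<not> P (lev w)" by (rule not_less_Least)
      then show False using w trans[OF w(2) a(2)] by (auto simp: P_def)
    qed
    then have aA: "a \<in> A" using a(1) by (auto simp: A_def)
    then have "lev a \<le> lev z" using \<gamma> z(2) by auto
    then have "(a, z) \<in> r" using below_common[OF a(2) y(2)] by simp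
    obtain \<beta> where \<beta>: "\<beta> \<in> B" "b < \<beta>" "\<beta> \<in> above z"
      using z(3) unfolding unbounded_def by blast
    then have "\<beta> \<in> B \<inter> above a"
      using trans[OF \<open>(a, z) \<in> r\<close>] by (simp add: above_def)
    then have "\<beta> < b" using b aA by blast
    then show False using \<beta>(2) by simp
  qed
  moreover have "unbounded (above z)"
    by (rule unbounded_subset[OF z(3)]) blast
  then have "z \<in> branching" using z(1) by (simp add: branching_def)
  ultimately show ?thesis by blast
qed

text \<open>This allows the branching nodes to be enumerated by \<kappa> and thus to serve as rows
  of the colouring.\<close>

lemma card_branching: "|branching| \<le>o |UNIV :: 'k set|"
proof -
  have "branching \<subseteq> (\<Union>\<gamma>\<in>UNIV. {x \<in> Field r. lev x = \<gamma>})"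
    by (auto simp: branching_def)
  moreover have "|\<Union>\<gamma>\<in>(UNIV :: 'k set). {x \<in> Field r. lev x = \<gamma>}| \<le>o |UNIV :: 'k set|"
  proof (rule card_of_UNION_ordLeq_infinite[OF infinite_UNIV])
    show "|UNIV :: 'k set| \<le>o |UNIV :: 'k set|"
      by (rule card_of_mono1) simp
    show "\<forall>\<gamma>\<in>UNIV. |{x \<in> Field r. lev x = \<gamma>}| \<le>o |UNIV :: 'k set|"
      using small_level unfolding small_def by (blast intro: ordLess_imp_ordLeq)
  qed
  ultimately show ?thesis
    using ordLeq_transitive[OF card_of_mono1] by blast
qed

text \<open>Row \<eta> uses an antichain of \<theta> branching nodes above the node
  \<open>q \<eta>\<close>, and \<beta> is coloured by the member below \<open>node \<beta>\<close>.
  If \<open>q \<eta>\<close> comes from \<open>ex_dense_above\<close> for \<open>B\<close>, every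
  member has nodes indexed by \<open>B\<close> above it on unboundedly many levels.\<close>

lemma onto: "onto_NS \<theta>"
proof (rule ccontr)
  assume not_onto: "\<not> onto_NS \<theta>"
  have "unbounded UNIV" using ex_greater by (auto simp: unbounded_def)
  then have "branching \<noteq> {}" using ex_dense_above by blast
  then obtain q where q: "q ` (UNIV :: 'k set) = branching"
    using card_branching card_of_ordLeq2[of branching "UNIV :: 'k set"] by blast
  obtain i0 where i0: "i0 < \<theta>"
    using infinite_theta by (metis finite.emptyI lessThan_iff all_not_in_conv)
  obtain a where a: "\<forall>x\<in>branching. \<forall>i<\<theta>. a x i \<in> branching \<and> (x, a x i) \<in> r \<and>
      (\<forall>j<\<theta>. (a x i, a x j) \<in> r \<longrightarrow> i = j)"
    using bchoice[of branching "\<lambda>x a. \<forall>i<\<theta>. a i \<in> branching \<and> (x, a i) \<in> r \<and>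
      (\<forall>j<\<theta>. (a i, a j) \<in> r \<longrightarrow> i = j)"] ex_antichain by blast
  define hit where "hit \<eta> \<beta> i \<longleftrightarrow> i < \<theta> \<and> (a (q \<eta>) i, node \<beta>) \<in> r" for \<eta> \<beta> i
  \<comment> \<open>If no member of the antichain lies below the node, the colour is the default
    \<open>i0\<close>.\<close>
  define c where "c p = (if \<exists>i. hit (fst p) (snd p) i then SOME i. hit (fst p) (snd p) i else i0)" for p
  have hit_unique: "i = j" if "hit \<eta> \<beta> i" "hit \<eta> \<beta> j" for \<eta> \<beta> i j
  proof -
    have ij: "i < \<theta>" "j < \<theta>" "(a (q \<eta>) i, node \<beta>) \<in> r" "(a (q \<eta>) j, node \<beta>) \<in> r"
      using that by (auto simp: hit_def)
    then have "(a (q \<eta>) i, a (q \<eta>) j) \<in> r \<or> (a (q \<eta>) j, a (q \<eta>) i) \<in> r"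
      using below_common[OF ij(3,4)] below_common[OF ij(4,3)] linear by blast
    moreover have "q \<eta> \<in> branching" using q by blast
    ultimately show ?thesis
      using bspec[OF a, of "q \<eta>"] ij(1,2) by metis
  qed
  have c_hit: "c (\<eta>, \<beta>) = i" if "hit \<eta> \<beta> i" for \<eta> \<beta> i
  proof -
    have "hit \<eta> \<beta> (SOME i. hit \<eta> \<beta> i)" using that by (rule someI)
    then show ?thesis
      using that hit_unique by (auto simp: c_def)
  qed
  have "c (\<eta>, \<beta>) < \<theta>" for \<eta> \<beta>
  proof (cases "\<exists>i. hit \<eta> \<beta> i")
    case True
    then show ?thesis using c_hit by (auto simp: hit_def)
  qed (simp add: c_def i0)
  then obtain B where B: "stationary_in UNIV B"
    "\<forall>\<eta>. \<exists>j<\<theta>. \<forall>\<beta>\<in>B. \<eta> < \<beta> \<longrightarrow> c (\<eta>, \<beta>) \<noteq> j"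
    using not_onto_missing_colour[OF not_onto, of c] by blast
  obtain x where x: "x \<in> branching" "\<forall>y\<in>branching. (x, y) \<in> r \<longrightarrow> unbounded (B \<inter> above y)"
    using ex_dense_above[OF stationary_unbounded[OF B(1)]] by blast
  obtain \<eta> where \<eta>: "q \<eta> = x"
    using x(1) unfolding q[symmetric] by blast
  obtain j where j: "j < \<theta>" "\<forall>\<beta>\<in>B. \<eta> < \<beta> \<longrightarrow> c (\<eta>, \<beta>) \<noteq> j"
    using B(2) by blast
  have "unbounded (B \<inter> above (a x j))"
    using a x j(1) by blast
  then obtain \<beta> where \<beta>: "\<beta> \<in> B" "\<eta> < \<beta>" "\<beta> \<in> above (a x j)"
    unfolding unbounded_def by blast
  then have "hit \<eta> \<beta> j"
    using j(1) \<eta> by (simp add: hit_def above_def)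
  then show False
    using c_hit j(2) \<beta>(1,2) by blast
qed

end

section \<open>The square bracket relation and the conclusion\<close>

context not_onto_pair
begin

text \<open>Each row \<eta> misses a colour on \<open>B\<close>. As \<theta> is below \<kappa>, the
  same colour is missed for unboundedly many \<eta> in \<open>B\<close>, and these \<eta> form a set
  of size \<kappa> whose pairs omit that colour.\<close>

lemma not_negative_square_bracket: "\<not> negative_square_bracket \<theta>"
proof
  assume "negative_square_bracket \<theta>"
  then obtain c where c: "c \<in> (UNIV :: 'k set) \<circledast> UNIV \<rightarrow> {..<\<theta>}"
    "\<forall>B. |B| =o |UNIV :: 'k set| \<longrightarrow> c ` (B \<circledast> B) = {..<\<theta>}"
    unfolding negative_square_bracket_def by blast
  have "c (\<eta>, \<beta>) < \<theta>" if "\<eta> < \<beta>" for \<eta> \<beta>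
    using funcset_mem[OF c(1), of "(\<eta>, \<beta>)"] that by (simp add: circledast_def)
  then obtain B where B: "stationary_in UNIV B"
    "\<forall>\<eta>. \<exists>j<\<theta>. \<forall>\<beta>\<in>B. \<eta> < \<beta> \<longrightarrow> c (\<eta>, \<beta>) \<noteq> j"
    using not_onto_missing_colour[OF not_onto, of c] by blast
  then obtain J where J: "\<And>\<eta>. J \<eta> < \<theta>" "\<And>\<eta> \<beta>. \<beta> \<in> B \<Longrightarrow> \<eta> < \<beta> \<Longrightarrow> c (\<eta>, \<beta>) \<noteq> J \<eta>"
    by metis
  obtain i where i: "i < \<theta>" "unbounded {\<eta> \<in> B. J \<eta> = i}"
    using unbounded_pigeonhole[OF stationary_unbounded[OF B(1)] small_lessThan[of \<theta>], of J] J(1)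
    by auto
  have "c ` ({\<eta> \<in> B. J \<eta> = i} \<circledast> {\<eta> \<in> B. J \<eta> = i}) = {..<\<theta>}"
    using c(2) unbounded_card[OF i(2)] by blast
  then have "i \<in> c ` ({\<eta> \<in> B. J \<eta> = i} \<circledast> {\<eta> \<in> B. J \<eta> = i})"
    using i(1) by simp
  then obtain \<eta> \<beta> where "\<eta> \<in> B" "J \<eta> = i" "\<beta> \<in> B" "\<eta> < \<beta>" "c (\<eta>, \<beta>) = i"
    by (auto simp: circledast_def)
  then show False using J(2) by blast
qed

lemma no_Souslin_tree: "\<not> Souslin_tree TYPE('k) (r :: 'b rel)"
proof
  assume "Souslin_tree TYPE('k) r"
  then interpret souslin \<theta> r
    by unfold_locales (simp_all add: Souslin_tree_def)
  show False using onto not_onto by contradiction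
qed

end

theorem theoremD:
  fixes \<theta> :: "'k::wellorder"
  assumes "infinite_regular (UNIV :: 'k set)"
    and "\<theta> \<in> Reg"
    and "\<not> onto_NS \<theta>"
  shows "greatly_Mahlo TYPE('k)
    \<and> \<not> diamond_star (Reg :: 'k set)
    \<and> stationary_Refl (Reg :: 'k set)
    \<and> (\<forall>\<mu> :: 'k. cardinal {..<\<mu>} \<longrightarrow> \<not> square \<mu>)
    \<and> \<not> negative_square_bracket \<theta>
    \<and> (\<nexists>r :: 'b rel. Souslin_tree TYPE('k) r)"
proof -
  interpret not_onto_pair \<theta>
    using assms by unfold_locales
  show ?thesis
    using greatly_Mahlo not_diamond_star stationary_Refl not_square not_negative_square_bracket
      no_Souslin_tree by blast
qed

end
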